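(* Fix $\epsilon>0$. Let $p=p(n)\in(0,1)$ satisfy $p=o(n^{-2/3})$, let $k=k(n)$ be an integer satisfying $0\le k\le(1-\epsilon)\binom n3p^3$, and let $\theta=\theta(n,p,k):=\frac{6k}{n^3p^3}$ and $\mu:=\binom n3p^3$. Let $X$ denote the number of triangles in the random graph $G(n,p)$. Then, as $n\to\infty$, $$\mathbb P[X=k]=(1+o(1))\,\frac{\mu^ke^{-\mu}}{k!}\exp\left(\frac{(1-\theta)^2}{4}n^4p^5-\frac{(1-\theta)^2(2\theta+7)}{12}n^5p^7\right).$$
   Context: $G(n,p)$ is the Erdős–Rényi random graph on $n$ labeled vertices in which each of the $\binom n2$ pairs is an edge independently with probability $p$. Note $\mu=\mathbb E[X]$. All asymptotics are as $n\to\infty$. *)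

theory Defs
  imports
    "HOL-Probability.Probability"
    "HOL-Library.Landau_Symbols"
    "HOL-Library.Ramsey"
begin

text \<open>
  Graphs on the vertex set \<open>{1..n}\<close> are represented by their edge sets, i.e. by sets of
  two-element subsets of \<open>{1..n}\<close>; \<open>nsets A r\<close> is the set of \<open>r\<close>-element subsets of \<open>A\<close>.

  In \<open>erdos_renyi n p\<close> the product distribution assigns to each vertex pair an independent
  Bernoulli(\<open>p\<close>) indicator; pairs outside the complete graph get the dummy value \<open>False\<close>.
\<close>

definition erdos_renyi :: "nat \<Rightarrow> real \<Rightarrow> nat set set pmf" where
  "erdos_renyi n p =
     map_pmf (\<lambda>b. {e \<in> nsets {1..n} 2. b e})
       (Pi_pmf (nsets {1..n} 2) False (\<lambda>_. bernoulli_pmf p))"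

definition triangles :: "nat \<Rightarrow> nat set set \<Rightarrow> nat set set" where
  "triangles n E = {T \<in> nsets {1..n} 3. nsets T 2 \<subseteq> E}"

definition num_triangles :: "nat \<Rightarrow> nat set set \<Rightarrow> nat" where
  "num_triangles n E = card (triangles n E)"

definition mu :: "nat \<Rightarrow> real \<Rightarrow> real" where
  "mu n p = real (n choose 3) * p ^ 3"

definition theta :: "nat \<Rightarrow> real \<Rightarrow> nat \<Rightarrow> real" where
  "theta n p k = 6 * real k / (real n ^ 3 * p ^ 3)"

end

theory Submission
  imports Defs
begin

text \<open>
  Let \<open>q k\<close> be the probability of exactly \<open>k\<close> triangles and \<open>x = n p\<^sup>2\<close>. Planting a triangle gives
  \<open>(k + 1) q (k + 1) = \<mu> P(X(G \<union> T) = k + 1)\<close>. Expanding the right-hand side by the number of further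
  triangles created by the planted edges, and treating the cherries responsible for them as
  planted edges in turn, yields a recursion between \<open>q (k + 1)\<close>, \<open>q k\<close>, \<open>q (k - 1)\<close>, \<open>q (k - 2)\<close>
  with relative error \<open>O(1/n)\<close>; this is affordable since \<open>\<mu>/n \<le> n\<^sup>2 p\<^sup>3 \<rightarrow> 0\<close>. Harris' inequality bounds all
  error terms by \<open>P(X \<le> k)\<close>, and the crudest form of the recursion shows that this is \<open>O(q k)\<close> in the lower
  tail. Taking logarithms and summing over \<open>k\<close> gives \<open>q k / q 0\<close>. Finally, the same expansion evaluates
  Russo's formula for the derivative of \<open>ln (q 0)\<close> in \<open>p\<close>, which is integrated from \<open>0\<close>.
\<close>

section \<open>Product Bernoulli expectations\<close>

text \<open>At the edge of the range, \<open>p\<close> near \<open>n^(-2/3)\<close>, the parameter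
  \<open>x\<close>, roughly the mean number of common neighbours of a pair, is of order
  \<open>n^(-1/3)\<close>. Terms in \<open>x\<close> and \<open>x^2\<close> then exceed the budget
  \<open>1/n\<close> per step of \<open>k\<close>, while \<open>x^3\<close> meets it: this fixes the
  order of the expansions. A pivotal pair is held to the tighter \<open>p^2 = x/n\<close>, because
  some \<open>n^2/2\<close> pairs integrated over \<open>p\<close> must again give
  \<open>n^2 p^3\<close>; this costs one more order. The event of exactly \<open>k\<close> triangles
  is not monotone, so Harris' inequality cannot be applied to it. Errors are bounded through
  decreasing events "at most \<open>k\<close>" instead, so they come out as multiples of
  \<open>cdf k\<close>, and being in the lower tail is what turns these into multiples of
  \<open>q k\<close>. Both halves of the proof meet in one function \<open>\<Phi>\<close>: the sum
  over \<open>k\<close> contributes \<open>\<Phi> (k/m) - \<Phi> 0\<close> beside the Poisson terms,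
  the triangle-free probability contributes about \<open>\<Phi> 0 - m\<close>, and
  \<open>\<Phi> 0\<close> cancels. The numerical constants are generous; what matters is that they
  depend on neither \<open>n\<close> nor \<open>k\<close>.\<close>

definition bern_exp :: "real \<Rightarrow> 'a set \<Rightarrow> ('a set \<Rightarrow> real) \<Rightarrow> real" where
  "bern_exp p E f = (\<Sum>A\<in>Pow E. p ^ card A * (1 - p) ^ card (E - A) * f A)"

lemma bern_exp_empty [simp]: "bern_exp p {} f = f {}"
  by (simp add: bern_exp_def)

lemma bern_exp_insert:
  assumes "finite E" "e \<notin> E"
  shows "bern_exp p (insert e E) f =
    (1 - p) * bern_exp p E f + p * bern_exp p E (\<lambda>A. f (insert e A))"
proof -
  let ?w = "\<lambda>A. p ^ card A * (1 - p) ^ card (insert e E - A) * f A"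
  have inj: "inj_on (insert e) (Pow E)"
    using assms(2) by (auto simp: inj_on_def)
  have "bern_exp p (insert e E) f = sum ?w (Pow E \<union> insert e ` Pow E)"
    by (simp add: bern_exp_def Pow_insert)
  also have "\<dots> = sum ?w (Pow E) + sum ?w (insert e ` Pow E)"
    using assms by (intro sum.union_disjoint) auto
  also have "sum ?w (insert e ` Pow E) = (\<Sum>A\<in>Pow E. ?w (insert e A))"
    by (simp add: sum.reindex[OF inj])
  also have "sum ?w (Pow E) = (1 - p) * bern_exp p E f"
    unfolding bern_exp_def sum_distrib_left
  proof (rule sum.cong[OF refl])
    fix A assume "A \<in> Pow E"
    then have "insert e E - A = insert e (E - A)" "e \<notin> E - A" "finite (E - A)"
      using assms by auto
    then show "?w A = (1 - p) * (p ^ card A * (1 - p) ^ card (E - A) * f A)"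
      by simp
  qed
  also have "(\<Sum>A\<in>Pow E. ?w (insert e A)) = p * bern_exp p E (\<lambda>A. f (insert e A))"
    unfolding bern_exp_def sum_distrib_left
  proof (rule sum.cong[OF refl])
    fix A assume A: "A \<in> Pow E"
    then have "insert e E - insert e A = E - A" "e \<notin> A" "finite A"
      using assms finite_subset by auto
    then show "?w (insert e A) = p * (p ^ card A * (1 - p) ^ card (E - A) * f (insert e A))"
      by simp
  qed
  finally show ?thesis .
qed

lemma bern_exp_cong:
  assumes "\<And>A. A \<subseteq> E \<Longrightarrow> f A = g A"
  shows "bern_exp p E f = bern_exp p E g"
  using assms by (auto simp: bern_exp_def intro!: sum.cong)

lemma bern_exp_add: "bern_exp p E (\<lambda>A. f A + g A) = bern_exp p E f + bern_exp p E g"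
  by (simp add: bern_exp_def sum.distrib algebra_simps)

lemma bern_exp_diff: "bern_exp p E (\<lambda>A. f A - g A) = bern_exp p E f - bern_exp p E g"
  by (simp add: bern_exp_def sum_subtractf algebra_simps)

lemma bern_exp_cmult: "bern_exp p E (\<lambda>A. c * f A) = c * bern_exp p E f"
  by (simp add: bern_exp_def sum_distrib_left algebra_simps)

lemma bern_exp_sum: "bern_exp p E (\<lambda>A. \<Sum>i\<in>I. f i A) = (\<Sum>i\<in>I. bern_exp p E (f i))"
  unfolding bern_exp_def sum_distrib_left by (rule sum.swap)

lemma bern_exp_mono:
  assumes "0 \<le> p" "p \<le> 1" "\<And>A. A \<subseteq> E \<Longrightarrow> f A \<le> g A"
  shows "bern_exp p E f \<le> bern_exp p E g"
  unfolding bern_exp_def using assms by (intro sum_mono mult_left_mono) auto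

lemma bern_exp_nonneg:
  assumes "0 \<le> p" "p \<le> 1" "\<And>A. A \<subseteq> E \<Longrightarrow> 0 \<le> f A"
  shows "0 \<le> bern_exp p E f"
  unfolding bern_exp_def using assms by (intro sum_nonneg mult_nonneg_nonneg) auto

lemma bern_exp_abs_le:
  assumes "0 \<le> p" "p \<le> 1" "\<And>A. A \<subseteq> E \<Longrightarrow> \<bar>f A\<bar> \<le> g A"
  shows "\<bar>bern_exp p E f\<bar> \<le> bern_exp p E g"
proof -
  have "bern_exp p E f \<le> bern_exp p E g"
    using assms by (intro bern_exp_mono) (auto simp: abs_le_iff)
  moreover have "(-1) * bern_exp p E f \<le> bern_exp p E g"
    unfolding bern_exp_cmult[symmetric] using assms by (intro bern_exp_mono) (auto simp: abs_le_iff)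
  ultimately show ?thesis by linarith
qed

lemma bern_exp_const:
  assumes "finite E"
  shows "bern_exp p E (\<lambda>_. c) = c"
  using assms by induction (auto simp: bern_exp_insert algebra_simps)

text \<open>Revealing one element at a time reduces this to the two-point space, where the
  covariance is \<open>p (1 - p)\<close> times the product of the increments of \<open>f\<close> and
  \<open>g\<close>, which have opposite signs.\<close>

lemma harris:
  assumes "finite E" "0 \<le> p" "p \<le> 1"
    and "\<And>A B. A \<subseteq> B \<Longrightarrow> B \<subseteq> E \<Longrightarrow> f A \<le> f B"
    and "\<And>A B. A \<subseteq> B \<Longrightarrow> B \<subseteq> E \<Longrightarrow> g B \<le> g A"
  shows "bern_exp p E (\<lambda>A. f A * g A) \<le> bern_exp p E f * bern_exp p E g"
  using assms(1,4,5)
proof (induction arbitrary: f g)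
  case (insert e E)
  let ?E = "bern_exp p E"
  let ?f = "\<lambda>A. f (insert e A)" and ?g = "\<lambda>A. g (insert e A)"
  have le: "?E f \<le> ?E ?f" "?E ?g \<le> ?E g"
    using assms(2,3) by (auto intro!: bern_exp_mono insert.prems)
  have 0: "?E (\<lambda>A. f A * g A) \<le> ?E f * ?E g"
    by (intro insert.IH insert.prems) auto
  have 1: "?E (\<lambda>A. ?f A * ?g A) \<le> ?E ?f * ?E ?g"
    by (intro insert.IH insert.prems) auto
  have "bern_exp p (insert e E) (\<lambda>A. f A * g A) \<le> (1 - p) * (?E f * ?E g) + p * (?E ?f * ?E ?g)"
    unfolding bern_exp_insert[OF insert.hyps(1,2)]
    using 0 1 assms(2,3) by (intro add_mono mult_left_mono) auto
  also have "\<dots> = ((1 - p) * ?E f + p * ?E ?f) * ((1 - p) * ?E g + p * ?E ?g)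
      - p * (1 - p) * ((?E ?f - ?E f) * (?E g - ?E ?g))"
    by (simp add: algebra_simps)
  also have "\<dots> \<le> ((1 - p) * ?E f + p * ?E ?f) * ((1 - p) * ?E g + p * ?E ?g)"
    using le assms(2,3) by simp
  finally show ?case
    by (simp add: bern_exp_insert[OF insert.hyps(1,2)])
qed simp

lemma bern_exp_plant_single:
  assumes "finite E" "e \<in> E"
  shows "bern_exp p E (\<lambda>A. of_bool (e \<in> A) * g (A - {e})) = p * bern_exp p E (\<lambda>A. g (A - {e}))"
proof -
  define E' where "E' = E - {e}"
  have E: "E = insert e E'" "e \<notin> E'" "finite E'"
    using assms by (auto simp: E'_def)
  have "bern_exp p E' (\<lambda>A. of_bool (e \<in> A) * g (A - {e})) = bern_exp p E' (\<lambda>_. 0)"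
    using E by (intro bern_exp_cong) auto
  moreover have "bern_exp p E' (\<lambda>A. of_bool (e \<in> insert e A) * g (insert e A - {e})) = bern_exp p E' g"
    using E(2) by (intro bern_exp_cong) (auto intro!: arg_cong[of _ _ g])
  moreover have "bern_exp p E' (\<lambda>A. g (A - {e})) = bern_exp p E' g"
    using E(2) by (intro bern_exp_cong arg_cong[of _ _ g]) auto
  moreover have "bern_exp p E' (\<lambda>A. g (insert e A - {e})) = bern_exp p E' g"
    using E(2) by (intro bern_exp_cong) (auto intro!: arg_cong[of _ _ g])
  ultimately show ?thesis
    using E by (simp add: bern_exp_insert bern_exp_const algebra_simps)
qed

text \<open>Evaluating \<open>g\<close> at \<open>A - S\<close> expresses that \<open>g\<close>
  ignores \<open>S\<close>, hence is independent of the presence of \<open>S\<close>. This is the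
  device that trades "these edges are present" for "these edges are planted".\<close>

lemma bern_exp_plant:
  assumes "finite E" "S \<subseteq> E"
  shows "bern_exp p E (\<lambda>A. of_bool (S \<subseteq> A) * g (A - S)) = p ^ card S * bern_exp p E (\<lambda>A. g (A - S))"
proof -
  have "finite S" using assms finite_subset by auto
  then show ?thesis using assms(2)
  proof (induction arbitrary: g)
    case empty
    then show ?case by simp
  next
    case (insert e S)
    let ?h = "\<lambda>A. of_bool (S \<subseteq> A) * g (A - S)"
    have "bern_exp p E (\<lambda>A. of_bool (insert e S \<subseteq> A) * g (A - insert e S))
        = bern_exp p E (\<lambda>A. of_bool (S \<subseteq> A) * (of_bool (e \<in> A - S) * g ((A - S) - {e})))"
      using insert.hyps by (intro bern_exp_cong) (auto simp: set_diff_eq intro!: arg_cong[of _ _ g])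
    also have "\<dots> = p ^ card S * bern_exp p E (\<lambda>A. of_bool (e \<in> A - S) * g ((A - S) - {e}))"
      using insert by (subst insert.IH) auto
    also have "bern_exp p E (\<lambda>A. of_bool (e \<in> A - S) * g ((A - S) - {e}))
        = bern_exp p E (\<lambda>A. of_bool (e \<in> A) * g ((A - {e}) - S))"
      using insert.hyps by (intro bern_exp_cong) (auto simp: set_diff_eq intro!: arg_cong[of _ _ g])
    also have "\<dots> = p * bern_exp p E (\<lambda>A. g ((A - {e}) - S))"
      using insert.prems assms by (subst bern_exp_plant_single[where g = "\<lambda>A. g (A - S)"]) auto
    also have "(\<lambda>A. g ((A - {e}) - S)) = (\<lambda>A. g (A - insert e S))"
      by (metis Diff_insert2)
    finally show ?case
      using insert.hyps by simp
  qed
qed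

lemma bern_exp_subset:
  assumes "finite E" "S \<subseteq> E"
  shows "bern_exp p E (\<lambda>A. of_bool (S \<subseteq> A)) = p ^ card S"
  using bern_exp_plant[OF assms, of p "\<lambda>_. 1"] assms by (simp add: bern_exp_const)

lemma bern_exp_disjoint:
  assumes "finite E" "R \<subseteq> E"
  shows "bern_exp p E (\<lambda>A. of_bool (A \<inter> R = {}) * g (A - R)) = (1 - p) ^ card R * bern_exp p E (\<lambda>A. g (A - R))"
proof -
  have "finite R" using assms finite_subset by auto
  then show ?thesis using assms(2)
  proof (induction arbitrary: g)
    case empty
    then show ?case by simp
  next
    case (insert e R)
    have "bern_exp p E (\<lambda>A. of_bool (A \<inter> insert e R = {}) * g (A - insert e R))
        = bern_exp p E (\<lambda>A. of_bool (A \<inter> R = {}) * (of_bool (e \<notin> A - R) * g ((A - R) - {e})))"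
      using insert.hyps by (intro bern_exp_cong) (auto simp: set_diff_eq intro!: arg_cong[of _ _ g])
    also have "\<dots> = (1 - p) ^ card R * bern_exp p E (\<lambda>A. of_bool (e \<notin> A - R) * g ((A - R) - {e}))"
      using insert by (subst insert.IH) auto
    also have "bern_exp p E (\<lambda>A. of_bool (e \<notin> A - R) * g ((A - R) - {e}))
        = bern_exp p E (\<lambda>A. g ((A - {e}) - R) - of_bool (e \<in> A) * g ((A - {e}) - R))"
      using insert.hyps by (intro bern_exp_cong) (auto simp: set_diff_eq intro!: arg_cong[of _ _ g])
    also have "\<dots> = (1 - p) * bern_exp p E (\<lambda>A. g ((A - {e}) - R))"
      unfolding bern_exp_diff
      using insert.prems assms
      by (subst bern_exp_plant_single[where g = "\<lambda>A. g (A - R)"]) (auto simp: algebra_simps)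
    also have "(\<lambda>A. g ((A - {e}) - R)) = (\<lambda>A. g (A - insert e R))"
      by (metis Diff_insert2)
    finally show ?case
      using insert.hyps by simp
  qed
qed

text \<open>Russo's formula for an arbitrary \<open>f\<close>. As \<open>bern_exp\<close> is a
  polynomial in \<open>p\<close>, no bound on \<open>p\<close> is required; this later yields
  continuity at \<open>p = 0\<close>, where the integration starts.\<close>

lemma DERIV_bern_exp:
  assumes "finite E"
  shows "((\<lambda>p. bern_exp p E f) has_real_derivative
    (\<Sum>e\<in>E. bern_exp p E (\<lambda>A. f (insert e A) - f (A - {e})))) (at p)"
  using assms
proof (induction arbitrary: f)
  case empty
  show ?case by simp
next
  case (insert e E)
  have e: "bern_exp q E (\<lambda>A. f (insert e A - {e})) = bern_exp q E f"
    "bern_exp q E (\<lambda>A. f (A - {e})) = bern_exp q E f" for q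
    using insert.hyps by (auto intro!: bern_exp_cong arg_cong[of _ _ f])
  have D: "((\<lambda>p. (1 - p) * bern_exp p E f + p * bern_exp p E (\<lambda>A. f (insert e A))) has_real_derivative
     (0 - 1) * bern_exp p E f + (1 - p) * (\<Sum>d\<in>E. bern_exp p E (\<lambda>A. f (insert d A) - f (A - {d})))
     + (1 * bern_exp p E (\<lambda>A. f (insert e A))
       + p * (\<Sum>d\<in>E. bern_exp p E (\<lambda>A. f (insert e (insert d A)) - f (insert e (A - {d})))))) (at p)"
    by (rule derivative_eq_intros insert.IH insert.IH[of "\<lambda>A. f (insert e A)"] refl | simp)+
  have eq: "bern_exp p E (\<lambda>A. f (insert d (insert e A)) - f (insert e A - {d}))
      = bern_exp p E (\<lambda>A. f (insert e (insert d A)) - f (insert e (A - {d})))" if "d \<in> E" for d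
    using insert.hyps that
    by (intro bern_exp_cong arg_cong2[of _ _ _ _ "(-)"] arg_cong[of _ _ f]) auto
  have sum_eq: "(\<Sum>d\<in>E. bern_exp p E (\<lambda>A. f (insert d (insert e A)) - f (insert e A - {d})))
      = (\<Sum>d\<in>E. bern_exp p E (\<lambda>A. f (insert e (insert d A)) - f (insert e (A - {d}))))"
    by (rule sum.cong[OF refl eq])
  have e_eq: "bern_exp p E (\<lambda>A. f (insert e A) - f (A - {e})) = bern_exp p E (\<lambda>A. f (insert e A)) - bern_exp p E f"
    "bern_exp p E (\<lambda>A. f (insert e (insert e A)) - f (insert e A - {e})) = bern_exp p E (\<lambda>A. f (insert e A)) - bern_exp p E f"
    by (simp_all add: bern_exp_diff e)
  show ?case
    unfolding bern_exp_insert[OF insert.hyps(1,2)]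
  proof (rule DERIV_cong[OF D])
    show "(0 - 1) * bern_exp p E f + (1 - p) * (\<Sum>d\<in>E. bern_exp p E (\<lambda>A. f (insert d A) - f (A - {d})))
     + (1 * bern_exp p E (\<lambda>A. f (insert e A))
       + p * (\<Sum>d\<in>E. bern_exp p E (\<lambda>A. f (insert e (insert d A)) - f (insert e (A - {d})))))
     = (\<Sum>d\<in>insert e E. (1 - p) * bern_exp p E (\<lambda>A. f (insert d A) - f (A - {d})) +
          p * bern_exp p E (\<lambda>A. f (insert d (insert e A)) - f (insert e A - {d})))"
      unfolding sum.insert[OF insert.hyps(1,2)] sum.distrib sum_distrib_left[symmetric]
      unfolding sum_eq e_eq by (simp add: algebra_simps)
  qed
qed

section \<open>Transfer to the random graph\<close>

lemma prob_Pi_bernoulli: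
  assumes "finite E" "0 \<le> p" "p \<le> 1"
  shows "measure_pmf.expectation (map_pmf (\<lambda>b. {e \<in> E. b e}) (Pi_pmf E False (\<lambda>_. bernoulli_pmf p))) f
    = bern_exp p E f"
  using assms(1)
proof (induction arbitrary: f)
  case empty
  then show ?case by simp
next
  case (insert e E)
  let ?M = "map_pmf (\<lambda>b. {e \<in> E. b e}) (Pi_pmf E False (\<lambda>_. bernoulli_pmf p))"
  have fin: "finite (set_pmf ?M)"
    by (rule finite_subset[of _ "Pow E"]) (use insert.hyps in auto)
  have "map_pmf (\<lambda>b. {d \<in> insert e E. b d}) (Pi_pmf (insert e E) False (\<lambda>_. bernoulli_pmf p))
      = map_pmf (\<lambda>(b, A). if b then insert e A else A) (pair_pmf (bernoulli_pmf p) ?M)"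
    using insert.hyps
    by (simp add: Pi_pmf_insert pair_map_pmf2 pmf.map_comp o_def)
       (rule map_pmf_cong[OF refl], auto split: if_splits)
  also have "\<dots> = bernoulli_pmf p \<bind> (\<lambda>b. map_pmf (\<lambda>A. if b then insert e A else A) ?M)"
    by (simp add: pair_pmf_def map_bind_pmf map_pmf_def bind_assoc_pmf bind_return_pmf)
  finally have eq: "map_pmf (\<lambda>b. {d \<in> insert e E. b d}) (Pi_pmf (insert e E) False (\<lambda>_. bernoulli_pmf p))
      = bernoulli_pmf p \<bind> (\<lambda>b. map_pmf (\<lambda>A. if b then insert e A else A) ?M)" .
  have "measure_pmf.expectation (bernoulli_pmf p \<bind> (\<lambda>b. map_pmf (\<lambda>A. if b then insert e A else A) ?M)) f
     = measure_pmf.expectation (bernoulli_pmf p)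
        (\<lambda>b. measure_pmf.expectation (map_pmf (\<lambda>A. if b then insert e A else A) ?M) f)"
    by (subst pmf_expectation_bind[where A = UNIV])
       (use fin assms in \<open>auto simp: integral_measure_pmf_real[where A = UNIV] UNIV_bool\<close>)
  also have "\<dots> = (1 - p) * bern_exp p E f + p * bern_exp p E (\<lambda>A. f (insert e A))"
    using assms(2,3) insert.IH[of f] insert.IH[of "\<lambda>A. f (insert e A)"] by (simp add: algebra_simps)
  finally show ?case
    by (simp only: eq bern_exp_insert[OF insert.hyps(1,2)])
qed

lemma prob_erdos_renyi:
  assumes "0 \<le> p" "p \<le> 1"
  shows "measure_pmf.prob (erdos_renyi n p) {E. P E} = bern_exp p (nsets {1..n} 2) (\<lambda>A. of_bool (P A))"
proof -
  have "(\<lambda>A. of_bool (P A)) = (indicator {E. P E} :: _ \<Rightarrow> real)"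
    by (auto simp: indicator_def)
  then have "measure_pmf.prob (erdos_renyi n p) {E. P E} = measure_pmf.expectation (erdos_renyi n p) (\<lambda>A. of_bool (P A))"
    by simp
  then show ?thesis
    unfolding erdos_renyi_def
    by (simp only: prob_Pi_bernoulli[OF finite_imp_finite_nsets[OF finite_atLeastAtMost] assms])
qed

section \<open>Planted edges and new triangles\<close>

definition cherry :: "nat set \<Rightarrow> nat \<Rightarrow> nat set set" where
  "cherry e y = (\<lambda>a. {a, y}) ` e"

text \<open>In the planted model the pairs inside \<open>V\<close> are not random, so a third vertex
  in \<open>V\<close> contributes an amount determined by \<open>S\<close> alone. Only third
  vertices outside \<open>V\<close> carry randomness.\<close>

definition common_nbrs :: "nat \<Rightarrow> nat set \<Rightarrow> nat set \<Rightarrow> nat set set \<Rightarrow> nat" where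
  "common_nbrs n V e A = card {y \<in> {1..n} - V. cherry e y \<subseteq> A}"

text \<open>The planted model: pairs inside \<open>V\<close> are present exactly if they lie in
  \<open>S\<close>, all others are random. Subtracting the triangles of \<open>S\<close> itself lets
  the same \<open>k\<close> be used for different planted sets. Integers avoid truncated
  subtraction.\<close>

definition new_triangles :: "nat \<Rightarrow> nat set \<Rightarrow> nat set set \<Rightarrow> nat set set \<Rightarrow> int" where
  "new_triangles n V S A =
     int (num_triangles n ((A - nsets V 2) \<union> S)) - int (num_triangles n S)"

lemma nsets_insert_cherry:
  assumes "card e = 2" "y \<notin> e"
  shows "nsets (insert y e) 2 = insert e (cherry e y)"
proof -
  obtain a b where ab: "e = {a, b}" "a \<noteq> b"
    using assms(1) by (auto simp: card_2_iff)
  have "nsets {y, a, b} 2 = {{y, a}, {y, b}, {a, b}}"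
    using ab assms(2) by (auto simp: nsets_def card_2_iff doubleton_eq_iff)
  then show ?thesis
    using ab by (auto simp: cherry_def insert_commute)
qed

lemma card_nsets_triple: "card T = 3 \<Longrightarrow> card (nsets T 2) = 3"
  by (simp add: card_nsets choose_two)

lemma finite_triangles: "finite (triangles n A)"
  by (auto simp: triangles_def intro: finite_subset[OF _ finite_imp_finite_nsets])

lemma triangles_mono: "A \<subseteq> B \<Longrightarrow> triangles n A \<subseteq> triangles n B"
  by (auto simp: triangles_def)

lemma num_triangles_mono: "A \<subseteq> B \<Longrightarrow> num_triangles n A \<le> num_triangles n B"
  unfolding num_triangles_def by (intro card_mono finite_triangles triangles_mono)

lemma num_triangles_insert:
  assumes e: "e \<in> nsets {1..n} 2" and "e \<notin> B"
  shows "num_triangles n (insert e B) =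
    num_triangles n B + card {y \<in> {1..n} - e. cherry e y \<subseteq> B}"
proof -
  let ?Y = "{y \<in> {1..n} - e. cherry e y \<subseteq> B}"
  have e': "card e = 2" "e \<subseteq> {1..n}" "finite e"
    using e by (auto simp: nsets_def)
  have "triangles n (insert e B) = triangles n B \<union> (\<lambda>y. insert y e) ` ?Y"
  proof (intro equalityI subsetI)
    fix T assume T: "T \<in> triangles n (insert e B)"
    show "T \<in> triangles n B \<union> (\<lambda>y. insert y e) ` ?Y"
    proof (cases "e \<in> nsets T 2")
      case False
      then show ?thesis using T by (auto simp: triangles_def)
    next
      case True
      then have "e \<subseteq> T" "card T = 3" "finite T" "T \<subseteq> {1..n}"
        using T by (auto simp: nsets_def triangles_def)
      then have "card (T - e) = 1" using e' by (simp add: card_Diff_subset)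
      then obtain y where y: "T - e = {y}" by (auto simp: card_1_singleton_iff)
      then have Ty: "T = insert y e" "y \<notin> e" "y \<in> {1..n}"
        using \<open>e \<subseteq> T\<close> \<open>T \<subseteq> {1..n}\<close> by auto
      have "e \<notin> cherry e y" using Ty by (auto simp: cherry_def)
      moreover have "cherry e y \<subseteq> insert e B"
        using T nsets_insert_cherry[OF e'(1) Ty(2)] unfolding triangles_def Ty(1) by auto
      ultimately show ?thesis using Ty by auto
    qed
  next
    fix T assume "T \<in> triangles n B \<union> (\<lambda>y. insert y e) ` ?Y"
    then show "T \<in> triangles n (insert e B)"
    proof
      assume "T \<in> triangles n B"
      then show ?thesis using triangles_mono[of B "insert e B" n] by auto
    next
      assume "T \<in> (\<lambda>y. insert y e) ` ?Y"
      then obtain y where y: "T = insert y e" "y \<in> {1..n}" "y \<notin> e" "cherry e y \<subseteq> B" by auto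
      then have "nsets T 2 = insert e (cherry e y)" using nsets_insert_cherry e' by auto
      then show ?thesis
        using y e' by (auto simp: triangles_def nsets_def)
    qed
  qed
  moreover have "triangles n B \<inter> (\<lambda>y. insert y e) ` ?Y = {}"
    using assms(2) e' by (auto simp: triangles_def nsets_insert_cherry)
  moreover have "inj_on (\<lambda>y. insert y e) ?Y"
    by (auto simp: inj_on_def)
  ultimately show ?thesis
    unfolding num_triangles_def
    by (simp add: card_Un_disjoint finite_triangles card_image)
qed

lemma cherry_facts:
  assumes "e \<in> nsets V 2" "y \<notin> V"
  shows "card (cherry e y) = 2" "cherry e y \<subseteq> nsets (insert y V) 2"
    "cherry e y \<inter> nsets V 2 = {}" "cherry e y \<noteq> {}" "finite (cherry e y)"
proof -
  obtain a b where ab: "e = {a, b}" "a \<noteq> b" "a \<in> V" "b \<in> V"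
    using assms(1) by (auto simp: nsets_def card_2_iff)
  then show "card (cherry e y) = 2" "cherry e y \<subseteq> nsets (insert y V) 2"
    "cherry e y \<inter> nsets V 2 = {}" "cherry e y \<noteq> {}" "finite (cherry e y)"
    using assms(2) by (auto simp: cherry_def nsets_def card_2_iff doubleton_eq_iff)
qed

text \<open>The triangles completed by \<open>e\<close> split by their third vertex. In
  \<open>V\<close>, both other edges must lie in \<open>S\<close>, and the triangle is absorbed by
  the subtracted term; outside \<open>V\<close>, both are random, because a cherry at such a vertex
  avoids the pairs of \<open>V\<close>.\<close>

lemma new_triangles_insert:
  assumes V: "V \<subseteq> {1..n}" and S: "S \<subseteq> nsets V 2" and e: "e \<in> nsets V 2" "e \<notin> S"
  shows "new_triangles n V (insert e S) A = new_triangles n V S A + int (common_nbrs n V e A)"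
proof -
  let ?B = "(A - nsets V 2) \<union> S"
  have en: "e \<in> nsets {1..n} 2" using e V nsets_mono by blast
  have eV: "e \<subseteq> V" "card e = 2" "finite e" using e by (auto simp: nsets_def)
  have split: "{y \<in> {1..n} - e. cherry e y \<subseteq> ?B}
     = {y \<in> {1..n} - e. cherry e y \<subseteq> S} \<union> {y \<in> {1..n} - V. cherry e y \<subseteq> A}"
  proof (intro set_eqI iffI)
    fix y assume y: "y \<in> {y \<in> {1..n} - e. cherry e y \<subseteq> ?B}"
    show "y \<in> {y \<in> {1..n} - e. cherry e y \<subseteq> S} \<union> {y \<in> {1..n} - V. cherry e y \<subseteq> A}"
    proof (cases "y \<in> V")
      case True
      then have "cherry e y \<subseteq> nsets V 2"
        using eV y by (auto simp: cherry_def nsets_def card_2_iff)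
      then show ?thesis using y by auto
    next
      case False
      then show ?thesis using y S cherry_facts(3)[OF e(1) False] by auto
    qed
  next
    fix y assume y: "y \<in> {y \<in> {1..n} - e. cherry e y \<subseteq> S} \<union> {y \<in> {1..n} - V. cherry e y \<subseteq> A}"
    then show "y \<in> {y \<in> {1..n} - e. cherry e y \<subseteq> ?B}"
      using eV cherry_facts(3)[OF e(1), of y] by auto
  qed
  have disj: "{y \<in> {1..n} - e. cherry e y \<subseteq> S} \<inter> {y \<in> {1..n} - V. cherry e y \<subseteq> A} = {}"
    using S cherry_facts(3,4)[OF e(1)] by blast
  have "card {y \<in> {1..n} - e. cherry e y \<subseteq> ?B}
      = card {y \<in> {1..n} - e. cherry e y \<subseteq> S} + common_nbrs n V e A"
    unfolding split common_nbrs_def by (rule card_Un_disjoint) (use disj in auto)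
  moreover have "num_triangles n (insert e ?B) = num_triangles n ?B + card {y \<in> {1..n} - e. cherry e y \<subseteq> ?B}"
    using e by (intro num_triangles_insert en) auto
  moreover have "num_triangles n (insert e S) = num_triangles n S + card {y \<in> {1..n} - e. cherry e y \<subseteq> S}"
    using e by (intro num_triangles_insert en) auto
  ultimately show ?thesis
    by (simp add: new_triangles_def)
qed

section \<open>Planting a set of cherries\<close>

definition cherries :: "nat set \<Rightarrow> nat set \<Rightarrow> nat set set" where
  "cherries e Z = (\<Union>y\<in>Z. cherry e y)"

lemma cherries_facts:
  assumes "e \<in> nsets V 2" "Z \<inter> V = {}" "finite Z"
  shows "card (cherries e Z) = 2 * card Z" "cherries e Z \<subseteq> nsets (V \<union> Z) 2"
    "cherries e Z \<inter> nsets V 2 = {}" "finite (cherries e Z)"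
proof -
  have Z: "y \<notin> V" if "y \<in> Z" for y using assms(2) that by auto
  have disj: "cherry e y \<inter> cherry e y' = {}" if "y \<in> Z" "y' \<in> Z" "y \<noteq> y'" for y y'
    using assms(1) Z[OF that(1)] Z[OF that(2)] that(3)
    by (auto simp: cherry_def nsets_def doubleton_eq_iff)
  have "card (cherries e Z) = (\<Sum>y\<in>Z. card (cherry e y))"
    unfolding cherries_def
    using assms(3) disj cherry_facts(5)[OF assms(1) Z] by (intro card_UN_disjoint) auto
  also have "\<dots> = 2 * card Z" using cherry_facts(1)[OF assms(1) Z] by simp
  finally show "card (cherries e Z) = 2 * card Z" .
  show "cherries e Z \<subseteq> nsets (V \<union> Z) 2"
  proof -
    have "cherry e y \<subseteq> nsets (V \<union> Z) 2" if "y \<in> Z" for y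
      using cherry_facts(2)[OF assms(1) Z[OF that]] nsets_mono[of "insert y V" "V \<union> Z" 2] that
      by blast
    then show ?thesis by (auto simp: cherries_def)
  qed
  show "cherries e Z \<inter> nsets V 2 = {}"
    using cherry_facts(3)[OF assms(1) Z] by (auto simp: cherries_def)
  show "finite (cherries e Z)"
    using assms(3) cherry_facts(5)[OF assms(1) Z] by (auto simp: cherries_def)
qed

text \<open>A vertex of \<open>Z\<close> is joined only to the two ends of \<open>e\<close>, so a
  triangle through it would have to use \<open>e\<close>, which is not planted yet. This is why the
  cherries of \<open>e\<close> are planted before \<open>e\<close>.\<close>

lemma num_triangles_cherries:
  assumes S: "S \<subseteq> nsets V 2" and e: "e \<in> nsets V 2" "e \<notin> S" and Z: "Z \<inter> V = {}"
  shows "num_triangles n (S \<union> cherries e Z) = num_triangles n S"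
proof -
  have eV: "e \<subseteq> V" "card e = 2" "finite e" using e by (auto simp: nsets_def)
  have "T \<in> triangles n S" if T: "T \<in> triangles n (S \<union> cherries e Z)" for T
  proof -
    have T3: "finite T" "card T = 3" "nsets T 2 \<subseteq> S \<union> cherries e Z"
      using T by (auto simp: triangles_def nsets_def)
    have nbr: "a \<in> e" if "y \<in> T" "a \<in> T" "y \<noteq> a" "y \<in> Z" for y a
    proof -
      have "{y, a} \<in> nsets T 2" using that by simp
      then have "{y, a} \<in> S \<union> cherries e Z" using T3 by blast
      moreover have "{y, a} \<notin> S" using S Z that by (auto simp: nsets_def)
      ultimately obtain y' a' where "{y, a} = {a', y'}" "a' \<in> e" "y' \<in> Z"
        by (auto simp: cherries_def cherry_def)
      then show ?thesis using that Z eV by (auto simp: doubleton_eq_iff)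
    qed
    have "T \<inter> Z = {}"
    proof (rule ccontr)
      assume "T \<inter> Z \<noteq> {}"
      then obtain y where y: "y \<in> T" "y \<in> Z" by auto
      have "T - {y} \<subseteq> e" using nbr[OF y(1)] y by auto
      moreover have "card (T - {y}) = 2" using T3 y by simp
      ultimately have "T - {y} = e" using eV by (simp add: card_subset_eq)
      then have "e \<in> nsets T 2" using eV by (auto simp: nsets_def)
      moreover have "e \<notin> cherries e Z"
        using eV Z by (auto simp: cherries_def cherry_def)
      ultimately show False using T3 e by auto
    qed
    then have "nsets T 2 \<inter> cherries e Z = {}"
      by (auto simp: cherries_def cherry_def nsets_def)
    then show ?thesis using T T3 by (auto simp: triangles_def)
  qed
  then have "triangles n (S \<union> cherries e Z) = triangles n S"
    using triangles_mono[of S "S \<union> cherries e Z" n] by auto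
  then show ?thesis by (simp add: num_triangles_def)
qed

lemma num_triangles_triple:
  assumes "T \<in> nsets {1..n} 3"
  shows "num_triangles n (nsets T 2) = 1"
proof -
  have "U = T" if U: "U \<in> nsets {1..n} 3" "nsets U 2 \<subseteq> nsets T 2" for U
  proof -
    have c: "finite U" "card U = 3" "finite T" "card T = 3" using U assms by (auto simp: nsets_def)
    have "U \<subseteq> T"
    proof
      fix a assume a: "a \<in> U"
      have "card (U - {a}) = 2" using c a by simp
      then obtain b where "b \<in> U" "b \<noteq> a" by (metis Diff_iff card.empty equals0I insertCI zero_neq_numeral)
      then have "{a, b} \<in> nsets U 2" using a by simp
      then have "{a, b} \<in> nsets T 2" using U by blast
      then show "a \<in> T" by simp
    qed
    then show ?thesis using c by (simp add: card_subset_eq)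
  qed
  then have "triangles n (nsets T 2) = {T}"
    using assms by (auto simp: triangles_def)
  then show ?thesis by (simp add: num_triangles_def)
qed

text \<open>Binomial moments are preferred to powers because counting \<open>j\<close>-sets is
  linear in indicators of prescribed edge sets, and each of those can be planted.\<close>

lemma common_nbrs_choose:
  "real (common_nbrs n V e A choose j) =
    (\<Sum>Z\<in>nsets ({1..n} - V) j. of_bool (cherries e Z \<subseteq> A))"
proof -
  let ?W = "{y \<in> {1..n} - V. cherry e y \<subseteq> A}"
  have "real (common_nbrs n V e A choose j) = real (card (nsets ?W j))"
    by (simp add: common_nbrs_def card_nsets)
  also have "nsets ?W j = {Z \<in> nsets ({1..n} - V) j. cherries e Z \<subseteq> A}"
    by (auto simp: nsets_def cherries_def)
  also have "real (card \<dots>) = (\<Sum>Z\<in>nsets ({1..n} - V) j. of_bool (cherries e Z \<subseteq> A))"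
    by (simp add: finite_imp_finite_nsets of_bool_def sum.If_cases Int_def)
  finally show ?thesis .
qed

section \<open>Expansions for planted edges\<close>

lemma choose_two_real: "real (N choose 2) = real N * (real N - 1) / 2"
  by (simp add: binomial_gbinomial gbinomial_prod_rev eval_nat_numeral)

lemma choose_three_real: "real (N choose 3) = real N * (real N - 1) * (real N - 2) / 6"
  by (simp add: binomial_gbinomial gbinomial_prod_rev eval_nat_numeral)

section \<open>Truncated Newton and Bonferroni expansions of indicators\<close>

lemma abs_indicator_shift0:
  fixes Y k :: int and N :: nat
  shows "\<bar>of_bool (Y + int N = k) - of_bool (Y = k)\<bar> \<le> real (N choose 1) * of_bool (Y \<le> k)"
  by (cases "N = 0") (auto simp: of_bool_def)

text \<open>Newton expansion in the shift \<open>N\<close>, exact for \<open>N \<le> 1\<close>; the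
  factor 2 is attained at \<open>N = 2\<close>, \<open>Y = k - 1\<close>. For \<open>Y > k\<close>
  every indicator vanishes, so the error may carry the decreasing event \<open>Y \<le> k\<close> on
  which Harris' inequality relies.\<close>

lemma abs_indicator_shift1:
  fixes Y k :: int and N :: nat
  shows "\<bar>of_bool (Y + int N = k) - of_bool (Y = k)
      - real (N choose 1) * (of_bool (Y = k - 1) - of_bool (Y = k))\<bar>
    \<le> 2 * real (N choose 2) * of_bool (Y \<le> k)"
proof -
  consider "N = 0" | "N = 1" | "N \<ge> 2" by linarith
  then show ?thesis
  proof cases
    case 3
    have "2 * real (N choose 2) = real N * (real N - 1)"
      using 3 by (simp add: choose_two_real)
    moreover have "real N * 1 \<le> real N * (real N - 1)"
      using 3 by (intro mult_left_mono) auto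
    ultimately have "2 * real (N choose 2) \<ge> real N" by simp
    then show ?thesis using 3 by (auto simp: of_bool_def)
  qed (auto simp: of_bool_def)
qed

lemma abs_indicator_shift2:
  fixes Y k :: int and N :: nat
  shows "\<bar>of_bool (Y + int N = k) - of_bool (Y = k)
      - real (N choose 1) * (of_bool (Y = k - 1) - of_bool (Y = k))
      - real (N choose 2) * (of_bool (Y = k - 2) - 2 * of_bool (Y = k - 1) + of_bool (Y = k))\<bar>
    \<le> 3 * real (N choose 3) * of_bool (Y \<le> k)"
proof -
  consider "N = 0" | "N = 1" | "N = 2" | "N \<ge> 3" by linarith
  then show ?thesis
  proof cases
    case 4
    define M C2 C3 r where "M = real N * real N" "C2 = real (N choose 2)" "C3 = real (N choose 3)" "r = real N"
    note defs = this
    have "2 * C2 = M - r"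
      by (simp add: defs choose_two_real field_simps)
    \<comment> \<open>\<open>M - 2 * r\<close> is the absolute value of the left-hand side at
      \<open>Y = k - 1\<close>, its maximum over \<open>Y\<close>. Equality at \<open>N = 3\<close>
      explains the factor 3.\<close>
    moreover have "3 * C3 \<ge> M - 2 * r"
    proof -
      have "real N * (real N - 2) * 2 \<le> real N * (real N - 2) * (real N - 1)"
        using 4 by (intro mult_left_mono) auto
      moreover have "6 * real (N choose 3) = real N * (real N - 1) * (real N - 2)"
        by (simp add: choose_three_real)
      ultimately show ?thesis by (simp add: defs algebra_simps)
    qed
    moreover have "M \<ge> 3 * r"
      using 4 by (simp add: defs mult_right_mono)
    moreover have "r \<ge> 3" "real (N choose 1) = r" "N \<noteq> 0" "N \<noteq> 1" "N \<noteq> 2" using 4 by (auto simp: defs)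
    ultimately show ?thesis
      unfolding defs(2,3)[symmetric] by (auto simp: of_bool_def abs_le_iff)
  qed (auto simp: of_bool_def eval_nat_numeral)
qed

text \<open>Bonferroni: after one further term the alternating sum leaves exactly
  \<open>N - 1 choose 4\<close>, which lies between 0 and \<open>N choose 4\<close>.\<close>

lemma abs_indicator_pos:
  fixes N :: nat
  shows "\<bar>of_bool (N \<noteq> 0) - real (N choose 1) + real (N choose 2) - real (N choose 3)\<bar>
    \<le> real (N choose 4)"
proof -
  have s: "of_bool (N \<noteq> 0) - real (N choose 1) + real (N choose 2) - real (N choose 3) + real (N choose 4)
     = real (N - 1 choose 4)"
  proof (cases N)
    case (Suc m)
    show ?thesis
      unfolding Suc by (simp add: eval_nat_numeral)
  qed (simp add: binomial_eq_0)
  show ?thesis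
  proof (cases N)
    case (Suc m)
    have "real (m choose 4) \<le> real (Suc m choose 4)" by (simp add: eval_nat_numeral)
    then show ?thesis using s unfolding Suc by simp
  qed (simp add: binomial_eq_0)
qed

text \<open>\<open>dens\<close> is the bound \<open>p \<le> n^(-2/3)\<close>. Planted vertex sets
  have at most five vertices (a triangle and two more, or a pair and three more), whence
  \<open>n_ge\<close>; they span at most ten pairs, and \<open>p_le\<close> makes the probability
  that ten pairs are all absent at least 1/2.\<close>

locale sparse_gnp =
  fixes n :: nat and p :: real
  assumes p_pos: "0 < p" and p_le: "p \<le> 1 / 20" and dens: "real n ^ 2 * p ^ 3 \<le> 1" and n_ge: "n \<ge> 5"
begin

abbreviation "K \<equiv> nsets {1..n} 2"
abbreviation "\<E> f \<equiv> bern_exp p K f"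

definition x :: real where "x = real n * p ^ 2"

text \<open>Indices are integers so that \<open>q (k - 1)\<close> and \<open>q (k - 2)\<close> vanish, as they should, for small \<open>k\<close>.\<close>

definition q :: "int \<Rightarrow> real" where "q k = \<E> (\<lambda>A. of_bool (int (num_triangles n A) = k))"
definition cdf :: "int \<Rightarrow> real" where "cdf k = \<E> (\<lambda>A. of_bool (int (num_triangles n A) \<le> k))"

definition F :: "nat set \<Rightarrow> nat set set \<Rightarrow> int \<Rightarrow> real" where
  "F V S k = \<E> (\<lambda>A. of_bool (new_triangles n V S A = k))"

lemmas [simp] = finite_imp_finite_nsets

lemma finite_K: "finite K"
  by simp

lemma p01: "0 \<le> p" "p \<le> 1" using p_pos p_le by auto

lemma x_pos: "0 < x" using p_pos n_ge by (simp add: x_def)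

lemma x_sq: "x\<^sup>2 \<le> p"
proof -
  have "x\<^sup>2 = (real n ^ 2 * p ^ 3) * p" by (simp add: x_def power2_eq_square power3_eq_cube)
  also have "\<dots> \<le> 1 * p" using dens p_pos by (intro mult_right_mono) auto
  finally show ?thesis by simp
qed

lemma x_le: "x \<le> 1"
proof (rule power2_le_imp_le)
  show "x\<^sup>2 \<le> 1\<^sup>2" using x_sq p01 by simp
qed simp

lemma xp_le: "x * p \<le> 1 / n"
proof -
  have "x * p * n = real n ^ 2 * p ^ 3" by (simp add: x_def power2_eq_square power3_eq_cube)
  then show ?thesis using dens n_ge by (simp add: field_simps)
qed

lemma x3_le: "x ^ 3 \<le> 1 / n"
proof -
  have "x ^ 3 = x\<^sup>2 * x" by (simp add: power2_eq_square power3_eq_cube)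
  also have "\<dots> \<le> p * x" using x_sq x_pos by (intro mult_right_mono) auto
  finally show ?thesis using xp_le by (simp add: mult.commute)
qed

lemma p2_le: "p\<^sup>2 \<le> 1 / n"
  using x_le n_ge by (simp add: x_def field_simps)

lemma p2_le_p: "p\<^sup>2 \<le> p"
  using p01 by (simp add: power2_eq_square mult_left_le)

section \<open>Comparison of planted and unplanted distributions\<close>

lemma cdf_nonneg: "0 \<le> cdf k"
  unfolding cdf_def by (intro bern_exp_nonneg p01) auto

lemma cdf_mono: "k \<le> l \<Longrightarrow> cdf k \<le> cdf l"
  unfolding cdf_def by (intro bern_exp_mono p01) auto

lemma q_nonneg: "0 \<le> q k"
  unfolding q_def by (intro bern_exp_nonneg p01) auto

lemma q_le_cdf: "q k \<le> cdf k"
  unfolding q_def cdf_def by (intro bern_exp_mono p01) auto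

lemma new_triangles_mono: "A \<subseteq> B \<Longrightarrow> new_triangles n V S A \<le> new_triangles n V S B"
  using num_triangles_mono[of "(A - nsets V 2) \<union> S" "(B - nsets V 2) \<union> S" n]
  by (auto simp: new_triangles_def)

lemma new_triangles_empty: "new_triangles n V {} A = int (num_triangles n (A - nsets V 2))"
proof -
  have "triangles n {} = {}"
    by (auto simp: triangles_def nsets_eq_empty_iff) (auto simp: nsets_def)
  then show ?thesis by (simp add: new_triangles_def num_triangles_def)
qed

lemma finite_planted: "V \<subseteq> {1..n} \<Longrightarrow> S \<subseteq> nsets V 2 \<Longrightarrow> finite S"
  by (meson finite_atLeastAtMost finite_imp_finite_nsets finite_subset)

lemma new_triangles_ge:
  assumes "V \<subseteq> {1..n}" "S \<subseteq> nsets V 2"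
  shows "new_triangles n V S A \<ge> int (num_triangles n (A - nsets V 2))"
proof -
  have "finite S" using finite_planted assms by blast
  then show ?thesis using assms(2)
  proof (induction rule: finite_induct)
    case (insert e S)
    then show ?case using new_triangles_insert[OF assms(1), of S e A] by simp
  qed (simp add: new_triangles_empty)
qed

lemma card_pairs_le:
  assumes "V \<subseteq> {1..n}" "card V \<le> 5"
  shows "card (nsets V 2) \<le> 10"
proof -
  have "card V * (card V - 1) \<le> 5 * 4" using assms by (intro mult_mono) auto
  then show ?thesis by (simp add: choose_two)
qed

text \<open>Dropping all pairs inside \<open>V\<close> can only lose new triangles, and the
  resulting graph is the unplanted one conditioned on these pairs being absent. That condition has
  probability at least 1/2, which is the factor 2.\<close>

lemma planted_cdf_le:
  assumes V: "V \<subseteq> {1..n}" "card V \<le> 5" and S: "S \<subseteq> nsets V 2"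
  shows "\<E> (\<lambda>A. of_bool (new_triangles n V S A \<le> k)) \<le> 2 * cdf k"
proof -
  let ?R = "nsets V 2"
  let ?g = "\<lambda>A. of_bool (int (num_triangles n A) \<le> k) :: real"
  have R: "?R \<subseteq> K" using V nsets_mono by blast
  have "\<E> (\<lambda>A. of_bool (new_triangles n V S A \<le> k)) \<le> \<E> (\<lambda>A. ?g (A - ?R))"
    using new_triangles_ge[OF V(1) S] by (intro bern_exp_mono p01) (auto intro: order_trans)
  moreover have "(1 - p) ^ card ?R * \<E> (\<lambda>A. ?g (A - ?R)) \<le> cdf k"
    unfolding bern_exp_disjoint[OF finite_K R, of p ?g, symmetric] cdf_def
    by (intro bern_exp_mono p01) (auto simp: Diff_triv)
  moreover have "1 / 2 \<le> (1 - p) ^ card ?R"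
  proof -
    have "1 + real (card ?R) * (- p) \<le> (1 + - p) ^ card ?R"
      by (rule Bernoulli_inequality) (use p01 in auto)
    moreover have "real (card ?R) * p \<le> 10 * (1 / 20)"
      using card_pairs_le[OF V] p_le p01 by (intro mult_mono) auto
    ultimately show ?thesis by simp
  qed
  moreover have "0 \<le> \<E> (\<lambda>A. ?g (A - ?R))" by (intro bern_exp_nonneg p01) auto
  ultimately show ?thesis
    using mult_right_mono[of "1 / 2" "(1 - p) ^ card ?R" "\<E> (\<lambda>A. ?g (A - ?R))"] by linarith
qed

lemma harris_planted:
  assumes V: "V \<subseteq> {1..n}" "card V \<le> 5" and S: "S \<subseteq> nsets V 2"
    and f: "\<And>A B. A \<subseteq> B \<Longrightarrow> B \<subseteq> K \<Longrightarrow> f A \<le> f B" "\<And>A. 0 \<le> f A"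
  shows "\<E> (\<lambda>A. f A * of_bool (new_triangles n V S A \<le> k)) \<le> \<E> f * (2 * cdf k)"
proof -
  have "\<E> (\<lambda>A. f A * of_bool (new_triangles n V S A \<le> k))
      \<le> \<E> f * \<E> (\<lambda>A. of_bool (new_triangles n V S A \<le> k))"
    using f by (intro harris p01) (auto dest: new_triangles_mono[where V = V and S = S])
  also have "\<dots> \<le> \<E> f * (2 * cdf k)"
    using planted_cdf_le[OF V S] f by (intro mult_left_mono bern_exp_nonneg p01) auto
  finally show ?thesis .
qed

text \<open>Deleting the pairs inside \<open>V\<close> matters only if one of them lies in a
  triangle: at most ten pairs, \<open>n\<close> third vertices and probability \<open>p^3\<close>
  give \<open>10 n p^3 = 10 x p\<close>. Harris' inequality doubles this.\<close>

lemma F_empty: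
  assumes V: "V \<subseteq> {1..n}" "card V \<le> 5"
  shows "\<bar>F V {} k - q k\<bar> \<le> 20 * x * p * cdf k"
proof -
  let ?R = "nsets V 2"
  let ?f = "\<lambda>A. \<Sum>r\<in>?R. \<Sum>y\<in>{1..n} - r. of_bool (insert r (cherry r y) \<subseteq> A) :: real"
  have R: "?R \<subseteq> K" using V nsets_mono by blast
  have finR: "finite ?R" using R finite_subset finite_K by blast
  have pt: "\<bar>of_bool (new_triangles n V {} A = k) - of_bool (int (num_triangles n A) = k)\<bar>
      \<le> ?f A * of_bool (new_triangles n V {} A \<le> k)" for A
  proof (cases "num_triangles n (A - ?R) = num_triangles n A")
    case True
    then show ?thesis by (auto simp: new_triangles_empty intro!: mult_nonneg_nonneg sum_nonneg)
  next
    case False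
    then have "\<not> triangles n A \<subseteq> triangles n (A - ?R)"
      using triangles_mono[of "A - ?R" A n] by (auto simp: num_triangles_def)
    then obtain T where T: "T \<in> triangles n A" "T \<notin> triangles n (A - ?R)" by auto
    then obtain r where r: "r \<in> nsets T 2" "r \<in> ?R" by (auto simp: triangles_def)
    then have "r \<subseteq> T" "card T = 3" "finite T" "T \<subseteq> {1..n}" "card r = 2" "finite r"
      using T by (auto simp: nsets_def triangles_def)
    then have "card (T - r) = 1" by (simp add: card_Diff_subset)
    then obtain y where y: "T - r = {y}" by (auto simp: card_1_singleton_iff)
    then have Ty: "T = insert y r" "y \<notin> r" "y \<in> {1..n}"
      using \<open>r \<subseteq> T\<close> \<open>T \<subseteq> {1..n}\<close> by auto
    have A: "insert r (cherry r y) \<subseteq> A"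
      using T nsets_insert_cherry[OF \<open>card r = 2\<close> Ty(2)] by (simp add: triangles_def Ty(1))
    have "1 \<le> (\<Sum>y\<in>{1..n} - r. of_bool (insert r (cherry r y) \<subseteq> A) :: real)"
      using member_le_sum[of y "{1..n} - r" "\<lambda>y. of_bool (insert r (cherry r y) \<subseteq> A) :: real"] Ty A
      by auto
    also have "\<dots> \<le> ?f A"
      using r finR by (intro member_le_sum) (auto intro: sum_nonneg)
    finally have f1: "1 \<le> ?f A" .
    have "num_triangles n (A - ?R) \<le> num_triangles n A" by (intro num_triangles_mono) auto
    then show ?thesis using f1 by (auto simp: new_triangles_empty of_bool_def)
  qed
  have "\<bar>F V {} k - q k\<bar> \<le> \<E> (\<lambda>A. ?f A * of_bool (new_triangles n V {} A \<le> k))"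
    unfolding F_def q_def bern_exp_diff[symmetric]
    by (intro bern_exp_abs_le p01 pt)
  also have "\<dots> \<le> \<E> ?f * (2 * cdf k)"
    by (intro harris_planted V sum_mono sum_nonneg) auto
  also have "\<E> ?f \<le> 10 * x * p"
  proof -
    have c: "\<E> (\<lambda>A. of_bool (insert r (cherry r y) \<subseteq> A)) = p ^ 3" if "r \<in> ?R" "y \<in> {1..n} - r" for r y
    proof -
      have r: "card r = 2" "r \<subseteq> {1..n}" "finite r" using that V by (auto simp: nsets_def)
      have eq: "insert r (cherry r y) = nsets (insert y r) 2"
        using nsets_insert_cherry r that by auto
      have "insert y r \<subseteq> {1..n}" "card (insert y r) = 3" using r that by auto
      then show ?thesis
        unfolding eq using nsets_mono[of "insert y r" "{1..n}" 2]
        by (subst bern_exp_subset) (auto simp: choose_two)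
    qed
    have "\<E> ?f = (\<Sum>r\<in>?R. \<Sum>y\<in>{1..n} - r. p ^ 3)"
      unfolding bern_exp_sum by (intro sum.cong refl c) auto
    also have "\<dots> \<le> (\<Sum>r\<in>?R. real n * p ^ 3)"
    proof (rule sum_mono)
      fix r
      have "card ({1..n} - r) \<le> card {1..n}" by (intro card_mono) auto
      then show "(\<Sum>y\<in>{1..n} - r. p ^ 3) \<le> real n * p ^ 3" using p01 by (simp add: mult_right_mono)
    qed
    also have "\<dots> \<le> 10 * (real n * p ^ 3)"
      using card_pairs_le[OF V] p01
      by (simp add: mult_right_mono del: card_nsets)
    also have "\<dots> = 10 * x * p" by (simp add: x_def power2_eq_square power3_eq_cube)
    finally show ?thesis .
  qed
  finally show ?thesis using cdf_nonneg[of k] by (simp add: mult_right_mono)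
qed

text \<open>Asking for the cherries amounts to planting them. The error comes from the pairs inside
  \<open>V \<union> Z\<close> that are neither pairs of \<open>V\<close> nor planted: each of them is present only with probability \<open>p\<close>.\<close>

lemma plant_cherries:
  assumes V: "V \<subseteq> {1..n}" and S: "S \<subseteq> nsets V 2" and e: "e \<in> nsets V 2" "e \<notin> S"
    and Z: "Z \<subseteq> {1..n} - V" "card V + card Z \<le> 5"
  shows "\<bar>\<E> (\<lambda>A. of_bool (cherries e Z \<subseteq> A) * of_bool (new_triangles n V S A = k))
      - p ^ (2 * card Z) * F (V \<union> Z) (S \<union> cherries e Z) k\<bar>
    \<le> p ^ (2 * card Z) * (2 * p * card (nsets (V \<union> Z) 2 - nsets V 2 - cherries e Z) * cdf k)"
proof -
  let ?C = "cherries e Z" and ?R = "nsets V 2" and ?R' = "nsets (V \<union> Z) 2"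
  let ?D = "?R' - ?R - ?C"
  let ?S = "S \<union> ?C"
  have finZ: "finite Z" using Z finite_subset by auto
  have ZV: "Z \<inter> V = {}" using Z by auto
  note C = cherries_facts[OF e(1) ZV finZ]
  have VZ: "V \<union> Z \<subseteq> {1..n}" using V Z by auto
  have R'K: "?R' \<subseteq> K" using VZ nsets_mono by blast
  have CK: "?C \<subseteq> K" using C R'K by auto
  have RR': "?R \<subseteq> ?R'" by (intro nsets_mono) auto
  have cVZ: "card (V \<union> Z) \<le> 5" using Z card_Un_le[of V Z] by linarith
  have SR': "?S \<subseteq> ?R'" using S RR' C by auto
  have step: "\<E> (\<lambda>A. of_bool (?C \<subseteq> A) * of_bool (new_triangles n V S A = k))
     = p ^ (2 * card Z) * \<E> (\<lambda>A. of_bool (new_triangles n V S (A \<union> ?C) = k))"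
  proof -
    have "\<E> (\<lambda>A. of_bool (?C \<subseteq> A) * of_bool (new_triangles n V S A = k))
       = \<E> (\<lambda>A. of_bool (?C \<subseteq> A) * of_bool (new_triangles n V S ((A - ?C) \<union> ?C) = k))"
      by (intro bern_exp_cong) (auto simp: Un_absorb2)
    also have "\<dots> = p ^ (2 * card Z) * \<E> (\<lambda>A. of_bool (new_triangles n V S ((A - ?C) \<union> ?C) = k))"
      by (subst bern_exp_plant[where g = "\<lambda>B. of_bool (new_triangles n V S (B \<union> ?C) = k)"])
         (use CK C in auto)
    finally show ?thesis by simp
  qed
  \<comment> \<open>Hence the offsets subtracted in \<open>new_triangles\<close> agree for
    \<open>S\<close> and for \<open>S\<close> with its cherries, and \<open>k\<close> is not
    shifted.\<close>
  have ntC: "num_triangles n ?S = num_triangles n S"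
    by (rule num_triangles_cherries[OF S e ZV])
  have eq: "new_triangles n (V \<union> Z) ?S A = new_triangles n V S (A \<union> ?C)" if "A \<inter> ?D = {}" for A
  proof -
    have "(A - ?R') \<union> ?S = ((A \<union> ?C) - ?R) \<union> S" using that C RR' S by auto
    then show ?thesis by (simp add: new_triangles_def ntC)
  qed
  \<comment> \<open>By this inequality, \<open>k\<close> new triangles in the first model force at
    most \<open>k\<close> in the second, so both indicators are dominated by one decreasing
    event.\<close>
  have le: "new_triangles n (V \<union> Z) ?S A \<le> new_triangles n V S (A \<union> ?C)" for A
  proof -
    have "(A - ?R') \<union> ?S \<subseteq> ((A \<union> ?C) - ?R) \<union> S" using C RR' S by auto
    then show ?thesis using num_triangles_mono by (simp add: new_triangles_def ntC)
  qed
  have finD: "finite ?D" "?D \<subseteq> K" using R'K finite_K finite_subset by blast+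
  have pt: "\<bar>of_bool (new_triangles n V S (A \<union> ?C) = k) - of_bool (new_triangles n (V \<union> Z) ?S A = k)\<bar>
     \<le> (\<Sum>d\<in>?D. of_bool ({d} \<subseteq> A)) * (of_bool (new_triangles n (V \<union> Z) ?S A \<le> k) :: real)" for A
  proof (cases "A \<inter> ?D = {}")
    case True
    then show ?thesis by (simp add: eq sum_nonneg)
  next
    case False
    then obtain d where d: "d \<in> ?D" "d \<in> A" by auto
    have "(1::real) \<le> (\<Sum>d\<in>?D. of_bool ({d} \<subseteq> A))"
      using d finD member_le_sum[of d ?D "\<lambda>d. of_bool ({d} \<subseteq> A) :: real"] by auto
    then show ?thesis using le[of A] by (auto simp: of_bool_def)
  qed
  have "\<bar>\<E> (\<lambda>A. of_bool (new_triangles n V S (A \<union> ?C) = k)) - F (V \<union> Z) ?S k\<bar>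
     \<le> \<E> (\<lambda>A. (\<Sum>d\<in>?D. of_bool ({d} \<subseteq> A)) * of_bool (new_triangles n (V \<union> Z) ?S A \<le> k))"
    unfolding F_def bern_exp_diff[symmetric] by (intro bern_exp_abs_le p01 pt)
  also have "\<dots> \<le> \<E> (\<lambda>A. \<Sum>d\<in>?D. of_bool ({d} \<subseteq> A)) * (2 * cdf k)"
    by (intro harris_planted VZ cVZ SR' sum_mono sum_nonneg) auto
  also have "\<E> (\<lambda>A. \<Sum>d\<in>?D. of_bool ({d} \<subseteq> A)) = (\<Sum>d\<in>?D. p)"
    unfolding bern_exp_sum
  proof (rule sum.cong[OF refl])
    fix d assume "d \<in> ?D"
    then have "{d} \<subseteq> K" using finD by auto
    from bern_exp_subset[OF finite_K this] show "\<E> (\<lambda>A. of_bool ({d} \<subseteq> A)) = p" by simp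
  qed
  finally have fin: "\<bar>\<E> (\<lambda>A. of_bool (new_triangles n V S (A \<union> ?C) = k)) - F (V \<union> Z) ?S k\<bar>
     \<le> 2 * p * card ?D * cdf k"
    by (simp add: algebra_simps)
  show ?thesis
    unfolding step right_diff_distrib[symmetric] abs_mult
    using fin p01 by (simp add: mult_left_mono)
qed

section \<open>Binomial moments of the number of common neighbours\<close>

lemma choose_le_power: "real (m choose j) \<le> real m ^ j"
proof (cases "j \<le> m")
  case True
  then show ?thesis using binomial_le_pow[OF True] by (metis of_nat_le_iff of_nat_power)
qed (simp add: binomial_eq_0)

lemma choose_cherries_le:
  assumes "m \<le> n"
  shows "real (m choose j) * p ^ (2 * j) \<le> x ^ j"
proof -
  have "real (m choose j) \<le> real m ^ j" by (rule choose_le_power)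
  also have "\<dots> \<le> real n ^ j" using assms by (intro power_mono) auto
  finally have "real (m choose j) * p ^ (2 * j) \<le> real n ^ j * p ^ (2 * j)"
    using p01 by (intro mult_right_mono) auto
  then show ?thesis by (simp add: x_def power_mult_distrib power_mult)
qed

lemma moment_le:
  assumes V: "V \<subseteq> {1..n}" "card V \<le> 5" and S: "S \<subseteq> nsets V 2" and e: "e \<in> nsets V 2"
  shows "\<E> (\<lambda>A. real (common_nbrs n V e A choose j) * of_bool (new_triangles n V S A \<le> k))
    \<le> 2 * x ^ j * cdf k"
proof -
  let ?f = "\<lambda>A. \<Sum>Z\<in>nsets ({1..n} - V) j. of_bool (cherries e Z \<subseteq> A) :: real"
  have "\<E> (\<lambda>A. ?f A * of_bool (new_triangles n V S A \<le> k)) \<le> \<E> ?f * (2 * cdf k)"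
    by (intro harris_planted V S sum_mono sum_nonneg) auto
  also have "\<E> ?f = (\<Sum>Z\<in>nsets ({1..n} - V) j. p ^ (2 * j))"
    unfolding bern_exp_sum
  proof (rule sum.cong[OF refl])
    fix Z assume Z: "Z \<in> nsets ({1..n} - V) j"
    then have Z': "Z \<inter> V = {}" "finite Z" "card Z = j" "V \<union> Z \<subseteq> {1..n}"
      using V by (auto simp: nsets_def)
    note C = cherries_facts[OF e Z'(1,2)]
    have "cherries e Z \<subseteq> K" using C(2) nsets_mono[OF Z'(4)] by blast
    from bern_exp_subset[OF finite_K this, of p] show "\<E> (\<lambda>A. of_bool (cherries e Z \<subseteq> A)) = p ^ (2 * j)"
      using C(1) Z'(3) by simp
  qed
  also have "\<dots> = real (card ({1..n} - V) choose j) * p ^ (2 * j)" by simp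
  also have "\<dots> \<le> x ^ j"
  proof (rule choose_cherries_le)
    show "card ({1..n} - V) \<le> n" using card_mono[of "{1..n}" "{1..n} - V"] by auto
  qed
  finally show ?thesis
    unfolding common_nbrs_choose using cdf_nonneg[of k] by (simp add: mult_right_mono)
qed

lemma card_outside: "V \<subseteq> {1..n} \<Longrightarrow> card ({1..n} - V) = n - card V"
  by (subst card_Diff_subset) (auto intro: finite_subset)

definition M :: "nat set \<Rightarrow> nat set set \<Rightarrow> nat set \<Rightarrow> nat \<Rightarrow> int \<Rightarrow> real" where
  "M V S e j k = \<E> (\<lambda>A. real (common_nbrs n V e A choose j) * of_bool (new_triangles n V S A = k))"

text \<open>By linearity \<open>M\<close> is a sum over the possible sets \<open>Z\<close> of common
  neighbours, each term being a planted probability close to the common value \<open>a\<close>. The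
  number \<open>d\<close> of remaining pairs stays a parameter because the estimate for pivotal
  pairs depends on \<open>d = 0\<close>.\<close>

lemma M_approx:
  assumes V: "V \<subseteq> {1..n}" "card V + j \<le> 5" and S: "S \<subseteq> nsets V 2" and e: "e \<in> nsets V 2" "e \<notin> S"
    and a: "\<And>Z. Z \<subseteq> {1..n} - V \<Longrightarrow> card Z = j \<Longrightarrow> \<bar>F (V \<union> Z) (S \<union> cherries e Z) k - a\<bar> \<le> b"
    and d: "\<And>Z. Z \<subseteq> {1..n} - V \<Longrightarrow> card Z = j \<Longrightarrow> card (nsets (V \<union> Z) 2 - nsets V 2 - cherries e Z) \<le> d"
    and "0 \<le> b"
  shows "\<bar>M V S e j k - real (n - card V choose j) * p ^ (2 * j) * a\<bar> \<le> x ^ j * (b + 2 * d * p * cdf k)"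
proof -
  let ?I = "nsets ({1..n} - V) j"
  let ?c = "\<lambda>Z. \<E> (\<lambda>A. of_bool (cherries e Z \<subseteq> A) * of_bool (new_triangles n V S A = k))"
  have card_I: "card ?I = (n - card V) choose j" unfolding card_nsets card_outside[OF V(1)] ..
  have "M V S e j k = (\<Sum>Z\<in>?I. ?c Z)"
    unfolding M_def common_nbrs_choose sum_distrib_right bern_exp_sum ..
  then have "M V S e j k - real (n - card V choose j) * p ^ (2 * j) * a = (\<Sum>Z\<in>?I. ?c Z - p ^ (2 * j) * a)"
    using card_I by (simp add: sum_subtractf del: card_nsets)
  also have "\<bar>\<dots>\<bar> \<le> (\<Sum>Z\<in>?I. p ^ (2 * j) * (b + 2 * d * p * cdf k))"
  proof (intro order_trans[OF sum_abs] sum_mono)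
    fix Z assume "Z \<in> ?I"
    then have Z: "Z \<subseteq> {1..n} - V" "card Z = j" by (auto simp: nsets_def)
    have "\<bar>?c Z - p ^ (2 * j) * F (V \<union> Z) (S \<union> cherries e Z) k\<bar>
       \<le> p ^ (2 * j) * (2 * p * card (nsets (V \<union> Z) 2 - nsets V 2 - cherries e Z) * cdf k)"
      using plant_cherries[OF V(1) S e Z(1), of k] V(2) Z(2) by simp
    also have "\<dots> \<le> p ^ (2 * j) * (2 * p * d * cdf k)"
      using d[OF Z] p01 cdf_nonneg by (intro mult_left_mono mult_right_mono) auto
    finally have 1: "\<bar>?c Z - p ^ (2 * j) * F (V \<union> Z) (S \<union> cherries e Z) k\<bar> \<le> p ^ (2 * j) * (2 * p * d * cdf k)" .
    have 2: "\<bar>p ^ (2 * j) * F (V \<union> Z) (S \<union> cherries e Z) k - p ^ (2 * j) * a\<bar> \<le> p ^ (2 * j) * b"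
      unfolding right_diff_distrib[symmetric] abs_mult
      using a[OF Z] p01 by (simp add: mult_left_mono)
    show "\<bar>?c Z - p ^ (2 * j) * a\<bar> \<le> p ^ (2 * j) * (b + 2 * d * p * cdf k)"
      using 1 2 by (simp add: algebra_simps)
  qed
  also have "\<dots> = (real (n - card V choose j) * p ^ (2 * j)) * (b + 2 * d * p * cdf k)"
    using card_I by (simp del: card_nsets)
  also have "\<dots> \<le> x ^ j * (b + 2 * d * p * cdf k)"
    using assms(8) p01 cdf_nonneg[of k] by (intro mult_right_mono choose_cherries_le) auto
  finally show ?thesis by simp
qed

lemma card_extra_pairs:
  assumes "V \<subseteq> {1..n}" "Z \<subseteq> {1..n} - V" "card V + card Z \<le> 5"
  shows "card (nsets (V \<union> Z) 2 - nsets V 2 - cherries e Z) \<le> 10"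
proof -
  have "card (nsets (V \<union> Z) 2 - nsets V 2 - cherries e Z) \<le> card (nsets (V \<union> Z) 2)"
  proof (intro card_mono finite_imp_finite_nsets)
    show "finite (V \<union> Z)" by (rule finite_subset[of _ "{1..n}"]) (use assms in auto)
  qed auto
  also have "\<dots> \<le> 10"
    using assms card_Un_le[of V Z] by (intro card_pairs_le) auto
  finally show ?thesis .
qed

lemma M_approx':
  assumes V: "V \<subseteq> {1..n}" "card V + j \<le> 5" and S: "S \<subseteq> nsets V 2" and e: "e \<in> nsets V 2" "e \<notin> S"
    and a: "\<And>Z. Z \<subseteq> {1..n} - V \<Longrightarrow> card Z = j \<Longrightarrow> \<bar>F (V \<union> Z) (S \<union> cherries e Z) k - a\<bar> \<le> b"
    and "0 \<le> b"
  shows "\<bar>M V S e j k - real (n - card V choose j) * p ^ (2 * j) * a\<bar> \<le> x ^ j * (b + 20 * p * cdf k)"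
  using M_approx[OF V S e a, where d = 10] card_extra_pairs[OF V(1), of _ e] assms(7) V(2) by simp

lemma planted_facts:
  assumes V: "V \<subseteq> {1..n}" and S: "S \<subseteq> nsets V 2" and e: "e \<in> nsets V 2" "e \<notin> S"
    and Z: "Z \<subseteq> {1..n} - V"
  shows "V \<union> Z \<subseteq> {1..n}" "S \<union> cherries e Z \<subseteq> nsets (V \<union> Z) 2" "card (V \<union> Z) = card V + card Z"
    "card (S \<union> cherries e Z) = card S + 2 * card Z"
proof -
  have "finite V" "finite Z" by (rule finite_subset[of _ "{1..n}"]; use V Z in auto)+
  then have fin: "finite Z" "finite V" "finite S" using finite_planted[OF V S] by auto
  have d: "Z \<inter> V = {}" using Z by auto
  note C = cherries_facts[OF e(1) d fin(1)]
  show "V \<union> Z \<subseteq> {1..n}" using V Z by auto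
  show "S \<union> cherries e Z \<subseteq> nsets (V \<union> Z) 2" using S C(2) nsets_mono[of V "V \<union> Z" 2] by blast
  show "card (V \<union> Z) = card V + card Z" using fin d by (auto intro: card_Un_disjoint)
  show "card (S \<union> cherries e Z) = card S + 2 * card Z"
    using fin C S by (subst card_Un_disjoint) auto
qed

text \<open>The errors of the expansions of \<open>F V S k\<close> to order 0, 1, 2 in \<open>x\<close> are \<open>O(x)\<close>, \<open>O(p)\<close>, \<open>O(1/n)\<close>:
  since \<open>n\<^sup>2 p\<^sup>3 \<le> 1\<close>, one has \<open>x\<^sup>2 \<le> p\<close>, \<open>x p \<le> 1/n\<close> and \<open>x\<^sup>3 \<le> 1/n\<close>. Each is summed over the edges of \<open>S\<close>, added
  one at a time so that the cherries completing a new edge are pairwise disjoint.\<close>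

lemma F_level0:
  assumes V: "V \<subseteq> {1..n}" "card V \<le> 5" and S: "S \<subseteq> nsets V 2"
  shows "\<bar>F V S k - q k\<bar> \<le> 40 * x * cdf k"
proof -
  have fin: "finite S" using finite_planted V(1) S by blast
  then have "\<bar>F V S k - q k\<bar> \<le> (20 * x * p + 2 * x * card S) * cdf k" using S
  proof (induction rule: finite_induct)
    case empty
    then show ?case using F_empty[OF V, of k] by simp
  next
    case (insert e S)
    have "\<bar>F V (insert e S) k - F V S k\<bar>
       \<le> \<E> (\<lambda>A. real (common_nbrs n V e A choose 1) * of_bool (new_triangles n V S A \<le> k))"
      unfolding F_def bern_exp_diff[symmetric]
    proof (intro bern_exp_abs_le p01)
      fix A
      have nt: "new_triangles n V (insert e S) A = new_triangles n V S A + int (common_nbrs n V e A)"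
        using insert.prems insert.hyps by (intro new_triangles_insert V) auto
      show "\<bar>of_bool (new_triangles n V (insert e S) A = k) - of_bool (new_triangles n V S A = k)\<bar>
          \<le> real (common_nbrs n V e A choose 1) * of_bool (new_triangles n V S A \<le> k)"
        unfolding nt by (rule abs_indicator_shift0)
    qed
    also have "\<dots> \<le> 2 * x ^ 1 * cdf k" using insert.prems by (intro moment_le V) auto
    finally show ?case using insert by (simp add: algebra_simps)
  qed
  also have "\<dots> \<le> (40 * x) * cdf k"
  proof (intro mult_right_mono cdf_nonneg)
    have "card S \<le> 10" using card_mono[OF _ S] V card_pairs_le[OF V] finite_subset[of V "{1..n}"] by fastforce
    then have "2 * x * card S \<le> 2 * x * 10" using x_pos by (intro mult_left_mono) auto
    moreover have "20 * x * p \<le> 20 * x * 1" using x_pos p01 by (intro mult_left_mono) auto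
    ultimately show "20 * x * p + 2 * x * card S \<le> 40 * x" by linarith
  qed
  finally show ?thesis .
qed

lemma choose1_approx:
  assumes "m \<le> 5"
  shows "\<bar>real (n - m choose 1) * p\<^sup>2 - x\<bar> \<le> 5 * p\<^sup>2"
proof -
  have "real (n - m choose 1) * p\<^sup>2 - x = - (real m * p\<^sup>2)"
    using assms n_ge by (simp add: x_def of_nat_diff algebra_simps)
  then show ?thesis using assms by (simp add: mult_right_mono)
qed

lemma choose2_approx:
  assumes "m \<le> 5"
  shows "\<bar>real (n - m choose 2) * p ^ 4 - x\<^sup>2 / 2\<bar> \<le> 6 * x * p\<^sup>2"
proof -
  have "real (n - m choose 2) * p ^ 4 - x\<^sup>2 / 2 = ((real n - m) * (real n - m - 1) - n * n) / 2 * p ^ 4"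
  proof -
    have "real (n - m) = real n - real m" using assms n_ge by simp
    then show ?thesis unfolding choose_two_real
      by (simp only: x_def) (simp add: power2_eq_square power4_eq_xxxx field_simps)
  qed
  also have "\<bar>\<dots>\<bar> = \<bar>(real n - m) * (real n - m - 1) - n * n\<bar> / 2 * p ^ 4"
    by (simp add: abs_mult)
  also have "\<dots> \<le> (11 * n) / 2 * p ^ 4"
  proof (intro mult_right_mono divide_right_mono)
    have eq: "(real n - m) * (real n - m - 1) - n * n = real m * (m + 1) - real n * (2 * m + 1)"
      by (simp add: algebra_simps)
    have "real m * (m + 1) \<le> real n * (2 * m + 1)"
      using assms n_ge by (intro mult_mono) auto
    moreover have "real n * (2 * m + 1) \<le> real n * 11" using assms by (intro mult_left_mono) auto
    moreover have "0 \<le> real m * (m + 1)" by simp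
    ultimately show "\<bar>(real n - m) * (real n - m - 1) - n * n\<bar> \<le> 11 * n" unfolding eq by linarith
  qed auto
  also have "\<dots> \<le> (12 * n) / 2 * p ^ 4" by (intro mult_right_mono) auto
  also have "\<dots> = 6 * x * p\<^sup>2" by (simp add: x_def power2_eq_square power4_eq_xxxx)
  finally show ?thesis .
qed

lemma F_insert_shift1:
  assumes V: "V \<subseteq> {1..n}" "card V \<le> 5" and S: "S \<subseteq> nsets V 2" and e: "e \<in> nsets V 2" "e \<notin> S"
  shows "\<bar>F V (insert e S) k - F V S k - (M V S e 1 (k - 1) - M V S e 1 k)\<bar> \<le> 4 * x\<^sup>2 * cdf k"
proof -
  let ?N = "\<lambda>A. common_nbrs n V e A" and ?Y = "new_triangles n V S"
  have "F V (insert e S) k - F V S k - (M V S e 1 (k - 1) - M V S e 1 k)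
    = \<E> (\<lambda>A. of_bool (?Y A + int (?N A) = k) - of_bool (?Y A = k)
        - real (?N A choose 1) * (of_bool (?Y A = k - 1) - of_bool (?Y A = k)))"
    unfolding F_def M_def bern_exp_diff right_diff_distrib new_triangles_insert[OF V(1) S e] ..
  also have "\<bar>\<dots>\<bar> \<le> \<E> (\<lambda>A. 2 * (real (?N A choose 2) * of_bool (?Y A \<le> k)))"
    unfolding mult.assoc[symmetric] by (intro bern_exp_abs_le p01 abs_indicator_shift1)
  also have "\<dots> \<le> 2 * (2 * x ^ 2 * cdf k)"
    unfolding bern_exp_cmult by (intro mult_left_mono moment_le V S e) auto
  finally show ?thesis by simp
qed

lemma F_insert_shift2:
  assumes V: "V \<subseteq> {1..n}" "card V \<le> 5" and S: "S \<subseteq> nsets V 2" and e: "e \<in> nsets V 2" "e \<notin> S"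
  shows "\<bar>F V (insert e S) k - F V S k - (M V S e 1 (k - 1) - M V S e 1 k)
      - (M V S e 2 (k - 2) - 2 * M V S e 2 (k - 1) + M V S e 2 k)\<bar> \<le> 6 * x ^ 3 * cdf k"
proof -
  let ?N = "\<lambda>A. common_nbrs n V e A" and ?Y = "new_triangles n V S"
  have eq: "F V (insert e S) k - F V S k - (M V S e 1 (k - 1) - M V S e 1 k)
      - (M V S e 2 (k - 2) - 2 * M V S e 2 (k - 1) + M V S e 2 k)
    = \<E> (\<lambda>A. of_bool (?Y A + int (?N A) = k) - of_bool (?Y A = k)
        - real (?N A choose 1) * (of_bool (?Y A = k - 1) - of_bool (?Y A = k))
        - real (?N A choose 2) * (of_bool (?Y A = k - 2) - 2 * of_bool (?Y A = k - 1) + of_bool (?Y A = k)))"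
  proof -
    have lin: "\<E> (\<lambda>A. u A - v A - c A * (g A - f A) - d A * (h A - 2 * g A + f A))
        = \<E> u - \<E> v - (\<E> (\<lambda>A. c A * g A) - \<E> (\<lambda>A. c A * f A))
          - (\<E> (\<lambda>A. d A * h A) - 2 * \<E> (\<lambda>A. d A * g A) + \<E> (\<lambda>A. d A * f A))" for u v c d f g h
    proof -
      have "(\<lambda>A. u A - v A - c A * (g A - f A) - d A * (h A - 2 * g A + f A))
        = (\<lambda>A. u A - v A - (c A * g A - c A * f A) - (d A * h A - 2 * (d A * g A) + d A * f A))"
        by (simp add: fun_eq_iff algebra_simps)
      then show ?thesis by (simp only: bern_exp_diff bern_exp_add bern_exp_cmult)
    qed
    show ?thesis
      unfolding F_def M_def lin new_triangles_insert[OF V(1) S e] ..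
  qed
  have "\<bar>F V (insert e S) k - F V S k - (M V S e 1 (k - 1) - M V S e 1 k)
      - (M V S e 2 (k - 2) - 2 * M V S e 2 (k - 1) + M V S e 2 k)\<bar> \<le> \<E> (\<lambda>A. 3 * (real (?N A choose 3) * of_bool (?Y A \<le> k)))"
    unfolding eq mult.assoc[symmetric] by (intro bern_exp_abs_le p01 abs_indicator_shift2)
  also have "\<dots> \<le> 3 * (2 * x ^ 3 * cdf k)"
    unfolding bern_exp_cmult by (intro mult_left_mono moment_le V S e) auto
  finally show ?thesis by simp
qed

lemma card_planted_le:
  assumes "V \<subseteq> {1..n}" "card V \<le> 5" "S \<subseteq> nsets V 2"
  shows "card S \<le> 10"
proof -
  have "finite (nsets V 2)" using assms finite_planted by blast
  then show ?thesis using card_mono[OF _ assms(3)] card_pairs_le[OF assms(1,2)] by linarith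
qed

lemma x2_bounds: "x\<^sup>2 \<le> p" "x * p \<le> p" "p\<^sup>2 \<le> p" "x\<^sup>2 * p \<le> 1 / n" "x * p\<^sup>2 \<le> 1 / n"
proof -
  show "x\<^sup>2 \<le> p" "p\<^sup>2 \<le> p" by (fact x_sq p2_le_p)+
  show "x * p \<le> p" using x_le p01 by (simp add: mult_left_le_one_le x_pos less_imp_le)
  have "x\<^sup>2 * p = x * (x * p)" by (simp add: power2_eq_square)
  also have "\<dots> \<le> 1 * (x * p)" using x_le x_pos p01 by (intro mult_right_mono) auto
  finally show "x\<^sup>2 * p \<le> 1 / n" using xp_le by simp
  have "x * p\<^sup>2 = p * (x * p)" by (simp add: power2_eq_square)
  also have "\<dots> \<le> 1 * (x * p)" using x_le x_pos p01 by (intro mult_right_mono) auto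
  finally show "x * p\<^sup>2 \<le> 1 / n" using xp_le by simp
qed

lemma cdf_le_cdf: "l \<le> k \<Longrightarrow> 0 \<le> c \<Longrightarrow> c * cdf l \<le> c * cdf k"
  by (intro mult_left_mono cdf_mono)

text \<open>Expanding a moment of order \<open>j\<close> plants \<open>j\<close> cherries and so
  uses up \<open>j\<close> vertices: the moment over four vertices rests on \<open>F_level0\<close>
  over five. Continuing this way, \<open>F_level1\<close> holds over four vertices and
  \<open>F_level2\<close> over three, just enough for a planted triangle.\<close>

lemma M1_level0:
  assumes V: "V \<subseteq> {1..n}" "card V \<le> 4" and S: "S \<subseteq> nsets V 2" and e: "e \<in> nsets V 2" "e \<notin> S"
  shows "\<bar>M V S e 1 k - x * q k\<bar> \<le> 65 * p * cdf k"
proof -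
  let ?c = "real (n - card V choose 1) * p\<^sup>2"
  have "\<bar>M V S e 1 k - real (n - card V choose 1) * p ^ (2 * 1) * q k\<bar> \<le> x ^ 1 * (40 * x * cdf k + 20 * p * cdf k)"
  proof (rule M_approx'[OF V(1) _ S e])
    fix Z assume Z: "Z \<subseteq> {1..n} - V" "card Z = 1"
    show "\<bar>F (V \<union> Z) (S \<union> cherries e Z) k - q k\<bar> \<le> 40 * x * cdf k"
      using planted_facts[OF V(1) S e Z(1)] Z(2) V(2) by (intro F_level0) auto
  qed (use V x_pos cdf_nonneg in auto)
  then have 1: "\<bar>M V S e 1 k - ?c * q k\<bar> \<le> (40 * x\<^sup>2 + 20 * (x * p)) * cdf k"
    by (simp add: algebra_simps power2_eq_square)
  have "\<bar>(?c - x) * q k\<bar> \<le> 5 * p\<^sup>2 * cdf k"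
    unfolding abs_mult using choose1_approx[of "card V"] V(2) q_le_cdf[of k] q_nonneg[of k] by (intro mult_mono) auto
  then have 2: "\<bar>?c * q k - x * q k\<bar> \<le> 5 * p\<^sup>2 * cdf k" by (simp add: algebra_simps)
  have "(40 * x\<^sup>2 + 20 * (x * p) + 5 * p\<^sup>2) * cdf k \<le> (65 * p) * cdf k"
    using x2_bounds by (intro mult_right_mono cdf_nonneg) linarith
  then have "(40 * x\<^sup>2 + 20 * (x * p)) * cdf k + 5 * p\<^sup>2 * cdf k \<le> 65 * p * cdf k"
    by (simp add: algebra_simps)
  then show ?thesis using 1 2 by linarith
qed

lemma F_level1:
  assumes V: "V \<subseteq> {1..n}" "card V \<le> 4" and S: "S \<subseteq> nsets V 2"
  shows "\<bar>F V S k - q k - card S * x * (q (k - 1) - q k)\<bar> \<le> 1360 * p * cdf k"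
proof -
  have V5: "card V \<le> 5" using V by simp
  have "finite S" using finite_planted V(1) S by blast
  \<comment> \<open>Each edge costs \<open>134 = 4 + 65 + 65\<close>: the truncation error of the
    shift, and the errors of the first moments at \<open>k\<close> and \<open>k - 1\<close>.\<close>
  then have "\<bar>F V S k - q k - card S * x * (q (k - 1) - q k)\<bar> \<le> 20 * p * cdf k + card S * (134 * p * cdf k)"
    using S
  proof (induction rule: finite_induct)
    case empty
    have "20 * (x * p) * cdf k \<le> 20 * p * cdf k" using x2_bounds cdf_nonneg by (intro mult_right_mono) auto
    then show ?case using F_empty[OF V(1) V5, of k] by (simp add: mult.assoc)
  next
    case (insert e S)
    then have S: "S \<subseteq> nsets V 2" and e: "e \<in> nsets V 2" "e \<notin> S" by auto
    have 1: "\<bar>F V (insert e S) k - F V S k - (M V S e 1 (k - 1) - M V S e 1 k)\<bar> \<le> 4 * p * cdf k"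
      using F_insert_shift1[OF V(1) V5 S e, of k] x2_bounds cdf_nonneg[of k]
        mult_right_mono[of "4 * x\<^sup>2" "4 * p" "cdf k"] by linarith
    have 2: "\<bar>M V S e 1 k - x * q k\<bar> \<le> 65 * p * cdf k" by (rule M1_level0[OF V S e])
    have 3: "\<bar>M V S e 1 (k - 1) - x * q (k - 1)\<bar> \<le> 65 * p * cdf k"
      using M1_level0[OF V S e, of "k - 1"] cdf_le_cdf[of "k - 1" k "65 * p"] p01 by linarith
    have 4: "\<bar>F V S k - q k - card S * x * (q (k - 1) - q k)\<bar> \<le> 20 * p * cdf k + card S * (134 * p * cdf k)"
      using insert.IH S by simp
    have 5: "card (insert e S) * x * (q (k - 1) - q k) = card S * x * (q (k - 1) - q k) + (x * q (k - 1) - x * q k)"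
      "card (insert e S) * (134 * p * cdf k) = card S * (134 * p * cdf k) + 134 * p * cdf k"
      using insert.hyps by (simp_all add: algebra_simps)
    show ?case unfolding 5 using 1 2 3 4 by linarith
  qed
  also have "\<dots> \<le> 20 * p * cdf k + 10 * (134 * p * cdf k)"
    using card_planted_le[OF V(1) V5 S] p01 cdf_nonneg by (intro add_left_mono mult_right_mono) auto
  finally show ?thesis by simp
qed

text \<open>The coefficient \<open>card S + 2\<close> counts planted edges once the two edges of the
  cherry have joined \<open>S\<close>.\<close>

lemma M1_level1:
  assumes V: "V \<subseteq> {1..n}" "card V \<le> 3" and S: "S \<subseteq> nsets V 2" and e: "e \<in> nsets V 2" "e \<notin> S"
  shows "\<bar>M V S e 1 k - x * (q k + (card S + 2) * x * (q (k - 1) - q k))\<bar> \<le> 1500 / n * cdf k"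
proof -
  let ?c = "real (n - card V choose 1) * p\<^sup>2"
  define a where "a = q k + (card S + 2) * x * (q (k - 1) - q k)"
  have "\<bar>M V S e 1 k - real (n - card V choose 1) * p ^ (2 * 1) * a\<bar> \<le> x ^ 1 * (1360 * p * cdf k + 20 * p * cdf k)"
  proof (rule M_approx'[OF V(1) _ S e])
    fix Z assume Z: "Z \<subseteq> {1..n} - V" "card Z = 1"
    show "\<bar>F (V \<union> Z) (S \<union> cherries e Z) k - a\<bar> \<le> 1360 * p * cdf k"
      using planted_facts[OF V(1) S e Z(1)] Z(2) V(2) F_level1[of "V \<union> Z" "S \<union> cherries e Z" k]
      by (simp add: a_def algebra_simps)
  qed (use V p01 cdf_nonneg in auto)
  then have 1: "\<bar>M V S e 1 k - ?c * a\<bar> \<le> 1380 * (x * p) * cdf k"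
    by (simp add: algebra_simps power2_eq_square)
  have "\<bar>q (k - 1) - q k\<bar> \<le> cdf k"
    using q_nonneg[of k] q_nonneg[of "k - 1"] q_le_cdf[of k] q_le_cdf[of "k - 1"] cdf_mono[of "k - 1" k] by linarith
  moreover have "\<bar>real (card S + 2) * x\<bar> \<le> 12"
  proof -
    have "real (card S + 2) * x \<le> 12 * 1"
      using card_planted_le[OF V(1) _ S] V(2) x_le x_pos by (intro mult_mono) auto
    then show ?thesis using x_pos by simp
  qed
  ultimately have "\<bar>real (card S + 2) * x * (q (k - 1) - q k)\<bar> \<le> 12 * cdf k"
    unfolding abs_mult[of "real (card S + 2) * x"] by (intro mult_mono) auto
  then have a: "\<bar>a\<bar> \<le> 13 * cdf k" using q_nonneg[of k] q_le_cdf[of k] unfolding a_def by linarith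
  have "\<bar>(?c - x) * a\<bar> \<le> (5 * p\<^sup>2) * (13 * cdf k)"
    unfolding abs_mult using choose1_approx[of "card V"] V(2) a by (intro mult_mono) auto
  then have 2: "\<bar>?c * a - x * a\<bar> \<le> 65 * p\<^sup>2 * cdf k" by (simp add: algebra_simps)
  have "(1380 * (x * p) + 65 * p\<^sup>2) * cdf k \<le> (1500 / n) * cdf k"
    using xp_le p2_le mult_left_mono[of 1445 1500 "1 / real n"] by (intro mult_right_mono cdf_nonneg) simp
  then have "1380 * (x * p) * cdf k + 65 * p\<^sup>2 * cdf k \<le> 1500 / n * cdf k"
    by (simp add: algebra_simps)
  then show ?thesis using 1 2 unfolding a_def[symmetric] by linarith
qed

lemma M2_level0:
  assumes V: "V \<subseteq> {1..n}" "card V \<le> 3" and S: "S \<subseteq> nsets V 2" and e: "e \<in> nsets V 2" "e \<notin> S"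
  shows "\<bar>M V S e 2 k - x\<^sup>2 / 2 * q k\<bar> \<le> 66 / n * cdf k"
proof -
  let ?c = "real (n - card V choose 2) * p ^ 4"
  have "\<bar>M V S e 2 k - real (n - card V choose 2) * p ^ (2 * 2) * q k\<bar> \<le> x ^ 2 * (40 * x * cdf k + 20 * p * cdf k)"
  proof (rule M_approx'[OF V(1) _ S e])
    fix Z assume Z: "Z \<subseteq> {1..n} - V" "card Z = 2"
    show "\<bar>F (V \<union> Z) (S \<union> cherries e Z) k - q k\<bar> \<le> 40 * x * cdf k"
      using planted_facts[OF V(1) S e Z(1)] Z(2) V(2) by (intro F_level0) auto
  qed (use V x_pos cdf_nonneg in auto)
  then have 1: "\<bar>M V S e 2 k - ?c * q k\<bar> \<le> (40 * x ^ 3 + 20 * (x\<^sup>2 * p)) * cdf k"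
    by (simp add: algebra_simps power2_eq_square power3_eq_cube)
  have "\<bar>(?c - x\<^sup>2 / 2) * q k\<bar> \<le> 6 * x * p\<^sup>2 * cdf k"
    unfolding abs_mult using choose2_approx[of "card V"] V(2) q_le_cdf[of k] q_nonneg[of k] x_pos by (intro mult_mono) auto
  then have 2: "\<bar>?c * q k - x\<^sup>2 / 2 * q k\<bar> \<le> 6 * (x * p\<^sup>2) * cdf k" by (simp add: algebra_simps)
  have "(40 * x ^ 3 + 20 * (x\<^sup>2 * p) + 6 * (x * p\<^sup>2)) * cdf k \<le> (66 / n) * cdf k"
    using x3_le x2_bounds(4,5) by (intro mult_right_mono cdf_nonneg) simp
  then have "(40 * x ^ 3 + 20 * (x\<^sup>2 * p)) * cdf k + 6 * (x * p\<^sup>2) * cdf k \<le> 66 / n * cdf k"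
    by (simp add: algebra_simps)
  then show ?thesis using 1 2 by linarith
qed

text \<open>Adding an edge to \<open>s\<close> planted ones contributes \<open>s + 2\<close> to the
  coefficient of \<open>x^2\<close> through the first moment and \<open>1/2\<close> through the
  second. Summing \<open>i + 5/2\<close> over \<open>i < s\<close> gives
  \<open>s^2/2 + 2 s\<close>.\<close>

lemma F_level2:
  assumes V: "V \<subseteq> {1..n}" "card V \<le> 3" and S: "S \<subseteq> nsets V 2"
  shows "\<bar>F V S k - q k - card S * x * (q (k - 1) - q k)
      - (real (card S) ^ 2 / 2 + 2 * real (card S)) * x\<^sup>2 * (q (k - 2) - 2 * q (k - 1) + q k)\<bar> \<le> 40000 / n * cdf k"
proof -
  have V5: "card V \<le> 5" using V by simp
  have "finite S" using finite_planted V(1) S by blast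
  then have "\<bar>F V S k - q k - card S * x * (q (k - 1) - q k)
      - (real (card S) ^ 2 / 2 + 2 * real (card S)) * x\<^sup>2 * (q (k - 2) - 2 * q (k - 1) + q k)\<bar>
    \<le> 20 * (1 / n * cdf k) + card S * (3300 * (1 / n * cdf k))"
    using S
  proof (induction rule: finite_induct)
    case empty
    have "20 * (x * p) * cdf k \<le> 20 * (1 / n) * cdf k" using xp_le by (intro mult_right_mono cdf_nonneg) auto
    then show ?case using F_empty[OF V(1) V5, of k] by (simp add: mult.assoc)
  next
    case (insert e S)
    then have S: "S \<subseteq> nsets V 2" and e: "e \<in> nsets V 2" "e \<notin> S" by auto
    define s u where "s = real (card S)" and "u = 1 / n * cdf k"
    have u: "c / n * cdf k = c * u" for c by (simp add: u_def)
    have 1: "\<bar>F V (insert e S) k - F V S k - (M V S e 1 (k - 1) - M V S e 1 k)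
      - (M V S e 2 (k - 2) - 2 * M V S e 2 (k - 1) + M V S e 2 k)\<bar> \<le> 6 * u"
      using F_insert_shift2[OF V(1) V5 S e, of k] x3_le cdf_nonneg[of k]
        mult_right_mono[of "6 * x ^ 3" "6 / n" "cdf k"] unfolding u by simp
    have sh: "c / n * cdf l \<le> c * u" if "l \<le> k" "0 \<le> c" for c l
      unfolding u[symmetric] using cdf_le_cdf[of l k "c / n"] that by simp
    have 2: "\<bar>M V S e 1 k - x * (q k + (s + 2) * x * (q (k - 1) - q k))\<bar> \<le> 1500 * u"
      using M1_level1[OF V S e, of k] unfolding u s_def by (simp add: algebra_simps)
    have 3: "\<bar>M V S e 1 (k - 1) - x * (q (k - 1) + (s + 2) * x * (q (k - 2) - q (k - 1)))\<bar> \<le> 1500 * u"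
      using M1_level1[OF V S e, of "k - 1"] sh[of "k - 1" 1500] unfolding s_def by (simp add: algebra_simps)
    have 4: "\<bar>M V S e 2 k - x\<^sup>2 / 2 * q k\<bar> \<le> 66 * u" "\<bar>M V S e 2 (k - 1) - x\<^sup>2 / 2 * q (k - 1)\<bar> \<le> 66 * u"
      "\<bar>M V S e 2 (k - 2) - x\<^sup>2 / 2 * q (k - 2)\<bar> \<le> 66 * u"
      using M2_level0[OF V S e, of k] M2_level0[OF V S e, of "k - 1"] M2_level0[OF V S e, of "k - 2"]
        sh[of k 66] sh[of "k - 1" 66] sh[of "k - 2" 66] by linarith+
    have 5: "\<bar>F V S k - q k - s * x * (q (k - 1) - q k)
      - (s\<^sup>2 / 2 + 2 * s) * x\<^sup>2 * (q (k - 2) - 2 * q (k - 1) + q k)\<bar> \<le> 20 * u + s * (3300 * u)"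
      using insert.IH S unfolding s_def u_def by simp
    have s1: "real (card (insert e S)) = s + 1" using insert.hyps by (simp add: s_def)
    have 6: "(s + 1) * x * (q (k - 1) - q k)
      + ((s + 1)\<^sup>2 / 2 + 2 * (s + 1)) * x\<^sup>2 * (q (k - 2) - 2 * q (k - 1) + q k)
      = (s * x * (q (k - 1) - q k) + (s\<^sup>2 / 2 + 2 * s) * x\<^sup>2 * (q (k - 2) - 2 * q (k - 1) + q k))
       + (x * (q (k - 1) + (s + 2) * x * (q (k - 2) - q (k - 1))) - x * (q k + (s + 2) * x * (q (k - 1) - q k)))
       + (x\<^sup>2 / 2 * q (k - 2) - 2 * (x\<^sup>2 / 2 * q (k - 1)) + x\<^sup>2 / 2 * q k)"
      by (simp add: field_simps power2_eq_square)
    have 7: "(s + 1) * (3300 * u) = s * (3300 * u) + 3300 * u" by (simp add: algebra_simps)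
    have u0: "0 \<le> u" using cdf_nonneg[of k] by (simp add: u_def)
    have aux: "\<bar>f' - q0 - t1 - t2\<bar> \<le> 20 * u + (w + 3300 * u)"
      if "\<bar>f' - f - (a1 - a0) - (b2 - 2 * b1 + b0)\<bar> \<le> 6 * u" "\<bar>a0 - a0'\<bar> \<le> 1500 * u"
        "\<bar>a1 - a1'\<bar> \<le> 1500 * u" "\<bar>b0 - b0'\<bar> \<le> 66 * u" "\<bar>b1 - b1'\<bar> \<le> 66 * u" "\<bar>b2 - b2'\<bar> \<le> 66 * u"
        "\<bar>f - q0 - c1 - c2\<bar> \<le> 20 * u + w"
        "t1 + t2 = (c1 + c2) + (a1' - a0') + (b2' - 2 * b1' + b0')"
      for f' q0 t1 t2 w f a1 a0 b2 b1 b0 a0' a1' b0' b1' b2' c1 c2 :: real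
      using that u0 by linarith
    show ?case unfolding s1 u_def[symmetric] 7 by (rule aux[OF 1 2 3 4 5 6])
  qed
  also have "\<dots> \<le> 20 * (1 / n * cdf k) + 10 * (3300 * (1 / n * cdf k))"
    using card_planted_le[OF V(1) V5 S] p01 cdf_nonneg by (intro add_left_mono mult_right_mono) auto
  also have "\<dots> \<le> 40000 / n * cdf k"
    using mult_right_mono[of 33020 40000 "1 / n * cdf k"] cdf_nonneg[of k] by simp
  finally show ?thesis .
qed

text \<open>Double counting of triangles in graphs with exactly \<open>k + 1\<close> of them. After
  planting \<open>T\<close>, the triangle \<open>T\<close> itself is subtracted by
  \<open>new_triangles\<close>, so \<open>k + 1\<close> in total becomes \<open>k\<close> new
  ones.\<close>

lemma triangle_sum:
  "of_int (k + 1) * q (k + 1) = (\<Sum>T\<in>nsets {1..n} 3. p ^ 3 * F T (nsets T 2) k)"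
proof -
  have "of_int (k + 1) * q (k + 1)
      = \<E> (\<lambda>A. \<Sum>T\<in>nsets {1..n} 3. of_bool (nsets T 2 \<subseteq> A) * of_bool (int (num_triangles n A) = k + 1))"
    unfolding q_def bern_exp_cmult[symmetric]
  proof (rule bern_exp_cong)
    fix A
    have "real (num_triangles n A) = (\<Sum>T\<in>nsets {1..n} 3. of_bool (nsets T 2 \<subseteq> A))"
    proof -
      have "triangles n A = {T \<in> nsets {1..n} 3. nsets T 2 \<subseteq> A}" by (simp add: triangles_def)
      then show ?thesis by (simp add: num_triangles_def of_bool_def sum.If_cases Int_def del: One_nat_def)
    qed
    then have "real_of_int (k + 1) = (\<Sum>T\<in>nsets {1..n} 3. of_bool (nsets T 2 \<subseteq> A))" if "int (num_triangles n A) = k + 1"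
      unfolding that[symmetric] by (simp only: of_int_of_nat_eq)
    then show "of_int (k + 1) * of_bool (int (num_triangles n A) = k + 1)
        = (\<Sum>T\<in>nsets {1..n} 3. of_bool (nsets T 2 \<subseteq> A) * of_bool (int (num_triangles n A) = k + 1) :: real)"
      unfolding sum_distrib_right[symmetric] by (cases "int (num_triangles n A) = k + 1") (simp_all only: of_bool_eq mult_1_right mult_zero_right)
  qed
  also have "\<dots> = (\<Sum>T\<in>nsets {1..n} 3. p ^ 3 * F T (nsets T 2) k)"
    unfolding bern_exp_sum
  proof (rule sum.cong[OF refl])
    fix T assume T: "T \<in> nsets {1..n} 3"
    let ?C = "nsets T 2"
    have "T \<subseteq> {1..n}" "card T = 3" using T by (auto simp: nsets_def)
    then have C: "?C \<subseteq> K" "card ?C = 3" using nsets_mono[of T "{1..n}" 2] card_nsets_triple[of T] by (simp_all only:)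
    have "\<E> (\<lambda>A. of_bool (?C \<subseteq> A) * of_bool (int (num_triangles n A) = k + 1))
      = \<E> (\<lambda>A. of_bool (?C \<subseteq> A) * of_bool (int (num_triangles n ((A - ?C) \<union> ?C)) = k + 1))"
      by (intro bern_exp_cong) (auto simp: Un_absorb2)
    also have "\<dots> = p ^ card ?C * \<E> (\<lambda>A. of_bool (int (num_triangles n ((A - ?C) \<union> ?C)) = k + 1))"
      by (fact bern_exp_plant[OF finite_K C(1), of p "\<lambda>B. of_bool (int (num_triangles n (B \<union> ?C)) = k + 1)"])
    finally show "\<E> (\<lambda>A. of_bool (?C \<subseteq> A) * of_bool (int (num_triangles n A) = k + 1)) = p ^ 3 * F T ?C k"
      unfolding C(2) by (simp add: F_def new_triangles_def num_triangles_triple[OF T] algebra_simps)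
  qed
  finally show ?thesis .
qed

lemma triangle_recursion:
  assumes "\<And>T. T \<in> nsets {1..n} 3 \<Longrightarrow> \<bar>F T (nsets T 2) k - a\<bar> \<le> b"
  shows "\<bar>of_int (k + 1) * q (k + 1) - mu n p * a\<bar> \<le> mu n p * b"
proof -
  have "of_int (k + 1) * q (k + 1) - mu n p * a = (\<Sum>T\<in>nsets {1..n} 3. p ^ 3 * (F T (nsets T 2) k - a))"
    unfolding triangle_sum by (simp add: mu_def sum_subtractf right_diff_distrib)
  also have "\<bar>\<dots>\<bar> \<le> (\<Sum>T\<in>nsets {1..n} 3. p ^ 3 * b)"
    using p01 by (intro order_trans[OF sum_abs] sum_mono) (simp add: abs_mult assms mult_left_mono)
  finally show ?thesis by (simp add: mu_def)
qed

lemma recursion0: "\<bar>of_int (k + 1) * q (k + 1) - mu n p * q k\<bar> \<le> mu n p * (40 * x * cdf k)"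
  by (rule triangle_recursion, rule F_level0) (auto simp: nsets_def)

lemma recursion1: "\<bar>of_int (k + 1) * q (k + 1) - mu n p * (q k + 3 * x * (q (k - 1) - q k))\<bar> \<le> mu n p * (1360 * p * cdf k)"
proof (rule triangle_recursion)
  fix T assume "T \<in> nsets {1..n} 3"
  then have T: "T \<subseteq> {1..n}" "card T = 3" by (auto simp: nsets_def)
  show "\<bar>F T (nsets T 2) k - (q k + 3 * x * (q (k - 1) - q k))\<bar> \<le> 1360 * p * cdf k"
    using F_level1[OF T(1) _ order_refl, of k] card_nsets_triple[OF T(2)] T(2) by (simp add: algebra_simps del: card_nsets)
qed

text \<open>A triangle plants \<open>s = 3\<close> edges, so \<open>21/2\<close> is
  \<open>s^2/2 + 2 s\<close>.\<close>

lemma recursion2: "\<bar>of_int (k + 1) * q (k + 1)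
    - mu n p * (q k + 3 * x * (q (k - 1) - q k) + 21 / 2 * x\<^sup>2 * (q (k - 2) - 2 * q (k - 1) + q k))\<bar>
  \<le> mu n p * (40000 / n * cdf k)"
proof (rule triangle_recursion)
  fix T assume "T \<in> nsets {1..n} 3"
  then have T: "T \<subseteq> {1..n}" "card T = 3" by (auto simp: nsets_def)
  have "\<bar>F T (nsets T 2) k - q k - real 3 * x * (q (k - 1) - q k)
      - (real 3 ^ 2 / 2 + 2 * real 3) * x\<^sup>2 * (q (k - 2) - 2 * q (k - 1) + q k)\<bar> \<le> 40000 / n * cdf k"
    using F_level2[OF T(1) _ order_refl, of k] T(2) unfolding card_nsets_triple[OF T(2)] by simp
  then show "\<bar>F T (nsets T 2) k - (q k + 3 * x * (q (k - 1) - q k) + 21 / 2 * x\<^sup>2 * (q (k - 2) - 2 * q (k - 1) + q k))\<bar>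
      \<le> 40000 / n * cdf k"
    by (simp add: diff_diff_eq)
qed

section \<open>Pivotal pairs and Russo's formula\<close>

lemma choose3_approx: "\<bar>real (n - 2 choose 3) * p ^ 6 - x ^ 3 / 6\<bar> \<le> 2 * p\<^sup>2"
proof -
  have n: "real (n - 2) = real n - 2" using n_ge by simp
  have "real (n - 2 choose 3) * p ^ 6 - x ^ 3 / 6 = - ((9 * real n ^ 2 - 26 * n + 24) / 6 * p ^ 6)"
    unfolding choose_three_real n by (simp add: x_def power2_eq_square eval_nat_numeral field_simps)
  also have "\<bar>\<dots>\<bar> \<le> (9 * real n ^ 2 / 6) * p ^ 6"
  proof -
    have "0 \<le> 9 * real n ^ 2 - 26 * n" using n_ge by (simp add: power2_eq_square)
    then have "\<bar>(9 * real n ^ 2 - 26 * n + 24) / 6\<bar> \<le> 9 * real n ^ 2 / 6" using n_ge by simp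
    then show ?thesis unfolding abs_minus_cancel abs_mult by (intro mult_mono) auto
  qed
  also have "\<dots> \<le> (2 * real n ^ 2) * p ^ 6" using p01 by (intro mult_right_mono) auto
  also have "\<dots> = 2 * ((real n ^ 2 * p ^ 3) * p ^ 3)" by (simp add: eval_nat_numeral)
  also have "\<dots> \<le> 2 * (1 * p ^ 3)" using dens p01 by (intro mult_left_mono mult_right_mono) auto
  also have "\<dots> \<le> 2 * p\<^sup>2" using p01 by (simp add: power_decreasing)
  finally show ?thesis .
qed

lemma q_neg: "k < 0 \<Longrightarrow> q k = 0"
  by (simp add: q_def bern_exp_const)

lemma cdf_0: "cdf 0 = q 0"
  unfolding cdf_def q_def by (intro bern_exp_cong) auto

text \<open>If the graph without \<open>e\<close> is triangle-free, then \<open>e\<close> creates a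
  triangle exactly when its ends have a common neighbour. Bonferroni turns this into three moments,
  expanded to orders two, one and zero respectively, which brings every error down to
  \<open>O(p^2)\<close>. As \<open>q\<close> vanishes at negative arguments, only \<open>q 0\<close>
  remains.\<close>

lemma pivotal_edge:
  assumes e: "e \<in> K"
  shows "\<bar>\<E> (\<lambda>A. of_bool (num_triangles n (insert e A) = 0) - of_bool (num_triangles n (A - {e}) = 0))
     + (x - 5 / 2 * x\<^sup>2 + 49 / 6 * x ^ 3) * q 0\<bar> \<le> 45000 * p\<^sup>2 * q 0"
proof -
  let ?N = "common_nbrs n e e" and ?Y = "new_triangles n e {}"
  have e': "e \<subseteq> {1..n}" "card e = 2" "finite e" using e by (auto simp: nsets_def)
  have "X = e" if "X \<in> nsets e 2" for X
    using that e' card_subset_eq[of e X] by (auto simp: nsets_def)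
  then have ee: "nsets e 2 = {e}" using e' by (auto simp: nsets_def)
  then have eV: "e \<in> nsets e 2" by simp
  have nt: "int (num_triangles n (insert e A)) = ?Y A + int (?N A)" "int (num_triangles n (A - {e})) = ?Y A" for A
  proof -
    show Y: "int (num_triangles n (A - {e})) = ?Y A" by (simp add: new_triangles_empty ee)
    have "{y \<in> {1..n} - e. cherry e y \<subseteq> A - {e}} = {y \<in> {1..n} - e. cherry e y \<subseteq> A}"
      by (auto simp: cherry_def)
    then have "num_triangles n (insert e (A - {e})) = num_triangles n (A - {e}) + ?N A"
      using num_triangles_insert[OF e, of "A - {e}"] by (simp add: common_nbrs_def)
    then show "int (num_triangles n (insert e A)) = ?Y A + int (?N A)" using Y by simp
  qed
  have Y0: "0 \<le> ?Y A" for A by (simp add: new_triangles_empty)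
  define M' where "M' j = M e {} e j 0" for j
  define D where "D = \<E> (\<lambda>A. of_bool (num_triangles n (insert e A) = 0) - of_bool (num_triangles n (A - {e}) = 0))"
  have D: "\<bar>D + (M' 1 - M' 2 + M' 3)\<bar> \<le> 2 * x ^ 4 * q 0"
  proof -
    have 1: "D + (M' 1 - M' 2 + M' 3) = \<E> (\<lambda>A. (of_bool (num_triangles n (insert e A) = 0) - of_bool (num_triangles n (A - {e}) = 0))
      + (real (?N A choose 1) * of_bool (?Y A = 0) - real (?N A choose 2) * of_bool (?Y A = 0) + real (?N A choose 3) * of_bool (?Y A = 0)))"
      unfolding D_def M'_def M_def bern_exp_diff bern_exp_add ..
    have "\<bar>D + (M' 1 - M' 2 + M' 3)\<bar> \<le> \<E> (\<lambda>A. real (?N A choose 4) * of_bool (?Y A \<le> 0))"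
      unfolding 1
    proof (intro bern_exp_abs_le p01)
      fix A
      have ne: "num_triangles n (insert e A) = 0 \<longleftrightarrow> ?Y A = 0 \<and> ?N A = 0" "num_triangles n (A - {e}) = 0 \<longleftrightarrow> ?Y A = 0"
        using nt[of A] Y0[of A] by linarith+
      show "\<bar>(of_bool (num_triangles n (insert e A) = 0) - of_bool (num_triangles n (A - {e}) = 0))
      + (real (?N A choose 1) * of_bool (?Y A = 0) - real (?N A choose 2) * of_bool (?Y A = 0) + real (?N A choose 3) * of_bool (?Y A = 0))\<bar>
        \<le> real (?N A choose 4) * of_bool (?Y A \<le> 0)"
        unfolding ne using abs_indicator_pos[of "?N A"] Y0[of A]
        by (cases "?Y A = 0"; cases "?N A = 0") (simp_all add: abs_le_iff)
    qed
    also have "\<dots> \<le> 2 * x ^ 4 * cdf 0" using e' eV by (intro moment_le) auto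
    finally show ?thesis by (simp add: cdf_0)
  qed
  have q: "q (0 - 1) = 0" "q (0 - 2) = 0" by (simp_all add: q_neg)
  \<comment> \<open>With a single cherry, every pair of \<open>e \<union> Z\<close> is
    \<open>e\<close> or planted, so \<open>d = 0\<close>; the error of order \<open>x * p\<close>
    from a larger \<open>d\<close> would in general not be \<open>O(p^2)\<close>. Two planted edges
    in \<open>F_level2\<close> give \<open>1 - 2 x + 6 x^2\<close>.\<close>
  have M1: "\<bar>M' 1 - x * (1 - 2 * x + 6 * x\<^sup>2) * q 0\<bar> \<le> 40045 * p\<^sup>2 * q 0"
  proof -
    define a where "a = (1 - 2 * x + 6 * x\<^sup>2) * q 0"
    let ?c = "real (n - card e choose 1) * p\<^sup>2"
    have "\<bar>M e {} e 1 0 - real (n - card e choose 1) * p ^ (2 * 1) * a\<bar> \<le> x ^ 1 * (40000 / n * cdf 0 + 2 * 0 * p * cdf 0)"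
    proof (rule M_approx[OF e'(1) _ _ eV, where d = 0, unfolded of_nat_0])
      fix Z assume Z: "Z \<subseteq> {1..n} - e" "card Z = 1"
      then obtain y where y: "Z = {y}" by (auto simp: card_1_singleton_iff)
      note pl = planted_facts[OF e'(1) _ eV _ Z(1), of "{}"]
      have c: "card ({} \<union> cherries e Z) = 2" using pl(4) Z by simp
      have "real 2 ^ 2 / 2 + 2 * real 2 = 6" by simp
      then show "\<bar>F (e \<union> Z) ({} \<union> cherries e Z) 0 - a\<bar> \<le> 40000 / n * cdf 0"
        using F_level2[of "e \<union> Z" "{} \<union> cherries e Z" 0] pl(1-3) Z(2) e'(2) unfolding c q
        by (simp add: a_def algebra_simps)
      show "card (nsets (e \<union> Z) 2 - nsets e 2 - cherries e Z) \<le> 0"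
      proof -
        have "nsets (e \<union> Z) 2 = insert e (cherry e y)"
          using nsets_insert_cherry[of e y] e' y Z by auto
        then have "nsets (e \<union> Z) 2 - nsets e 2 - cherries e Z = {}" by (auto simp: ee y cherries_def)
        then show ?thesis by (simp only: card.empty order_refl)
      qed
    qed (use e' cdf_nonneg in auto)
    also have "x ^ 1 * (40000 / n * cdf 0 + 2 * 0 * p * cdf 0) = 40000 * p\<^sup>2 * q 0"
      using n_ge by (simp add: cdf_0 x_def)
    finally have 1: "\<bar>M' 1 - ?c * a\<bar> \<le> 40000 * p\<^sup>2 * q 0" by (simp add: M'_def)
    have "x\<^sup>2 \<le> 1" using x_le x_pos by (simp add: power_le_one)
    then have "\<bar>1 - 2 * x + 6 * x\<^sup>2\<bar> \<le> 9" using x_le x_pos zero_le_power2[of x] unfolding abs_le_iff by linarith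
    then have a: "\<bar>a\<bar> \<le> 9 * q 0" unfolding a_def abs_mult using q_nonneg[of 0] by (simp add: mult_right_mono)
    have "\<bar>(?c - x) * a\<bar> \<le> 5 * p\<^sup>2 * (9 * q 0)"
      unfolding abs_mult using choose1_approx[of "card e"] e'(2) a by (intro mult_mono) auto
    then have "\<bar>?c * a - x * a\<bar> \<le> 45 * p\<^sup>2 * q 0" by (simp add: algebra_simps)
    then show ?thesis using 1 unfolding mult.assoc[of x] a_def[symmetric] by linarith
  qed
  have M2: "\<bar>M' 2 - x\<^sup>2 / 2 * (1 - 4 * x) * q 0\<bar> \<le> 1410 * p\<^sup>2 * q 0"
  proof -
    \<comment> \<open>Two cherries are four planted edges. Extra pairs are harmless here, since
      \<open>x^2 * p \<le> p^2\<close>.\<close>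
    define a where "a = (1 - 4 * x) * q 0"
    let ?c = "real (n - card e choose 2) * p ^ 4"
    have "\<bar>M e {} e 2 0 - real (n - card e choose 2) * p ^ (2 * 2) * a\<bar> \<le> x ^ 2 * (1360 * p * cdf 0 + 20 * p * cdf 0)"
    proof (rule M_approx'[OF e'(1) _ _ eV])
      fix Z assume Z: "Z \<subseteq> {1..n} - e" "card Z = 2"
      note pl = planted_facts[OF e'(1) _ eV _ Z(1), of "{}"]
      have c: "card ({} \<union> cherries e Z) = 4" using pl(4) Z by simp
      show "\<bar>F (e \<union> Z) ({} \<union> cherries e Z) 0 - a\<bar> \<le> 1360 * p * cdf 0"
        using F_level1[of "e \<union> Z" "{} \<union> cherries e Z" 0] pl(1-3) Z(2) e'(2) unfolding c q
        by (simp add: a_def algebra_simps)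
    qed (use e' cdf_nonneg p01 in auto)
    also have "x ^ 2 * (1360 * p * cdf 0 + 20 * p * cdf 0) = 1380 * (x\<^sup>2 * p * q 0)"
      by (simp add: cdf_0 algebra_simps)
    also have "\<dots> \<le> 1380 * (p * p * q 0)"
      using x_sq p01 q_nonneg by (intro mult_left_mono mult_right_mono) auto
    finally have 1: "\<bar>M' 2 - ?c * a\<bar> \<le> 1380 * p\<^sup>2 * q 0" by (simp add: M'_def power2_eq_square)
    have a: "\<bar>a\<bar> \<le> 5 * q 0" unfolding a_def abs_mult using x_le x_pos q_nonneg[of 0] by (intro mult_mono) auto
    have "\<bar>(?c - x\<^sup>2 / 2) * a\<bar> \<le> 6 * x * p\<^sup>2 * (5 * q 0)"
      unfolding abs_mult using choose2_approx[of "card e"] e'(2) a x_pos by (intro mult_mono) auto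
    also have "\<dots> \<le> 6 * 1 * p\<^sup>2 * (5 * q 0)"
      using x_le q_nonneg by (intro mult_left_mono mult_right_mono) auto
    finally have "\<bar>?c * a - x\<^sup>2 / 2 * a\<bar> \<le> 30 * p\<^sup>2 * q 0" by (simp add: algebra_simps)
    then show ?thesis using 1 unfolding mult.assoc[of "x\<^sup>2 / 2"] a_def[symmetric] by linarith
  qed
  have x4: "x ^ 4 \<le> p\<^sup>2"
    using power_mono[OF x_sq, of 2] by (simp add: power_mult[symmetric])
  have x3p: "x ^ 3 * p \<le> p\<^sup>2"
  proof -
    have "x ^ 3 * p = x\<^sup>2 * (x * p)" by (simp add: power2_eq_square power3_eq_cube)
    also have "\<dots> \<le> p * (1 * p)" using x_sq x_le x_pos p01 by (intro mult_mono) auto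
    finally show ?thesis by (simp add: power2_eq_square)
  qed
  have M3: "\<bar>M' 3 - x ^ 3 / 6 * q 0\<bar> \<le> 62 * p\<^sup>2 * q 0"
  proof -
    let ?c = "real (n - card e choose 3) * p ^ 6"
    have "\<bar>M e {} e 3 0 - real (n - card e choose 3) * p ^ (2 * 3) * q 0\<bar> \<le> x ^ 3 * (40 * x * cdf 0 + 20 * p * cdf 0)"
    proof (rule M_approx'[OF e'(1) _ _ eV])
      fix Z assume Z: "Z \<subseteq> {1..n} - e" "card Z = 3"
      note pl = planted_facts[OF e'(1) _ eV _ Z(1), of "{}"]
      show "\<bar>F (e \<union> Z) ({} \<union> cherries e Z) 0 - q 0\<bar> \<le> 40 * x * cdf 0"
        using pl(1-3) Z(2) e'(2) by (intro F_level0) auto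
    qed (use e' cdf_nonneg x_pos in auto)
    also have "x ^ 3 * (40 * x * cdf 0 + 20 * p * cdf 0) = (40 * x ^ 4 + 20 * (x ^ 3 * p)) * q 0"
      by (simp add: cdf_0 algebra_simps eval_nat_numeral)
    also have "\<dots> \<le> (60 * p\<^sup>2) * q 0"
      using x4 x3p by (intro mult_right_mono q_nonneg) linarith
    finally have 1: "\<bar>M' 3 - ?c * q 0\<bar> \<le> 60 * p\<^sup>2 * q 0" by (simp add: M'_def)
    have "\<bar>(?c - x ^ 3 / 6) * q 0\<bar> \<le> 2 * p\<^sup>2 * q 0"
      unfolding abs_mult e'(2) using choose3_approx q_nonneg[of 0] by (intro mult_mono) auto
    then have "\<bar>?c * q 0 - x ^ 3 / 6 * q 0\<bar> \<le> 2 * p\<^sup>2 * q 0" by (simp add: algebra_simps)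
    then show ?thesis using 1 by linarith
  qed
  have sum: "(x - 5 / 2 * x\<^sup>2 + 49 / 6 * x ^ 3) * q 0
    = x * (1 - 2 * x + 6 * x\<^sup>2) * q 0 - x\<^sup>2 / 2 * (1 - 4 * x) * q 0 + x ^ 3 / 6 * q 0"
    by (simp add: field_simps power2_eq_square power3_eq_cube)
  have D': "2 * x ^ 4 * q 0 \<le> 2 * p\<^sup>2 * q 0" using x4 q_nonneg by (intro mult_right_mono) auto
  have p2q: "0 \<le> p\<^sup>2 * q 0" using q_nonneg by simp
  show ?thesis
    unfolding D_def[symmetric] sum using D M1 M2 M3 D' p2q by linarith
qed

text \<open>Russo's formula sums \<open>pivotal_edge\<close> over all pairs; replacing
  \<open>n choose 2\<close> by \<open>n^2/2\<close> changes the main term by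
  \<open>O(n x) = O(n^2 p^2)\<close>, within the error already present.\<close>

lemma q0_derivative:
  "\<exists>d. ((\<lambda>s. bern_exp s K (\<lambda>A. of_bool (num_triangles n A = 0))) has_real_derivative d) (at p)
     \<and> \<bar>d + real n ^ 2 / 2 * (x - 5 / 2 * x\<^sup>2 + 49 / 6 * x ^ 3) * q 0\<bar> \<le> 30000 * real n ^ 2 * p\<^sup>2 * q 0"
proof -
  define w where "w = (x - 5 / 2 * x\<^sup>2 + 49 / 6 * x ^ 3)"
  define d where "d = (\<Sum>e\<in>K. \<E> (\<lambda>A. of_bool (num_triangles n (insert e A) = 0) - of_bool (num_triangles n (A - {e}) = 0)))"
  have "d + real (n choose 2) * (w * q 0)
     = (\<Sum>e\<in>K. \<E> (\<lambda>A. of_bool (num_triangles n (insert e A) = 0) - of_bool (num_triangles n (A - {e}) = 0)) + w * q 0)"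
    by (simp add: d_def sum.distrib)
  also have "\<bar>\<dots>\<bar> \<le> (\<Sum>e\<in>K. 45000 * p\<^sup>2 * q 0)"
    unfolding w_def by (intro order_trans[OF sum_abs] sum_mono pivotal_edge)
  also have "\<dots> = real (n choose 2) * (45000 * p\<^sup>2 * q 0)" by simp
  also have "\<dots> \<le> real n ^ 2 / 2 * (45000 * p\<^sup>2 * q 0)"
    using q_nonneg[of 0]
    by (intro mult_right_mono mult_nonneg_nonneg) (auto simp: choose_two_real power2_eq_square algebra_simps)
  finally have 1: "\<bar>d + real (n choose 2) * (w * q 0)\<bar> \<le> 22500 * (real n ^ 2 * p\<^sup>2 * q 0)" by (simp add: mult_ac)
  have w: "\<bar>w\<bar> \<le> 12 * x"
  proof -
    have "x\<^sup>2 \<le> x" "x ^ 3 \<le> x" using x_le x_pos power_decreasing[of 1 _ x] by auto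
    moreover have "0 \<le> x\<^sup>2" "0 \<le> x ^ 3" using x_pos by auto
    ultimately show ?thesis unfolding w_def abs_le_iff using x_pos by linarith
  qed
  have "real n ^ 2 / 2 * (w * q 0) - real (n choose 2) * (w * q 0) = real n / 2 * (w * q 0)"
    by (simp add: choose_two_real power2_eq_square field_simps)
  also have "\<bar>\<dots>\<bar> \<le> real n / 2 * (12 * x * q 0)"
    unfolding abs_mult using w q_nonneg by (intro mult_mono) auto
  also have "\<dots> = 6 * (real n ^ 2 * p\<^sup>2 * q 0)" by (simp add: x_def power2_eq_square)
  finally have 2: "\<bar>real n ^ 2 / 2 * (w * q 0) - real (n choose 2) * (w * q 0)\<bar> \<le> 6 * (real n ^ 2 * p\<^sup>2 * q 0)" .
  have "0 \<le> real n ^ 2 * p\<^sup>2 * q 0" using q_nonneg by simp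
  then have "\<bar>d + real n ^ 2 / 2 * w * q 0\<bar> \<le> 30000 * real n ^ 2 * p\<^sup>2 * q 0"
    using 1 2 unfolding mult.assoc by linarith
  then show ?thesis
    using DERIV_bern_exp[OF finite_K, of "\<lambda>A. of_bool (num_triangles n A = 0)" p] unfolding d_def w_def by blast
qed

end

section \<open>Ratios in the lower tail\<close>

lemma ln_second_order:
  fixes a :: real
  assumes "\<bar>a\<bar> \<le> 1 / 2"
  shows "\<bar>ln (1 + a) - a + a\<^sup>2 / 2\<bar> \<le> 2 * \<bar>a\<bar> ^ 3"
proof -
  define f where "f = (\<lambda>t::real. ln (1 + t) - t + t\<^sup>2 / 2)"
  have D: "(f has_real_derivative t\<^sup>2 / (1 + t)) (at t within T)" if "- 1 < t" for t T
    unfolding f_def using that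
    by (auto intro!: derivative_eq_intros simp: field_simps power2_eq_square)
  have bnd: "norm (f a - f 0) \<le> (2 * a\<^sup>2) * norm (a - 0)"
  proof (rule field_differentiable_bound[where S = "closed_segment 0 a" and f' = "\<lambda>t. t\<^sup>2 / (1 + t)"])
    fix t assume t: "t \<in> closed_segment 0 a"
    then have "\<bar>t\<bar> \<le> \<bar>a\<bar>" by (auto simp: closed_segment_eq_real_ivl split: if_splits)
    then have t1: "\<bar>t\<bar> \<le> 1 / 2" "t\<^sup>2 \<le> a\<^sup>2" using assms by (linarith, simp add: abs_le_square_iff)
    then show "(f has_field_derivative t\<^sup>2 / (1 + t)) (at t within closed_segment 0 a)"
      by (intro D) auto
    have "\<bar>t\<^sup>2 / (1 + t)\<bar> \<le> t\<^sup>2 / (1 / 2)"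
    proof -
      have "1 / 2 \<le> 1 + t" using t1 by linarith
      then have "t\<^sup>2 / (1 + t) \<le> t\<^sup>2 / (1 / 2)" by (intro divide_left_mono) auto
      then show ?thesis using \<open>1 / 2 \<le> 1 + t\<close> by simp
    qed
    then show "norm (t\<^sup>2 / (1 + t)) \<le> 2 * a\<^sup>2" using t1 by simp
  qed auto
  have "2 * a\<^sup>2 * \<bar>a\<bar> = 2 * \<bar>a\<bar> ^ 3" by (simp add: power2_eq_square power3_eq_cube)
  then show ?thesis using bnd by (simp add: f_def)
qed

text \<open>To be applied with \<open>t = k/m\<close> and \<open>u\<close> the normalized ratio of
  consecutive probabilities. In \<open>ln u\<close> the square of \<open>3 x (t - 1)\<close>
  contributes \<open>- 9/2 x^2 (t - 1)^2\<close>, and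
  \<open>- 9 (t - 1) t + (21/2 - 9/2) (t - 1)^2 = - (t - 1) (3 t + 6)\<close>. The power
  \<open>C^3\<close> stems from the cubic remainder.\<close>

lemma ln_near_quadratic:
  fixes u x t C b N :: real
  assumes N: "N > 0" and C: "1 \<le> C" and x: "0 \<le> x" "x ^ 3 \<le> 1 / N" "C * x \<le> 1 / 160" and t: "0 \<le> t" "t \<le> 1"
    and u1: "\<bar>u - 1\<bar> \<le> 40 * C * x"
    and u2: "\<bar>u - (1 + 3 * x * (t - 1) - 9 * x\<^sup>2 * (t - 1) * t + 21 / 2 * x\<^sup>2 * (t - 1)\<^sup>2)\<bar> \<le> 60000 * C / N"
  shows "\<bar>ln u - (3 * x * (t - 1) - x\<^sup>2 * (t - 1) * (3 * t + 6))\<bar> \<le> 300000 * C ^ 3 / N"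
proof -
  define a where "a = u - 1"
  define v where "v = - 9 * (t - 1) * t + 21 / 2 * (t - 1)\<^sup>2"
  define a0 where "a0 = 3 * x * (t - 1) + x\<^sup>2 * v"
  define \<eta> where "\<eta> = 1 / N"
  have eta: "0 < \<eta>" "x ^ 3 \<le> \<eta>" using N x by (auto simp: \<eta>_def)
  have x_le: "x \<le> 1 / 160" using C x mult_right_mono[of 1 C x] by simp
  have a: "\<bar>a\<bar> \<le> 1 / 4" using u1 x(3) by (simp add: a_def)
  have diff: "\<bar>a - a0\<bar> \<le> 60000 * C * \<eta>"
    using u2 by (simp add: a_def a0_def v_def \<eta>_def algebra_simps)
  have v: "\<bar>v\<bar> \<le> 13"
  proof -
    have "0 \<le> (1 - t) * t" "(1 - t) * t \<le> 1 / 4" "0 \<le> (t - 1)\<^sup>2" "(t - 1)\<^sup>2 \<le> 1"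
      using t zero_le_power2[of "t - 1 / 2"] zero_le_power2[of "t - 1"] mult_left_le[of t t]
      by (auto simp: power2_eq_square algebra_simps)
    moreover have "v = 9 * ((1 - t) * t) + 21 / 2 * (t - 1)\<^sup>2" by (simp add: v_def algebra_simps)
    ultimately show ?thesis by (simp add: abs_le_iff)
  qed
  have t1: "\<bar>t - 1\<bar> \<le> 1" using t by simp
  have a0: "\<bar>a0\<bar> \<le> 1"
  proof -
    have "\<bar>3 * x * (t - 1)\<bar> \<le> 3 * x * 1" unfolding abs_mult[of "3 * x"] using t1 x by (intro mult_mono) auto
    moreover have "\<bar>x\<^sup>2 * v\<bar> \<le> 1 * 13"
      unfolding abs_mult using v x x_le by (intro mult_mono) (auto simp: power_le_one)
    moreover have "x\<^sup>2 \<le> (1 / 160)\<^sup>2" using x x_le by (intro power_mono) auto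
    moreover have "\<bar>x\<^sup>2 * v\<bar> \<le> (1 / 160)\<^sup>2 * 13"
      unfolding abs_mult using v calculation(3) by (intro mult_mono) auto
    ultimately show ?thesis unfolding a0_def using x_le by (simp add: power2_eq_square)
  qed
  have sq: "\<bar>a\<^sup>2 - a0\<^sup>2\<bar> \<le> 60000 * C * \<eta> * (5 / 4)"
  proof -
    have "a\<^sup>2 - a0\<^sup>2 = (a - a0) * (a + a0)" by (simp add: power2_eq_square algebra_simps)
    moreover have "\<bar>a + a0\<bar> \<le> 5 / 4" using a a0 by linarith
    ultimately show ?thesis using diff C eta by (simp only: abs_mult) (intro mult_mono, auto)
  qed
  have cube: "2 * \<bar>a\<bar> ^ 3 \<le> 128000 * C ^ 3 * \<eta>"
  proof -
    have "\<bar>a\<bar> ^ 3 \<le> (40 * C * x) ^ 3" using u1 by (intro power_mono) (auto simp: a_def)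
    also have "\<dots> = 64000 * C ^ 3 * x ^ 3" by (simp add: power_mult_distrib)
    also have "\<dots> \<le> 64000 * C ^ 3 * \<eta>" using eta C by (intro mult_left_mono) auto
    finally show ?thesis by (simp add: mult_ac)
  qed
  have sq0: "\<bar>a0\<^sup>2 - 9 * x\<^sup>2 * (t - 1)\<^sup>2\<bar> \<le> 240 * \<eta>"
  proof -
    have "a0\<^sup>2 - 9 * x\<^sup>2 * (t - 1)\<^sup>2 = x ^ 3 * (6 * (t - 1) * v + x * v\<^sup>2)"
      by (simp add: a0_def power2_eq_square power3_eq_cube algebra_simps)
    moreover have "\<bar>6 * (t - 1) * v + x * v\<^sup>2\<bar> \<le> 240"
    proof -
      have "\<bar>6 * (t - 1) * v\<bar> \<le> (6 * 1) * 13" unfolding abs_mult using v t1 by (intro mult_mono) auto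
      moreover have "\<bar>x * v\<^sup>2\<bar> \<le> 1 / 160 * 13\<^sup>2"
        unfolding abs_mult using v x x_le abs_le_square_iff[of v 13] by (intro mult_mono) auto
      ultimately show ?thesis by (simp add: abs_le_iff) linarith
    qed
    ultimately have "\<bar>a0\<^sup>2 - 9 * x\<^sup>2 * (t - 1)\<^sup>2\<bar> \<le> x ^ 3 * 240"
      using x by (simp only: abs_mult) (intro mult_mono, auto)
    also have "\<dots> \<le> 240 * \<eta>" using eta by simp
    finally show ?thesis .
  qed
  have eq: "3 * x * (t - 1) - x\<^sup>2 * (t - 1) * (3 * t + 6) = a0 - 9 * x\<^sup>2 * (t - 1)\<^sup>2 / 2"
    by (simp add: a0_def v_def power2_eq_square field_simps)
  have ln: "\<bar>ln u - a + a\<^sup>2 / 2\<bar> \<le> 2 * \<bar>a\<bar> ^ 3" using ln_second_order[of a] a by (simp add: a_def)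
  have C3: "C \<le> C ^ 3" "1 \<le> C ^ 3" using C self_le_power[of C 3] by auto
  have m: "C * \<eta> \<le> C ^ 3 * \<eta>" "\<eta> \<le> C ^ 3 * \<eta>"
    using C3 eta mult_right_mono[of C "C ^ 3" \<eta>] mult_right_mono[of 1 "C ^ 3" \<eta>] by auto
  have "\<bar>ln u - (a0 - 9 * x\<^sup>2 * (t - 1)\<^sup>2 / 2)\<bar> \<le> 128000 * (C ^ 3 * \<eta>) + 60000 * (C * \<eta>) + 37500 * (C * \<eta>) + 120 * \<eta>"
  proof -
    have aux: "\<bar>L - (a' - s / 2)\<bar> \<le> c3 + c1 + c2 + e"
      if "\<bar>L - b + b2 / 2\<bar> \<le> d" "d \<le> c3" "\<bar>b - a'\<bar> \<le> c1" "\<bar>b2 - a2\<bar> \<le> 2 * c2" "\<bar>a2 - s\<bar> \<le> 2 * e"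
      for L a' s c1 c2 c3 b b2 d a2 e :: real
      using that by linarith
    show ?thesis
      by (rule aux[OF ln]) (use cube diff sq sq0 in \<open>simp_all add: mult_ac\<close>)
  qed
  also have "\<dots> \<le> 300000 * (C ^ 3 * \<eta>)" using m eta C3 by linarith
  finally show ?thesis unfolding eq by (simp add: \<eta>_def)
qed

lemma (in sparse_gnp) q0_pos: "0 < q 0"
proof -
  have "(\<Sum>A\<in>{{}}. p ^ card A * (1 - p) ^ card (K - A) * of_bool (int (num_triangles n A) = 0))
      \<le> q 0"
    unfolding q_def bern_exp_def using p01 by (intro sum_mono2) (auto intro!: mult_nonneg_nonneg)
  moreover have "num_triangles n {} = 0"
    using new_triangles_empty[of "{}" "{}"] by (simp add: new_triangles_def)
  moreover have "0 < (1 - p) ^ card K" using p_le by simp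
  ultimately show ?thesis by simp
qed

text \<open>\<open>x_small\<close> makes the relative error of the crude recursion at most
  \<open>\<epsilon>/2\<close>, so that half of the gap \<open>\<epsilon>\<close> survives. With
  \<open>\<epsilon> \<le> 1/2\<close> it also yields the absolute bound
  \<open>C * x \<le> 1/160\<close>.\<close>

locale lower_tail = sparse_gnp +
  fixes \<epsilon> :: real
  assumes eps: "0 < \<epsilon>" "\<epsilon> \<le> 1 / 2" and x_small: "40 * x * (1 + 2 / \<epsilon>) \<le> \<epsilon> / 2"
begin

abbreviation "m \<equiv> mu n p"

text \<open>In the lower tail \<open>q k\<close> is at most
  \<open>(1 - \<epsilon>) / (1 - \<epsilon>/2)\<close> times \<open>q (k + 1)\<close>, and the
  geometric series with this ratio sums to \<open>2/\<epsilon> - 1\<close>. The slightly larger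
  \<open>C\<close> satisfies \<open>C (1 - \<epsilon>) \<le> (1 - \<epsilon>/2) (C - 1)\<close>, the
  inequality that closes the induction in \<open>cdf_le_q\<close>.\<close>

definition C where "C = 1 + 2 / \<epsilon>"

lemma C_ge: "1 \<le> C" using eps by (simp add: C_def)

lemma Cx_le: "40 * C * x \<le> \<epsilon> / 2" "C * x \<le> 1 / 160" "40 * C * x \<le> 1 / 4"
proof -
  show "40 * C * x \<le> \<epsilon> / 2" using x_small by (simp add: C_def mult_ac)
  then show "C * x \<le> 1 / 160" "40 * C * x \<le> 1 / 4" using eps by auto
qed

lemma m_pos: "0 < m"
  using n_ge p_pos by (simp add: mu_def zero_less_binomial)

lemma q_pos:
  assumes "cdf (int k) \<le> C * q (int k)"
  shows "0 < q (int k)"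
proof -
  have "0 < cdf (int k)" using q0_pos cdf_mono[of 0 "int k"] q_le_cdf[of 0] by simp
  then have "0 < C * q (int k)" using assms by linarith
  then show ?thesis using C_ge by (simp add: zero_less_mult_iff)
qed

lemma cdf_Suc: "cdf (k + 1) = cdf k + q (k + 1)"
  unfolding cdf_def q_def bern_exp_add[symmetric] by (intro bern_exp_cong) auto

text \<open>In the lower tail the point probabilities grow geometrically, so they dominate the
  distribution function.\<close>

lemma cdf_le_q: "real k \<le> (1 - \<epsilon>) * m \<Longrightarrow> cdf (int k) \<le> C * q (int k)"
proof (induction k)
  case 0
  then show ?case using C_ge q_nonneg[of 0] mult_right_mono[of 1 C "q 0"] by (simp add: cdf_0)
next
  case (Suc k)
  then have IH: "cdf (int k) \<le> C * q (int k)" by simp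
  let ?q = "q (int k)" and ?q' = "q (int k + 1)"
  have k: "real k + 1 \<le> (1 - \<epsilon>) * m" using Suc.prems by simp
  have "40 * x * cdf (int k) \<le> 40 * x * (C * ?q)" using IH x_pos by (intro mult_left_mono) auto
  also have "\<dots> = 40 * C * x * ?q" by simp
  also have "\<dots> \<le> \<epsilon> / 2 * ?q" using Cx_le q_nonneg by (intro mult_right_mono) auto
  finally have "m * (40 * x * cdf (int k)) \<le> m * (\<epsilon> / 2 * ?q)" using m_pos by simp
  then have "m * ((1 - \<epsilon> / 2) * ?q) \<le> (real k + 1) * ?q'"
    using recursion0[of "int k"] by (simp add: abs_le_iff algebra_simps)
  also have "\<dots> \<le> ((1 - \<epsilon>) * m) * ?q'" using k q_nonneg by (intro mult_right_mono) auto
  also have "\<dots> = m * ((1 - \<epsilon>) * ?q')" by simp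
  finally have "(1 - \<epsilon> / 2) * ?q \<le> (1 - \<epsilon>) * ?q'" using m_pos by simp
  then have "C * ((1 - \<epsilon> / 2) * ?q) \<le> C * ((1 - \<epsilon>) * ?q')" using C_ge by simp
  moreover have "C * ((1 - \<epsilon>) * ?q') \<le> (1 - \<epsilon> / 2) * ((C - 1) * ?q')"
  proof -
    have "C * (1 - \<epsilon>) \<le> (1 - \<epsilon> / 2) * (C - 1)"
      using eps by (simp add: C_def field_simps)
    then show ?thesis using q_nonneg[of "int k + 1"] mult_right_mono by (fastforce simp: mult.assoc)
  qed
  ultimately have "(1 - \<epsilon> / 2) * (C * ?q) \<le> (1 - \<epsilon> / 2) * ((C - 1) * ?q')"
    by (simp add: algebra_simps)
  then have "C * ?q \<le> (C - 1) * ?q'" using eps by simp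
  then have "cdf (int k + 1) \<le> C * ?q'" unfolding cdf_Suc using IH by (simp add: algebra_simps)
  then show ?case by (simp add: add.commute)
qed

section \<open>Successive approximations of the ratio of consecutive probabilities\<close>

definition r :: "int \<Rightarrow> real" where "r k = q (k - 1) / q k"

lemma m_ge: "real n ^ 3 * p ^ 3 / 13 \<le> m"
proof -
  have n3: "6 * real (n choose 3) = real n * ((real n - 1) * (real n - 2))"
    by (simp add: choose_three_real)
  have "real n * (6 / 13 * real n ^ 2) \<le> real n * ((real n - 1) * (real n - 2))"
  proof (intro mult_left_mono)
    have "0 \<le> (real n - 5) * (7 * real n - 4)" using n_ge by (intro mult_nonneg_nonneg) auto
    then show "6 / 13 * real n ^ 2 \<le> (real n - 1) * (real n - 2)"
      by (simp add: power2_eq_square field_simps)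
  qed auto
  then have "real n ^ 3 / 13 \<le> real (n choose 3)"
    using n3 by (simp add: power2_eq_square power3_eq_cube)
  then have "real n ^ 3 / 13 * p ^ 3 \<le> real (n choose 3) * p ^ 3" using p01 by (intro mult_right_mono) auto
  then show ?thesis by (simp add: mu_def)
qed

lemma m_le: "m \<le> real n ^ 3 * p ^ 3 / 6"
proof -
  have "real n * ((real n - 1) * (real n - 2)) \<le> real n * (real n * real n)"
    using n_ge by (intro mult_left_mono mult_mono) auto
  then have "real (n choose 3) \<le> real n ^ 3 / 6"
    by (simp add: choose_three_real power3_eq_cube)
  then have "real (n choose 3) * p ^ 3 \<le> real n ^ 3 / 6 * p ^ 3" using p01 by (intro mult_right_mono) auto
  then show ?thesis by (simp add: mu_def)
qed

text \<open>Passing from \<open>k\<close> to \<open>k - 1\<close> moves \<open>k/m\<close> by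
  \<open>1/m\<close>; in the terms of second order this costs \<open>x^2/m\<close>, which is thus
  affordable. The bound \<open>p \<le> 1/20\<close> absorbs the 13.\<close>

lemma x2m_le: "x\<^sup>2 / m \<le> 1 / n"
proof -
  have "x\<^sup>2 / m \<le> x\<^sup>2 / (real n ^ 3 * p ^ 3 / 13)"
    using m_ge m_pos n_ge p_pos by (intro divide_left_mono) auto
  also have "\<dots> = 13 * p / n"
    using n_ge p_pos by (simp add: x_def field_simps eval_nat_numeral)
  also have "\<dots> \<le> 1 / n" using p_le by (intro divide_right_mono) auto
  finally show ?thesis .
qed

text \<open>The crude recursion at \<open>k - 1\<close> controls the error relative to
  \<open>r\<close> itself. As \<open>40 * C * x \<le> 1/4\<close>, this first gives
  \<open>r \<le> 2\<close>, and inserting that bound makes the error absolute.\<close>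

lemma ratio0:
  assumes "real k \<le> (1 - \<epsilon>) * m"
  shows "\<bar>r (int k) - real k / m\<bar> \<le> 80 * C * x" "0 \<le> r (int k)" "r (int k) \<le> 2" "real k / m \<le> 1"
proof -
  show t: "real k / m \<le> 1"
  proof -
    have "(1 - \<epsilon>) * m \<le> 1 * m" using eps m_pos by (intro mult_right_mono) auto
    with assms have "real k \<le> 1 * m" by (rule order_trans)
    then show ?thesis using m_pos by (simp add: divide_le_eq)
  qed
  show r0: "0 \<le> r (int k)" using q_nonneg by (simp add: r_def)
  have "\<bar>r (int k) - real k / m\<bar> \<le> 80 * C * x \<and> r (int k) \<le> 2"
  proof (cases k)
    \<comment> \<open>Here \<open>r 0 = 0 = k/m\<close>, because \<open>q (-1) = 0\<close>.\<close>
    case 0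
    then show ?thesis using x_pos C_ge by (simp add: r_def q_neg)
  next
    case (Suc l)
    have q: "0 < q (int k)" using assms q_pos cdf_le_q by blast
    have "real l \<le> (1 - \<epsilon>) * m" using assms Suc by simp
    then have "40 * x * cdf (int l) \<le> 40 * x * (C * q (int l))"
      using cdf_le_q x_pos by (intro mult_left_mono) auto
    from mult_left_mono[OF this less_imp_le[OF m_pos]] have b: "m * (40 * x * cdf (int l)) \<le> m * (40 * C * x * q (int l))"
      by (simp only: mult_ac)
    have "\<bar>real k * q (int k) - m * q (int l)\<bar> \<le> m * (40 * C * x * q (int l))"
      by (rule order_trans[OF _ b]) (use recursion0[of "int l"] Suc in \<open>simp add: add.commute\<close>)
    then have "\<bar>real k * q (int k) - m * q (int l)\<bar> / (m * q (int k)) \<le> m * (40 * C * x * q (int l)) / (m * q (int k))"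
      using m_pos q by (intro divide_right_mono) auto
    also have "m * (40 * C * x * q (int l)) / (m * q (int k)) = 40 * C * x * r (int k)"
      using m_pos Suc by (simp add: r_def)
    also have "\<bar>real k * q (int k) - m * q (int l)\<bar> / (m * q (int k)) = \<bar>real k / m - r (int k)\<bar>"
    proof -
      have "\<bar>real k * q (int k) - m * q (int l)\<bar> / (m * q (int k)) = \<bar>(real k * q (int k) - m * q (int l)) / (m * q (int k))\<bar>"
        using m_pos q by simp
      also have "(real k * q (int k) - m * q (int l)) / (m * q (int k)) = real k / m - r (int k)"
        using m_pos q Suc by (simp add: r_def field_simps)
      finally show ?thesis .
    qed
    finally have *: "\<bar>real k / m - r (int k)\<bar> \<le> 40 * C * x * r (int k)" .
    have "40 * C * x * r (int k) \<le> 1 / 4 * r (int k)" using Cx_le r0 by (intro mult_right_mono) auto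
    then have r2: "r (int k) \<le> 2" using * t by (simp add: abs_le_iff)
    have "40 * C * x * r (int k) \<le> 40 * C * x * 2" using r2 C_ge x_pos by (intro mult_left_mono) auto
    then show ?thesis using * r2 by (simp add: abs_le_iff)
  qed
  then show "\<bar>r (int k) - real k / m\<bar> \<le> 80 * C * x" "r (int k) \<le> 2" by auto
qed

text \<open>The recursion of first order reads \<open>t = r (1 + 3 x (r' - 1))\<close> up to
  \<open>O(p)\<close>, with \<open>r'\<close> the ratio one step earlier. Replacing
  \<open>r'\<close> and then \<open>r\<close> by \<open>t\<close> in the term with \<open>x\<close>,
  as \<open>ratio0\<close> allows, solves it for \<open>r\<close>.\<close>

lemma ratio1:
  assumes k: "real k \<le> (1 - \<epsilon>) * m"
  defines "t \<equiv> real k / m"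
  shows "\<bar>r (int k) - t + 3 * x * (t - 1) * t\<bar> \<le> 3440 * C * p + 6 * x / m"
proof (cases k)
  case 0
  then show ?thesis using x_pos C_ge p01 m_pos by (simp add: r_def q_neg t_def)
next
  case (Suc l)
  have q: "0 < q (int k)" using k q_pos cdf_le_q by blast
  have l: "real l \<le> (1 - \<epsilon>) * m" using k Suc by simp
  have ql: "0 < q (int l)" using l q_pos cdf_le_q by blast
  have x2C: "x\<^sup>2 * C \<le> p * C" using x_sq C_ge by (intro mult_right_mono) auto
  note rk = ratio0[OF k, folded t_def] and rl = ratio0[OF l]
  have t0: "0 \<le> t" using m_pos by (simp add: t_def)
  have kl: "int k = int l + 1" using Suc by simp
  have "1360 * p * cdf (int l) \<le> 1360 * p * (C * q (int l))"
    using cdf_le_q[OF l] p01 by (intro mult_left_mono) auto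
  from mult_left_mono[OF this less_imp_le[OF m_pos]] have b: "m * (1360 * p * cdf (int l)) \<le> m * (1360 * C * p * q (int l))"
      by (simp only: mult_ac)
  have "\<bar>real k * q (int k) - m * (q (int l) + 3 * x * (q (int l - 1) - q (int l)))\<bar> \<le> m * (1360 * C * p * q (int l))"
    by (rule order_trans[OF _ b]) (use recursion1[of "int l"] Suc in \<open>simp add: kl add.commute\<close>)
  then have "\<bar>real k * q (int k) - m * (q (int l) + 3 * x * (q (int l - 1) - q (int l)))\<bar> / (m * q (int k))
     \<le> m * (1360 * C * p * q (int l)) / (m * q (int k))"
    using m_pos q by (intro divide_right_mono) auto
  also have "m * (1360 * C * p * q (int l)) / (m * q (int k)) = 1360 * C * p * r (int k)"
    using m_pos Suc by (simp add: r_def)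
  also have "\<dots> \<le> 1360 * C * p * 2" using rk C_ge p01 by (intro mult_left_mono) auto
  also have "\<bar>real k * q (int k) - m * (q (int l) + 3 * x * (q (int l - 1) - q (int l)))\<bar> / (m * q (int k))
     = \<bar>t - r (int k) * (1 + 3 * x * (r (int l) - 1))\<bar>"
  proof -
    have "\<bar>real k * q (int k) - m * (q (int l) + 3 * x * (q (int l - 1) - q (int l)))\<bar> / (m * q (int k))
      = \<bar>(real k * q (int k) - m * (q (int l) + 3 * x * (q (int l - 1) - q (int l)))) / (m * q (int k))\<bar>"
      using m_pos q by simp
    also have "(real k * q (int k) - m * (q (int l) + 3 * x * (q (int l - 1) - q (int l)))) / (m * q (int k))
      = t - r (int k) * (1 + 3 * x * (r (int l) - 1))"
      using m_pos q ql Suc unfolding t_def r_def by (simp add: field_simps)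
    finally show ?thesis .
  qed
  finally have 1: "\<bar>t - r (int k) * (1 + 3 * x * (r (int l) - 1))\<bar> \<le> 2720 * C * p" by simp
  \<comment> \<open>Since \<open>l = k - 1\<close>, the value \<open>l / m\<close> misses
    \<open>t\<close> by \<open>1 / m\<close>; this is the source of
    \<open>6 * x / m\<close>.\<close>
  have "\<bar>r (int l) - t\<bar> \<le> 80 * C * x + 1 / m"
  proof -
    have "t = real l / m + 1 / m" "0 \<le> 1 / m" using Suc m_pos by (auto simp: t_def add_divide_distrib)
    then show ?thesis using rl(1) by linarith
  qed
  then have "\<bar>r (int k) * (3 * x) * (r (int l) - t)\<bar> \<le> 2 * (3 * x) * (80 * C * x + 1 / m)"
    unfolding abs_mult using rk x_pos by (intro mult_mono) auto
  also have "\<dots> = 480 * (x\<^sup>2 * C) + 6 * x / m" by (simp add: power2_eq_square algebra_simps)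
  also have "\<dots> \<le> 480 * (p * C) + 6 * x / m" using x2C by simp
  finally have 2: "\<bar>r (int k) * (3 * x) * (r (int l) - t)\<bar> \<le> 480 * (C * p) + 6 * x / m" by (simp add: mult_ac)
  have "\<bar>3 * x * (t - 1) * (r (int k) - t)\<bar> \<le> 3 * x * 1 * (80 * C * x)"
    unfolding abs_mult using rk t0 x_pos by (intro mult_mono) auto
  also have "\<dots> = 240 * (x\<^sup>2 * C)" by (simp add: power2_eq_square)
  also have "\<dots> \<le> 240 * (p * C)" using x2C by simp
  finally have 3: "\<bar>3 * x * (t - 1) * (r (int k) - t)\<bar> \<le> 240 * (C * p)" by (simp add: mult_ac)
  have "r (int k) - t + 3 * x * (t - 1) * t
    = - (t - r (int k) * (1 + 3 * x * (r (int l) - 1))) - r (int k) * (3 * x) * (r (int l) - t)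
      - 3 * x * (t - 1) * (r (int k) - t)"
    by (simp add: algebra_simps)
  then show ?thesis using 1 2 3 by linarith
qed

text \<open>In the recursion of second order, the term with \<open>x\<close> must be evaluated by
  the corrected \<open>ratio1\<close>, which produces \<open>- 9 x^2 (t - 1) t\<close>; in the terms
  with \<open>x^2\<close> the crude \<open>ratio0\<close> is accurate enough.\<close>

lemma ratio2:
  assumes k: "real k \<le> (1 - \<epsilon>) * m"
  defines "t \<equiv> real k / m"
  defines "u \<equiv> (real k + 1) * q (int k + 1) / (m * q (int k))"
  shows "\<bar>u - 1\<bar> \<le> 40 * C * x"
    "\<bar>u - (1 + 3 * x * (t - 1) - 9 * x\<^sup>2 * (t - 1) * t + 21 / 2 * x\<^sup>2 * (t - 1)\<^sup>2)\<bar> \<le> 60000 * C / n"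
proof -
  have q: "0 < q (int k)" using k q_pos cdf_le_q by blast
  note cdf = cdf_le_q[OF k]
  have scale: "\<bar>u - a\<bar> \<le> b" if "\<bar>(real k + 1) * q (int k + 1) - m * (a * q (int k))\<bar> \<le> m * (b * q (int k))" for a b
  proof -
    have "\<bar>u - a\<bar> = \<bar>((real k + 1) * q (int k + 1) - m * (a * q (int k))) / (m * q (int k))\<bar>"
      using m_pos q by (simp add: u_def field_simps)
    also have "\<dots> = \<bar>(real k + 1) * q (int k + 1) - m * (a * q (int k))\<bar> / (m * q (int k))"
      using m_pos q by simp
    also have "\<dots> \<le> b" using that m_pos q by (simp add: divide_le_eq mult_ac)
    finally show ?thesis .
  qed
  show "\<bar>u - 1\<bar> \<le> 40 * C * x"
  proof (rule scale)
    have "40 * x * cdf (int k) \<le> 40 * x * (C * q (int k))" using cdf x_pos by (intro mult_left_mono) auto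
    from mult_left_mono[OF this less_imp_le[OF m_pos]] have b: "m * (40 * x * cdf (int k)) \<le> m * (40 * C * x * q (int k))"
      by (simp only: mult_ac)
    show "\<bar>(real k + 1) * q (int k + 1) - m * (1 * q (int k))\<bar> \<le> m * (40 * C * x * q (int k))"
      by (rule order_trans[OF _ b]) (use recursion0[of "int k"] in simp)
  qed
  define rr where "rr = q (int k - 2) / q (int k)"
  have u: "\<bar>u - (1 + 3 * x * (r (int k) - 1) + 21 / 2 * x\<^sup>2 * (rr - 2 * r (int k) + 1))\<bar> \<le> 40000 / n * C"
  proof (rule scale)
    have "40000 / n * cdf (int k) \<le> 40000 / n * (C * q (int k))" using cdf by (intro mult_left_mono) auto
    from mult_left_mono[OF this less_imp_le[OF m_pos]] have "m * (40000 / n * cdf (int k)) \<le> m * (40000 / n * C * q (int k))"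
      by (simp only: mult_ac)
    moreover have "(1 + 3 * x * (r (int k) - 1) + 21 / 2 * x\<^sup>2 * (rr - 2 * r (int k) + 1)) * q (int k)
      = q (int k) + 3 * x * (q (int k - 1) - q (int k)) + 21 / 2 * x\<^sup>2 * (q (int k - 2) - 2 * q (int k - 1) + q (int k))"
      using q by (simp add: r_def rr_def field_simps)
    ultimately show "\<bar>(real k + 1) * q (int k + 1) - m * ((1 + 3 * x * (r (int k) - 1) + 21 / 2 * x\<^sup>2 * (rr - 2 * r (int k) + 1)) * q (int k))\<bar>
        \<le> m * (40000 / n * C * q (int k))"
      using recursion2[of "int k"] by simp
  qed
  note rk = ratio0[OF k, folded t_def]
  have t0: "0 \<le> t" using m_pos by (simp add: t_def)
  \<comment> \<open>\<open>rr\<close> is a product of two consecutive ratios, so it is near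
    \<open>t^2\<close>; the term \<open>2 / m\<close> comes from the one taken at
    \<open>k - 1\<close>.\<close>
  have rr: "\<bar>rr - t\<^sup>2\<bar> \<le> 240 * C * x + 2 / m"
  proof (cases k)
    case 0
    then show ?thesis using x_pos C_ge m_pos by (simp add: rr_def t_def q_neg)
  next
    case (Suc l)
    have l: "real l \<le> (1 - \<epsilon>) * m" using k Suc by simp
    have ql: "0 < q (int l)" using l q_pos cdf_le_q by blast
    have "\<bar>r (int l) - t\<bar> \<le> 80 * C * x + 1 / m"
    proof -
      have "t = real l / m + 1 / m" "0 \<le> 1 / m" using Suc m_pos by (auto simp: t_def add_divide_distrib)
      then show ?thesis using ratio0(1)[OF l] by linarith
    qed
    then have 1: "\<bar>r (int k) * (r (int l) - t)\<bar> \<le> 2 * (80 * C * x + 1 / m)"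
      unfolding abs_mult using rk by (intro mult_mono) auto
    have 2: "\<bar>t * (r (int k) - t)\<bar> \<le> 1 * (80 * C * x)"
      unfolding abs_mult using rk t0 by (intro mult_mono) auto
    have "rr = r (int k) * r (int l)" using ql Suc by (simp add: rr_def r_def)
    then have "rr - t\<^sup>2 = r (int k) * (r (int l) - t) + t * (r (int k) - t)"
      by (simp add: power2_eq_square algebra_simps)
    moreover have "2 * (80 * C * x + 1 / m) = 160 * C * x + 2 / m" by simp
    ultimately show ?thesis using 1 2 by (simp only:)
  qed
  have e1: "\<bar>3 * x * (r (int k) - t + 3 * x * (t - 1) * t)\<bar> \<le> 10320 * (C / n) + 18 / n"
  proof -
    have "\<bar>3 * x * (r (int k) - t + 3 * x * (t - 1) * t)\<bar> \<le> 3 * x * (3440 * C * p + 6 * x / m)"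
      unfolding abs_mult using ratio1[OF k, folded t_def] x_pos by (intro mult_mono) auto
    also have "\<dots> = 10320 * (C * (x * p)) + 18 * (x\<^sup>2 / m)" by (simp add: power2_eq_square algebra_simps)
    also have "\<dots> \<le> 10320 * (C * (1 / n)) + 18 * (1 / n)"
      using xp_le x2m_le C_ge by (intro add_mono mult_left_mono) auto
    finally show ?thesis by simp
  qed
  have e2: "\<bar>21 / 2 * x\<^sup>2 * (rr - t\<^sup>2)\<bar> \<le> 2520 * (C / n) + 21 / n"
  proof -
    have "\<bar>21 / 2 * x\<^sup>2 * (rr - t\<^sup>2)\<bar> \<le> 21 / 2 * x\<^sup>2 * (240 * C * x + 2 / m)"
      unfolding abs_mult using rr by (intro mult_mono) auto
    also have "\<dots> = 2520 * (C * x ^ 3) + 21 * (x\<^sup>2 / m)" by (simp add: power2_eq_square power3_eq_cube algebra_simps)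
    also have "\<dots> \<le> 2520 * (C * (1 / n)) + 21 * (1 / n)"
      using x3_le x2m_le C_ge by (intro add_mono mult_left_mono) auto
    finally show ?thesis by simp
  qed
  have e3: "\<bar>21 * x\<^sup>2 * (r (int k) - t)\<bar> \<le> 1680 * (C / n)"
  proof -
    have "\<bar>21 * x\<^sup>2 * (r (int k) - t)\<bar> \<le> 21 * x\<^sup>2 * (80 * C * x)"
      unfolding abs_mult using rk by (intro mult_mono) auto
    also have "\<dots> = 1680 * (C * x ^ 3)" by (simp add: power2_eq_square power3_eq_cube)
    also have "\<dots> \<le> 1680 * (C * (1 / n))" using x3_le C_ge by (intro mult_left_mono) auto
    finally show ?thesis by simp
  qed
  have eq: "u - (1 + 3 * x * (t - 1) - 9 * x\<^sup>2 * (t - 1) * t + 21 / 2 * x\<^sup>2 * (t - 1)\<^sup>2)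
    = (u - (1 + 3 * x * (r (int k) - 1) + 21 / 2 * x\<^sup>2 * (rr - 2 * r (int k) + 1)))
      + 3 * x * (r (int k) - t + 3 * x * (t - 1) * t) + 21 / 2 * x\<^sup>2 * (rr - t\<^sup>2) - 21 * x\<^sup>2 * (r (int k) - t)"
    by (simp add: power2_eq_square field_simps)
  have "1 / real n \<le> C / n" using C_ge by (intro divide_right_mono) auto
  moreover have "40000 / n * C = 40000 * (C / n)" "60000 * C / n = 60000 * (C / n)" "18 / real n = 18 * (1 / n)" "21 / real n = 21 * (1 / n)" by auto
  ultimately show "\<bar>u - (1 + 3 * x * (t - 1) - 9 * x\<^sup>2 * (t - 1) * t + 21 / 2 * x\<^sup>2 * (t - 1)\<^sup>2)\<bar> \<le> 60000 * C / n"
    unfolding eq using u e1 e2 e3 by linarith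
qed

text \<open>A discrete antiderivative: \<open>\<Phi>' t / m\<close> equals the increment
  \<open>3 x (t - 1) - x^2 (t - 1) (3 t + 6)\<close> of the logarithm found in
  \<open>ln_near_quadratic\<close>. With \<open>m\<close> replaced by \<open>n^3 p^3 / 6\<close> it
  is the exponent of the theorem.\<close>

definition \<Phi> :: "real \<Rightarrow> real" where
  "\<Phi> t = m * (3 / 2 * x * (1 - t)\<^sup>2 - 1 / 2 * x\<^sup>2 * (1 - t)\<^sup>2 * (2 * t + 7))"

lemma \<Phi>_step:
  assumes "0 \<le> t" "t \<le> 1" "m \<ge> 1"
  shows "\<bar>\<Phi> (t + 1 / m) - \<Phi> t - (3 * x * (t - 1) - x\<^sup>2 * (t - 1) * (3 * t + 6))\<bar> \<le> 7 * x / m"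
proof -
  define h where "h = 1 / m"
  have h: "0 < h" "h \<le> 1" "m * h = 1" using assms(3) by (auto simp: h_def)
  have "\<Phi> (t + h) - \<Phi> t = m * h * (3 / 2 * x * (2 * (t - 1) + h)
      - 1 / 2 * x\<^sup>2 * (6 * t\<^sup>2 + 6 * t - 12 + h * (6 * t + 3) + 2 * h\<^sup>2))"
    by (simp add: \<Phi>_def power2_eq_square field_simps)
  also have "\<dots> = (3 * x * (t - 1) - x\<^sup>2 * (t - 1) * (3 * t + 6))
      + (3 / 2 * (x * h) - 1 / 2 * (x\<^sup>2 * (h * (6 * t + 3 + 2 * h))))"
    unfolding h(3) by (simp add: power2_eq_square field_simps)
  finally have eq: "\<Phi> (t + h) - \<Phi> t - (3 * x * (t - 1) - x\<^sup>2 * (t - 1) * (3 * t + 6))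
      = 3 / 2 * (x * h) - 1 / 2 * (x\<^sup>2 * (h * (6 * t + 3 + 2 * h)))" by simp
  have "x\<^sup>2 \<le> x" using x_pos x_le by (simp add: power2_eq_square mult_left_le_one_le)
  then have "x\<^sup>2 * (h * (6 * t + 3 + 2 * h)) \<le> x * (h * 11)"
    using assms h x_pos by (intro mult_mono) auto
  moreover have "0 \<le> x\<^sup>2 * (h * (6 * t + 3 + 2 * h))" using assms h by simp
  moreover have "0 \<le> x * h" using x_pos h by simp
  ultimately have "\<bar>3 / 2 * (x * h) - 1 / 2 * (x\<^sup>2 * (h * (6 * t + 3 + 2 * h)))\<bar> \<le> 7 * (x * h)" by linarith
  then show ?thesis using eq by (simp add: h_def)
qed

lemma ln_q:
  assumes "real k \<le> (1 - \<epsilon>) * m"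
  shows "\<bar>ln (q (int k)) - ln (q 0) - (real k * ln m - ln (fact k)) - (\<Phi> (real k / m) - \<Phi> 0)\<bar>
    \<le> real k * (300000 * C ^ 3 / n + 7 * x / m)"
  using assms
proof (induction k)
  case 0
  then show ?case by simp
next
  case (Suc k)
  then have k: "real k \<le> (1 - \<epsilon>) * m" by simp
  define t u where "t = real k / m" and "u = (real k + 1) * q (int k + 1) / (m * q (int k))"
  have q: "0 < q (int k)" using k q_pos cdf_le_q by blast
  have q': "0 < q (int k + 1)" using Suc.prems q_pos[of "Suc k"] cdf_le_q[of "Suc k"] by (simp add: add.commute)
  note u = ratio2[OF k, folded t_def u_def]
  have t: "0 \<le> t" "t \<le> 1" using ratio0(4)[OF k] m_pos by (auto simp: t_def)
  have "(1 - \<epsilon>) * m \<le> 1 * m" using eps m_pos by (intro mult_right_mono) auto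
  \<comment> \<open>\<open>Suc k \<le> m\<close> forces \<open>m \<ge> 1\<close>, so the step width
    \<open>1 / m\<close> in \<open>\<Phi>_step\<close> is at most 1; the base case
    \<open>k = 0\<close> is exact.\<close>
  then have m1: "1 \<le> m" using Suc.prems by simp
  have n0: "0 < real n" using n_ge by simp
  have A: "\<bar>ln u - (3 * x * (t - 1) - x\<^sup>2 * (t - 1) * (3 * t + 6))\<bar> \<le> 300000 * C ^ 3 / n"
    by (rule ln_near_quadratic[OF n0 C_ge _ x3_le Cx_le(2) t u]) (use x_pos in simp)
  have B: "\<bar>\<Phi> (t + 1 / m) - \<Phi> t - (3 * x * (t - 1) - x\<^sup>2 * (t - 1) * (3 * t + 6))\<bar> \<le> 7 * x / m"
    by (rule \<Phi>_step[OF t m1])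
  have lnu: "ln u = ln (real k + 1) + ln (q (int k + 1)) - (ln m + ln (q (int k)))"
    unfolding u_def using q q' m_pos by (subst ln_div) (auto simp: ln_mult)
  have f: "ln (fact (Suc k)) = ln (real k + 1) + ln (fact k :: real)"
    by (simp add: ln_mult add.commute)
  have t': "real (Suc k) / m = t + 1 / m" by (simp add: t_def add_divide_distrib)
  have S: "real (Suc k) * w = real k * w + w" for w by (simp add: algebra_simps)
  have i: "int (Suc k) = int k + 1" by simp
  have aux: "\<bar>lq' - l0 - (km + lm - (lk + lf)) - (\<Phi>' - \<Phi>0)\<bar> \<le> w + (c + d)"
    if "\<bar>(lk + lq' - (lm + lq)) - v\<bar> \<le> c" "\<bar>\<Phi>' - \<Phi>1 - v\<bar> \<le> d" "\<bar>lq - l0 - (km - lf) - (\<Phi>1 - \<Phi>0)\<bar> \<le> w"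
    for lq' l0 km lm lk lf \<Phi>' \<Phi>0 \<Phi>1 w c d v lq :: real
    using that by linarith
  show ?case
    unfolding t' S f i using A B Suc.IH[OF k, folded t_def] unfolding lnu by (rule aux)
qed

end

section \<open>Triangle-free graphs and the asymptotics\<close>

text \<open>The three powers of \<open>p\<close> are the integral from 0 of
  \<open>n^2/2 (x - 5/2 x^2 + 49/6 x^3)\<close> with \<open>x = n s^2\<close>. Adding them to the
  logarithm leaves a function \<open>g\<close> whose derivative is only
  \<open>O(n^2 s^2)\<close>.\<close>

lemma ln_triangle_free:
  assumes "sparse_gnp n p"
  shows "\<bar>ln (sparse_gnp.q n p 0) + real n ^ 3 * p ^ 3 / 6 - real n ^ 4 * p ^ 5 / 4 + 7 / 12 * real n ^ 5 * p ^ 7\<bar>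
    \<le> 30000 * (real n ^ 2 * p ^ 3)"
proof -
  interpret sparse_gnp n p by fact
  define Q where "Q = (\<lambda>s. bern_exp s K (\<lambda>A. of_bool (num_triangles n A = 0)))"
  define g where "g = (\<lambda>s. ln (Q s) + real n ^ 3 * s ^ 3 / 6 - real n ^ 4 * s ^ 5 / 4 + 7 / 12 * real n ^ 5 * s ^ 7)"
  \<comment> \<open>The hypotheses on the density pass to every smaller probability, so the
    derivative is controlled along the whole interval.\<close>
  have sp: "sparse_gnp n s" if "0 < s" "s \<le> p" for s
  proof
    have "real n ^ 2 * s ^ 3 \<le> real n ^ 2 * p ^ 3"
      using that by (intro mult_left_mono power_mono) auto
    then show "real n ^ 2 * s ^ 3 \<le> 1" using dens by simp
  qed (use that p_le n_ge in auto)
  have qQ: "sparse_gnp.q n s 0 = Q s" if "0 < s" "s \<le> p" for s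
    by (simp add: sparse_gnp.q_def[OF sp[OF that]] Q_def)
  have Qpos: "0 < Q s" if "0 < s" "s \<le> p" for s
    using sparse_gnp.q0_pos[OF sp[OF that]] qQ[OF that] by simp
  have Q0: "Q 0 = 1"
  proof -
    have "Q 0 = (\<Sum>A\<in>Pow K. if A = {} then of_bool (num_triangles n {} = 0) else 0)"
      unfolding Q_def bern_exp_def
    proof (rule sum.cong[OF refl])
      fix A assume "A \<in> Pow K"
      then have "finite A" using finite_subset[OF _ finite_K] by blast
      then show "0 ^ card A * (1 - 0) ^ card (K - A) * of_bool (num_triangles n A = 0)
          = (if A = {} then of_bool (num_triangles n {} = 0) else 0 :: real)"
        by (auto simp: power_0_left)
    qed
    moreover have "num_triangles n {} = 0"
      using new_triangles_empty[of "{}" "{}"] by (simp add: new_triangles_def)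
    ultimately show ?thesis by simp
  qed
  have Qcont: "isCont Q s" for s
    unfolding Q_def using DERIV_bern_exp[OF finite_K] by (rule DERIV_isCont)
  have Qge: "Q s \<noteq> 0" if "0 \<le> s" "s \<le> p" for s
    using that Qpos[of s] Q0 by (cases "s = 0") auto
  have D: "\<exists>d. (g has_real_derivative d) (at s) \<and> \<bar>d\<bar> \<le> 30000 * real n ^ 2 * s\<^sup>2" if s: "0 < s" "s \<le> p" for s
  proof -
    define x' where "x' = real n * s\<^sup>2"
    obtain d where d: "(Q has_real_derivative d) (at s)"
      "\<bar>d + real n ^ 2 / 2 * (x' - 5 / 2 * x'\<^sup>2 + 49 / 6 * x' ^ 3) * Q s\<bar> \<le> 30000 * real n ^ 2 * s\<^sup>2 * Q s"
      using sparse_gnp.q0_derivative[OF sp[OF s]] qQ[OF s]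
      unfolding Q_def sparse_gnp.x_def[OF sp[OF s]] x'_def by auto
    define w where "w = real n ^ 2 / 2 * (x' - 5 / 2 * x'\<^sup>2 + 49 / 6 * x' ^ 3)"
    have "(g has_real_derivative (1 / Q s * d + real n ^ 3 * (3 * s ^ 2) / 6 - real n ^ 4 * (5 * s ^ 4) / 4
        + 7 / 12 * real n ^ 5 * (7 * s ^ 6))) (at s)"
      unfolding g_def using Qpos[OF s]
      by (auto intro!: derivative_eq_intros d(1) simp: algebra_simps)
    moreover have "1 / Q s * d + real n ^ 3 * (3 * s ^ 2) / 6 - real n ^ 4 * (5 * s ^ 4) / 4
        + 7 / 12 * real n ^ 5 * (7 * s ^ 6) = (d + w * Q s) / Q s"
    proof -
      have "w = real n ^ 3 * (3 * s ^ 2) / 6 - real n ^ 4 * (5 * s ^ 4) / 4 + 7 / 12 * real n ^ 5 * (7 * s ^ 6)"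
        unfolding w_def x'_def by (simp add: field_simps eval_nat_numeral)
      then show ?thesis using Qpos[OF s] by (simp add: add_divide_distrib)
    qed
    moreover have "\<bar>(d + w * Q s) / Q s\<bar> \<le> 30000 * real n ^ 2 * s\<^sup>2"
      using d(2) Qpos[OF s] by (simp add: w_def pos_divide_le_eq)
    ultimately show ?thesis by metis
  qed
  \<comment> \<open>The mean value theorem replaces integration: the bound on the derivative
    increases with \<open>s\<close>, and \<open>g 0 = 0\<close> because
    \<open>Q 0 = 1\<close>.\<close>
  have "\<exists>l z. 0 < z \<and> z < p \<and> (g has_real_derivative l) (at z) \<and> g p - g 0 = (p - 0) * l"
  proof (rule MVT)
    show "continuous_on {0..p} g"
      unfolding g_def using Qge continuous_at_imp_continuous_on[of "{0..p}" Q] Qcont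
      by (intro continuous_intros) auto
    show "\<And>z. 0 < z \<Longrightarrow> z < p \<Longrightarrow> g differentiable at z"
      unfolding real_differentiable_def using D by (meson less_imp_le)
  qed (fact p_pos)
  then obtain l z where z: "0 < z" "z < p" "(g has_real_derivative l) (at z)" "g p - g 0 = p * l" by auto
  obtain d where d: "(g has_real_derivative d) (at z)" "\<bar>d\<bar> \<le> 30000 * real n ^ 2 * z\<^sup>2"
    using D[of z] z by auto
  have "l = d" using z(3) d(1) by (rule DERIV_unique)
  have "z\<^sup>2 \<le> p\<^sup>2" using z by (intro power_mono) auto
  then have "\<bar>l\<bar> \<le> 30000 * real n ^ 2 * p\<^sup>2"
    using d(2) \<open>l = d\<close> mult_left_mono[of "z\<^sup>2" "p\<^sup>2" "30000 * real n ^ 2"] by simp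
  then have "\<bar>p * l\<bar> \<le> p * (30000 * real n ^ 2 * p\<^sup>2)"
    unfolding abs_mult using p_pos by (intro mult_mono) auto
  moreover have "g 0 = 0" by (simp add: g_def Q0)
  ultimately have "\<bar>g p\<bar> \<le> 30000 * (real n ^ 2 * p ^ 3)"
    using z(4) by (simp add: power2_eq_square power3_eq_cube mult_ac)
  then show ?thesis using qQ[of p] p_pos by (simp add: g_def)
qed

section \<open>Assembly of the exponent\<close>

context lower_tail
begin

text \<open>\<open>\<Phi>\<close> is normalized by \<open>m\<close>, the theorem by
  \<open>M = n^3 p^3 / 6\<close>, and the two differ by at most \<open>n^2 p^3 / 2\<close>. Since
  \<open>\<Psi>\<close> is bounded and Lipschitz on the unit interval, replacing both the factor
  \<open>m\<close> and the argument \<open>k/m\<close> costs a multiple of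
  \<open>M - m\<close>.\<close>

lemma exponent_approx:
  assumes k: "real k \<le> (1 - \<epsilon>) * m"
  defines "\<theta> \<equiv> theta n p k"
  shows "\<bar>\<Phi> (real k / m) - ((1 - \<theta>)\<^sup>2 / 4 * real n ^ 4 * p ^ 5 - (1 - \<theta>)\<^sup>2 * (2 * \<theta> + 7) / 12 * real n ^ 5 * p ^ 7)\<bar>
    \<le> 11 * (real n ^ 2 * p ^ 3)"
proof -
  define M t where "M = real n ^ 3 * p ^ 3 / 6" and "t = real k / m"
  define \<Psi> where "\<Psi> s = 3 / 2 * x * (1 - s)\<^sup>2 - 1 / 2 * x\<^sup>2 * (1 - s)\<^sup>2 * (2 * s + 7)" for s
  have M: "m \<le> M" "M - m \<le> real n ^ 2 * p ^ 3 / 2"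
  proof -
    show "m \<le> M" using m_le by (simp add: M_def)
    have "M - m = (3 * real n ^ 2 - 2 * n) / 6 * p ^ 3"
      unfolding M_def mu_def choose_three_real by (simp add: power2_eq_square power3_eq_cube field_simps)
    also have "\<dots> \<le> (3 * real n ^ 2) / 6 * p ^ 3" using p01 by (intro mult_right_mono divide_right_mono) auto
    finally show "M - m \<le> real n ^ 2 * p ^ 3 / 2" by simp
  qed
  have Mpos: "0 < M" using M m_pos by linarith
  have th: "\<theta> = real k / M" by (simp add: \<theta>_def theta_def M_def)
  have t: "0 \<le> t" "t \<le> 1" using ratio0(4)[OF k] m_pos by (auto simp: t_def)
  have "\<theta> \<le> t" unfolding th t_def using M m_pos by (intro divide_left_mono) auto
  have \<theta>: "0 \<le> \<theta>" "\<theta> \<le> 1" using \<open>\<theta> \<le> t\<close> t Mpos by (simp add: th, linarith)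
  have x2: "x\<^sup>2 \<le> 1" using x_le x_pos by (simp add: power_le_one)
  have \<Psi>: "\<bar>\<Psi> \<theta>\<bar> \<le> 6"
  proof -
    have s: "(1 - \<theta>)\<^sup>2 \<le> 1" using \<theta> by (simp add: power_le_one)
    have "x * (1 - \<theta>)\<^sup>2 \<le> 1 * 1" using x_le x_pos s by (intro mult_mono) auto
    moreover have "x\<^sup>2 * (1 - \<theta>)\<^sup>2 * (2 * \<theta> + 7) \<le> 1 * 1 * 9" using x2 s \<theta> by (intro mult_mono) auto
    moreover have "0 \<le> x * (1 - \<theta>)\<^sup>2" "0 \<le> x\<^sup>2 * (1 - \<theta>)\<^sup>2 * (2 * \<theta> + 7)" using x_pos \<theta> by auto
    ultimately show ?thesis unfolding \<Psi>_def abs_le_iff by linarith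
  qed
  have lip: "\<bar>\<Psi> t - \<Psi> \<theta>\<bar> \<le> 15 * (t - \<theta>)"
  proof -
    have eq: "\<Psi> t - \<Psi> \<theta> = (t - \<theta>) * (3 / 2 * (x * (t + \<theta> - 2)) - 1 / 2 * (x\<^sup>2 * (2 * (t\<^sup>2 + t * \<theta> + \<theta>\<^sup>2) + 3 * (t + \<theta>) - 12)))"
      by (simp add: \<Psi>_def power2_eq_square field_simps)
    have "\<bar>x * (t + \<theta> - 2)\<bar> \<le> 1 * 2" unfolding abs_mult using x_pos x_le t \<theta> by (intro mult_mono) auto
    moreover have "\<bar>x\<^sup>2 * (2 * (t\<^sup>2 + t * \<theta> + \<theta>\<^sup>2) + 3 * (t + \<theta>) - 12)\<bar> \<le> 1 * 24"
    proof -
      have "t\<^sup>2 \<le> 1" "\<theta>\<^sup>2 \<le> 1" "t * \<theta> \<le> 1" "0 \<le> t * \<theta>" using t \<theta> by (auto simp: power_le_one mult_le_one)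
      moreover have "\<bar>2 * (a + b + c) + 3 * (d + e) - 12\<bar> \<le> 24"
        if "a \<le> 1" "c \<le> 1" "b \<le> 1" "0 \<le> b" "0 \<le> a" "0 \<le> c" "0 \<le> d" "d \<le> 1" "0 \<le> e" "e \<le> 1" for a b c d e :: real
        using that by (auto simp: abs_le_iff)
      note this[of "t\<^sup>2" "\<theta>\<^sup>2" "t * \<theta>" t \<theta>]
      ultimately have "\<bar>2 * (t\<^sup>2 + t * \<theta> + \<theta>\<^sup>2) + 3 * (t + \<theta>) - 12\<bar> \<le> 24"
        using t \<theta> zero_le_power2 by blast
      then show ?thesis unfolding abs_mult using x2 by (intro mult_mono) auto
    qed
    ultimately have "\<bar>3 / 2 * (x * (t + \<theta> - 2)) - 1 / 2 * (x\<^sup>2 * (2 * (t\<^sup>2 + t * \<theta> + \<theta>\<^sup>2) + 3 * (t + \<theta>) - 12))\<bar> \<le> 15"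
      by linarith
    then show ?thesis
      unfolding eq abs_mult[of "t - \<theta>"] mult.commute[of 15] using \<open>\<theta> \<le> t\<close> by (intro mult_mono) auto
  qed
  \<comment> \<open>Both \<open>m * t\<close> and \<open>M * \<theta>\<close> equal
    \<open>k\<close>, so the factor \<open>m\<close> compensates for the division hidden in
    \<open>t - \<theta>\<close>.\<close>
  have mt: "m * (t - \<theta>) \<le> M - m"
  proof -
    have "m * (t - \<theta>) = \<theta> * (M - m)" using m_pos Mpos by (simp add: t_def th field_simps)
    also have "\<dots> \<le> 1 * (M - m)" using \<theta> M by (intro mult_right_mono) auto
    finally show ?thesis by simp
  qed
  have "\<bar>m * (\<Psi> t - \<Psi> \<theta>)\<bar> \<le> m * (15 * (t - \<theta>))"
    unfolding abs_mult using lip m_pos by (simp add: mult_left_mono)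
  also have "m * (15 * (t - \<theta>)) = 15 * (m * (t - \<theta>))" by simp
  also have "\<dots> \<le> 15 * (M - m)" using mt by simp
  finally have 1: "\<bar>m * (\<Psi> t - \<Psi> \<theta>)\<bar> \<le> 15 * (M - m)" .
  have 2: "\<bar>(M - m) * \<Psi> \<theta>\<bar> \<le> (M - m) * 6"
    unfolding abs_mult using \<Psi> M by (intro mult_mono) auto
  have "(1 - \<theta>)\<^sup>2 / 4 * real n ^ 4 * p ^ 5 - (1 - \<theta>)\<^sup>2 * (2 * \<theta> + 7) / 12 * real n ^ 5 * p ^ 7 = M * \<Psi> \<theta>"
    by (simp add: M_def \<Psi>_def x_def field_simps eval_nat_numeral)
  moreover have "\<Phi> t = m * \<Psi> t" by (simp add: \<Phi>_def \<Psi>_def)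
  moreover have "m * \<Psi> t - M * \<Psi> \<theta> = m * (\<Psi> t - \<Psi> \<theta>) - (M - m) * \<Psi> \<theta>" by (simp add: algebra_simps)
  moreover have "\<bar>a - b\<bar> \<le> 11 * y" if "\<bar>a\<bar> \<le> 15 * d" "\<bar>b\<bar> \<le> d * 6" "d \<le> y / 2" for a b d y :: real
    using that by linarith
  note this[OF 1 2 M(2)]
  ultimately show ?thesis unfolding t_def[symmetric] by (simp only:)
qed

lemma ln_prob:
  assumes k: "real k \<le> (1 - \<epsilon>) * m"
  defines "\<theta> \<equiv> theta n p k"
  shows "\<bar>ln (q (int k)) - (real k * ln m - m - ln (fact k)
      + ((1 - \<theta>)\<^sup>2 / 4 * real n ^ 4 * p ^ 5 - (1 - \<theta>)\<^sup>2 * (2 * \<theta> + 7) / 12 * real n ^ 5 * p ^ 7))\<bar>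
    \<le> 90000 * C ^ 3 * (real n ^ 2 * p ^ 3) + 7 * x"
proof -
  define y where "y = real n ^ 2 * p ^ 3"
  have y0: "0 \<le> y" using p01 by (simp add: y_def)
  have k0: "real 0 \<le> (1 - \<epsilon>) * m" using eps m_pos by simp
  note e1 = exponent_approx[OF k, folded \<theta>_def y_def]
  \<comment> \<open>The case \<open>k = 0\<close> evaluates \<open>\<Phi> 0\<close>, to be cancelled
    against the correction terms in \<open>ln (q 0)\<close>.\<close>
  have e0: "\<bar>\<Phi> 0 - (real n ^ 4 * p ^ 5 / 4 - 7 / 12 * real n ^ 5 * p ^ 7)\<bar> \<le> 11 * y"
    using exponent_approx[OF k0] by (simp add: theta_def y_def)
  have l0: "\<bar>ln (q 0) + real n ^ 3 * p ^ 3 / 6 - real n ^ 4 * p ^ 5 / 4 + 7 / 12 * real n ^ 5 * p ^ 7\<bar> \<le> 30000 * y"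
    unfolding y_def by (rule ln_triangle_free) unfold_locales
  have m': "\<bar>real n ^ 3 * p ^ 3 / 6 - m\<bar> \<le> y / 2"
  proof -
    have "real n ^ 3 * p ^ 3 / 6 - m = (3 * real n ^ 2 - 2 * n) / 6 * p ^ 3"
      unfolding mu_def choose_three_real by (simp add: power2_eq_square power3_eq_cube field_simps)
    also have "\<dots> \<le> (3 * real n ^ 2) / 6 * p ^ 3" using p01 by (intro mult_right_mono divide_right_mono) auto
    finally show ?thesis using m_le by (simp add: y_def)
  qed
  have "(1 - \<epsilon>) * m \<le> 1 * m" using eps m_pos by (intro mult_right_mono) auto
  then have km: "real k \<le> m" using k by simp
  have n0: "0 < real n" using n_ge by simp
  have C3: "1 \<le> C ^ 3" using C_ge by simp
  have "real k * (300000 * C ^ 3 / n + 7 * x / m) \<le> m * (300000 * C ^ 3 / n + 7 * x / m)"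
    using km C_ge x_pos m_pos by (intro mult_right_mono add_nonneg_nonneg divide_nonneg_nonneg) auto
  also have "\<dots> = m / n * (300000 * C ^ 3) + 7 * x" using m_pos by (simp add: field_simps)
  \<comment> \<open>At most \<open>m\<close> steps of error \<open>1/n\<close> each: here the sum
    becomes a multiple of \<open>n^2 p^3\<close>, which tends to 0.\<close>
  also have "m / n * (300000 * C ^ 3) \<le> y / 6 * (300000 * C ^ 3)"
  proof (rule mult_right_mono)
    have "m / n \<le> (real n ^ 3 * p ^ 3 / 6) / n" using m_le by (intro divide_right_mono) auto
    also have "\<dots> = y / 6" using n0 by (simp add: y_def power2_eq_square power3_eq_cube)
    finally show "m / n \<le> y / 6" .
  qed (use C_ge in simp)
  finally have b: "real k * (300000 * C ^ 3 / n + 7 * x / m) \<le> 50000 * (C ^ 3 * y) + 7 * x" by (simp add: mult_ac)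
  have lq: "\<bar>ln (q (int k)) - ln (q 0) - (real k * ln m - ln (fact k)) - (\<Phi> (real k / m) - \<Phi> 0)\<bar>
      \<le> 50000 * (C ^ 3 * y) + 7 * x"
    using ln_q[OF k] b by linarith
  have yC: "y \<le> C ^ 3 * y" using C3 y0 mult_right_mono[of 1 "C ^ 3" y] by simp
  have aux: "\<bar>lq - (km - mm - lf + E)\<bar> \<le> 90000 * cy + z"
    if "\<bar>lq - l0 - (km - lf) - (ph - ph0)\<bar> \<le> 50000 * cy + z" "\<bar>ph - E\<bar> \<le> 11 * y" "\<bar>ph0 - (a - b)\<bar> \<le> 11 * y"
      "\<bar>l0 + M - a + b\<bar> \<le> 30000 * y" "\<bar>M - mm\<bar> \<le> y / 2" "y \<le> cy" "0 \<le> y"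
    for lq km mm lf E cy z l0 ph ph0 a b M :: real
    using that by linarith
  show ?thesis
    using aux[OF lq e1 e0 l0 m' yC y0] by (simp add: y_def mult.assoc)
qed

end

theorem theorem1p1:
  fixes \<epsilon> :: real and p :: "nat \<Rightarrow> real" and k :: "nat \<Rightarrow> nat"
  assumes "\<epsilon> > 0"
    and "\<And>n. 0 < p n \<and> p n < 1"
    and "p \<in> o(\<lambda>n. real n powr (- 2 / 3))"
    and "\<And>n. real (k n) \<le> (1 - \<epsilon>) * (real (n choose 3) * p n ^ 3)"
  shows "(\<lambda>n. measure_pmf.prob (erdos_renyi n (p n)) {E. num_triangles n E = k n})
           \<sim>[at_top]
         (\<lambda>n. mu n (p n) ^ k n * exp (- mu n (p n)) / fact (k n) *
              exp ((1 - theta n (p n) (k n))\<^sup>2 / 4 * real n ^ 4 * p n ^ 5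
                   - (1 - theta n (p n) (k n))\<^sup>2 * (2 * theta n (p n) (k n) + 7) / 12
                       * real n ^ 5 * p n ^ 7))"
    (is "?f \<sim>[at_top] ?g")
proof -
  \<comment> \<open>Shrinking \<open>\<epsilon>\<close> only enlarges the admissible range of
    \<open>k\<close> and provides the bound 1/2 required by \<open>lower_tail\<close>.\<close>
  define \<epsilon>' where "\<epsilon>' = min \<epsilon> (1 / 2)"
  have eps': "0 < \<epsilon>'" "\<epsilon>' \<le> 1 / 2" "\<epsilon>' \<le> \<epsilon>" using assms(1) by (auto simp: \<epsilon>'_def)
  define y where "y n = real n ^ 2 * p n ^ 3" for n
  define x' where "x' n = real n * p n ^ 2" for n
  \<comment> \<open>All smallness is expressed through \<open>c\<close>: for
    \<open>n \<ge> 1\<close>, \<open>n^2 p^3 = c^3\<close>, \<open>n p^2 \<le> c^2\<close> and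
    \<open>p \<le> c\<close>.\<close>
  define c where "c n = p n / real n powr (- 2 / 3)" for n
  have c: "c \<longlonglongrightarrow> 0" unfolding c_def using assms(3) by (rule smalloD_tendsto)
  have pc: "p n = c n * real n powr (- 2 / 3)" if "n \<ge> 1" for n
    using that by (simp add: c_def)
  have c_pos: "0 \<le> c n" for n using assms(2)[of n] by (simp add: c_def)
  have y_eq: "y n = c n ^ 3" if "n \<ge> 1" for n
  proof -
    have "(real n powr (- 2 / 3)) ^ 3 = real n powr (- 2)"
      using that by (simp flip: powr_realpow add: powr_powr)
    then have "(real n powr (- 2 / 3)) ^ 3 = 1 / real n ^ 2"
      using that by (simp add: powr_minus_divide)
    then show ?thesis using that by (simp add: y_def pc[OF that] power_mult_distrib)
  qed
  have x'_le: "x' n \<le> c n ^ 2" if "n \<ge> 1" for n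
  proof -
    have "(real n powr (- 2 / 3)) ^ 2 = real n powr (- 4 / 3)"
      using that by (simp flip: powr_realpow add: powr_powr)
    also have "\<dots> \<le> real n powr (- 1)" using that by (intro powr_mono) auto
    finally have "(real n powr (- 2 / 3)) ^ 2 \<le> 1 / n" using that by (simp add: powr_minus_divide)
    then have "real n * (c n ^ 2 * (real n powr (- 2 / 3)) ^ 2) \<le> real n * (c n ^ 2 * (1 / n))"
      by (intro mult_left_mono) auto
    then show ?thesis using that by (simp add: x'_def pc[OF that] power_mult_distrib)
  qed
  have p_le: "p n \<le> c n" if "n \<ge> 1" for n
  proof -
    have "real n powr (- 2 / 3) \<le> real n powr 0" using that by (intro powr_mono) auto
    then show ?thesis using that c_pos[of n] pc[OF that] mult_left_le[of "real n powr (- 2 / 3)" "c n"] by simp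
  qed
  have ev1: "eventually (\<lambda>n. n \<ge> 1) (at_top :: nat filter)" by (rule eventually_ge_at_top)
  have y: "y \<longlonglongrightarrow> 0"
  proof (rule Lim_transform_eventually)
    show "(\<lambda>n. c n ^ 3) \<longlonglongrightarrow> 0" using tendsto_power[OF c, of 3] by simp
    show "eventually (\<lambda>n. c n ^ 3 = y n) at_top" using ev1 by eventually_elim (simp add: y_eq)
  qed
  have x': "x' \<longlonglongrightarrow> 0"
  proof (rule Lim_null_comparison)
    show "(\<lambda>n. c n ^ 2) \<longlonglongrightarrow> 0" using tendsto_power[OF c, of 2] by simp
    show "eventually (\<lambda>n. norm (x' n) \<le> c n ^ 2) at_top" using ev1 by eventually_elim (simp add: x'_le, simp add: x'_def x'_le[unfolded x'_def])
  qed
  define C' where "C' = 1 + 2 / \<epsilon>'"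
  define \<delta> where "\<delta> n = ln (?f n) - ln (?g n)" for n
  have ev: "eventually (\<lambda>n. lower_tail n (p n) \<epsilon>') at_top"
  proof -
    have "eventually (\<lambda>n. c n < 1 / 20) at_top" using c by (rule order_tendstoD) auto
    moreover have "eventually (\<lambda>n. y n < 1) at_top" using y by (rule order_tendstoD) auto
    moreover have "eventually (\<lambda>n. x' n < \<epsilon>' / 2 / (40 * (1 + 2 / \<epsilon>'))) at_top"
      using x' by (rule order_tendstoD) (use eps' in \<open>auto intro!: divide_pos_pos add_pos_pos\<close>)
    moreover have "eventually (\<lambda>n. n \<ge> 5) (at_top :: nat filter)" by (rule eventually_ge_at_top)
    ultimately show ?thesis
    proof eventually_elim
      case (elim n)
      have sp: "sparse_gnp n (p n)"
        using elim assms(2)[of n] p_le[of n] by unfold_locales (auto simp: y_def)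
      have "0 < 40 * (1 + 2 / \<epsilon>')" using eps' by (simp add: add_pos_pos)
      then have "x' n * (40 * (1 + 2 / \<epsilon>')) < \<epsilon>' / 2" using elim(3) by (simp only: pos_less_divide_eq)
      then have "40 * x' n * (1 + 2 / \<epsilon>') \<le> \<epsilon>' / 2" by (simp add: algebra_simps)
      then have "lower_tail_axioms n (p n) \<epsilon>'"
        using eps' by (intro lower_tail_axioms.intro) (auto simp: sparse_gnp.x_def[OF sp] x'_def)
      then show ?case using sp by (intro lower_tail.intro)
    qed
  qed
  have key: "eventually (\<lambda>n. norm (\<delta> n) \<le> 90000 * C' ^ 3 * y n + 7 * x' n \<and> ?f n / ?g n = exp (\<delta> n)) at_top"
    using ev
  proof eventually_elim
    case (elim n)
    interpret lower_tail n "p n" \<epsilon>' by fact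
    have "real (k n) \<le> (1 - \<epsilon>) * mu n (p n)" using assms(4)[of n] by (simp add: mu_def)
    also have "\<dots> \<le> (1 - \<epsilon>') * mu n (p n)" using eps' m_pos by (intro mult_right_mono) auto
    finally have k: "real (k n) \<le> (1 - \<epsilon>') * mu n (p n)" .
    have f: "?f n = q (int (k n))"
      using p01 by (simp add: prob_erdos_renyi q_def)
    have fpos: "0 < ?f n" unfolding f using k q_pos cdf_le_q by blast
    have gpos: "0 < ?g n" using m_pos by simp
    have "ln (?g n) = real (k n) * ln m - m - ln (fact (k n))
      + ((1 - theta n (p n) (k n))\<^sup>2 / 4 * real n ^ 4 * p n ^ 5
         - (1 - theta n (p n) (k n))\<^sup>2 * (2 * theta n (p n) (k n) + 7) / 12 * real n ^ 5 * p n ^ 7)"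
      using m_pos by (simp add: ln_mult ln_div ln_realpow)
    then have "norm (\<delta> n) \<le> 90000 * C' ^ 3 * y n + 7 * x' n"
      using ln_prob[OF k] unfolding \<delta>_def f
      by (simp add: y_def x'_def C'_def C_def x_def)
    moreover have "?f n / ?g n = exp (\<delta> n)"
      using fpos gpos by (simp add: \<delta>_def exp_diff)
    ultimately show ?case by blast
  qed
  have "\<delta> \<longlonglongrightarrow> 0"
  proof (rule Lim_null_comparison)
    show "(\<lambda>n. 90000 * C' ^ 3 * y n + 7 * x' n) \<longlonglongrightarrow> 0"
      using tendsto_add[OF tendsto_mult_right_zero[OF y] tendsto_mult_right_zero[OF x']] by simp
  qed (use key in \<open>auto elim: eventually_mono\<close>)
  then have "(\<lambda>n. exp (\<delta> n)) \<longlonglongrightarrow> 1" using tendsto_exp[of \<delta> 0] by simp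
  moreover have "eventually (\<lambda>n. exp (\<delta> n) = ?f n / ?g n) at_top" using key by eventually_elim simp
  ultimately have "(\<lambda>n. ?f n / ?g n) \<longlonglongrightarrow> 1" by (rule Lim_transform_eventually)
  then show ?thesis by (rule asymp_equivI')
qed

end
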